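(* For every $\varepsilon>0$ there exists $\delta_0>0$ such that the following holds. For every $K>0$ there is a constant $c=c(\varepsilon,K)>0$ such that, for every prime $p$, every non-principal multiplicative character $\chi$ modulo $p$, every integer $N$ with $p^{1/8+\varepsilon}\le N<p^{1/2}$, and all sequences of complex numbers $\boldsymbol\alpha=(\alpha_a)_{a\ge 1}$ and $\boldsymbol\beta=(\beta_b)_{b\ge 1}$ with $|\alpha_a|\le K$ and $|\beta_b|\le K$ for all $a,b\ge 1$, one has $$\left|U_\chi(\boldsymbol\alpha,\boldsymbol\beta,N)\right|\le c\,N^{4-\delta_0},$$ where $$U_\chi(\boldsymbol\alpha,\boldsymbol\beta,N)=\sum_{1\le a\le N}\alpha_a\sum_{1\le b\le N}\beta_b\sum_{1\le c\le N}\ \sum_{1\le d\le N}\chi(ad-bc).$$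
   Context: A multiplicative character $\chi$ modulo $p$ is viewed as a function on $\mathbb Z$ (Dirichlet character), with $\chi(n)=0$ when $p\mid n$. *)

theory Defs
  imports Complex_Main "HOL-Number_Theory.Number_Theory"
begin

text \<open>
  A multiplicative character modulo \<open>q\<close>, in its guise as a function on the integers: it is constant on
  residue classes, completely multiplicative, and vanishes exactly at the integers not coprime to
  \<open>q\<close>. (For \<open>q\<close> prime these are the multiples of \<open>q\<close>.)
\<close>

definition dirichlet_character :: "nat \<Rightarrow> (int \<Rightarrow> complex) \<Rightarrow> bool" where
  "dirichlet_character q \<chi> \<longleftrightarrow>
     (\<forall>m n. [m = n] (mod int q) \<longrightarrow> \<chi> m = \<chi> n) \<and>
     (\<forall>m n. \<chi> (m * n) = \<chi> m * \<chi> n) \<and>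
     (\<forall>n. \<chi> n = 0 \<longleftrightarrow> \<not> coprime n (int q))"

definition principal_character :: "nat \<Rightarrow> int \<Rightarrow> complex" where
  "principal_character q n = (if coprime n (int q) then 1 else 0)"

definition nonprincipal_character :: "nat \<Rightarrow> (int \<Rightarrow> complex) \<Rightarrow> bool" where
  "nonprincipal_character q \<chi> \<longleftrightarrow> dirichlet_character q \<chi> \<and> \<chi> \<noteq> principal_character q"

lemma dirichlet_character_principal: "dirichlet_character q (principal_character q)"
  unfolding dirichlet_character_def principal_character_def
  by (auto simp: cong_imp_coprime cong_sym dest: cong_imp_coprime cong_sym)

lemma dirichlet_character_one:
  assumes "dirichlet_character q \<chi>"
  shows "\<chi> 1 = 1"
proof -
  have "\<chi> 1 * \<chi> 1 = \<chi> 1" "\<chi> 1 \<noteq> 0"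
    using assms unfolding dirichlet_character_def by (metis mult_1, simp)
  then show ?thesis by simp
qed

lemma dirichlet_character_prime_eq_0_iff:
  assumes "dirichlet_character p \<chi>" "prime p"
  shows "\<chi> n = 0 \<longleftrightarrow> int p dvd n"
  using assms unfolding dirichlet_character_def
  by (metis coprime_commute coprime_absorb_left not_prime_unit prime_imp_coprime prime_int_nat_transfer
      prime_nat_int_transfer)

text \<open>The values \<open>\<alpha> 0\<close> and \<open>\<beta> 0\<close> do not enter: the sequences are indexed from 1.\<close>

definition U_sum :: "(int \<Rightarrow> complex) \<Rightarrow> (nat \<Rightarrow> complex) \<Rightarrow> (nat \<Rightarrow> complex) \<Rightarrow> nat \<Rightarrow> complex" where
  "U_sum \<chi> \<alpha> \<beta> N =
     (\<Sum>a = 1..N. \<alpha> a * (\<Sum>b = 1..N. \<beta> b *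
        (\<Sum>c = 1..N. \<Sum>d = 1..N. \<chi> (int a * int d - int b * int c))))"

end

theory Submission
  imports Defs "HOL-Computational_Algebra.Computational_Algebra" "HOL-Analysis.Convex"
begin

text \<open>
For fixed coefficients \<open>a, b\<close> the inner double sum \<open>W(a, b) = \<Sum>c,d\<le>N. \<chi>(a d - b c)\<close> already saves a
power of \<open>N\<close> for almost all pairs, so the weights \<open>\<alpha>, \<beta>\<close> only cost the factor \<open>K\<^sup>2\<close>. The reason is
that a linear form with coefficients of size about \<open>N\<close> and small common divisor takes about \<open>N\<^sup>2\<close>
values, each of them rarely more than a few times, and \<open>N\<^sup>2\<close> exceeds \<open>p\<^bsup>1/4\<^esup>\<close> by a power of \<open>p\<close>, which is
Burgess's threshold.

When \<open>4 N\<^sup>4 < p\<close> (lemma \<open>short_range_bound\<close>), shift \<open>(c, d)\<close> by \<open>t (-u, v)\<close> with \<open>u, v \<le> V = N\<^bsup>1-2\<epsilon>\<^esup>\<close> and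
\<open>t \<le> T = N\<^sup>\<epsilon>\<close>. This moves \<open>x = a d - b c\<close> to \<open>x + t y\<close> with \<open>y = a v + b u\<close>, and averaging over the shifts
replaces \<open>W(a, b)\<close> by sums \<open>\<Sum>t\<le>T. \<chi>(x/y + t)\<close> over many residues \<open>x/y\<close>. Hoelder's inequality
separates two factors (\<open>burgess_inequality\<close>). One is the number of solutions of \<open>x y' = x' y\<close>
modulo \<open>p\<close>; as \<open>4 N\<^sup>3 V < p\<close> this is an equation in integers, and the divisor bound leaves hardly more
than the diagonal solutions (\<open>card_proportional_le\<close>). The other is a complete high moment of \<open>\<Sum>t\<le>T. \<chi>(\<lambda> + t)\<close> over all residues \<open>\<lambda>\<close> (\<open>moment_bound\<close>). When \<open>p \<le> 4 N\<^sup>4\<close>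
(\<open>long_range_bound\<close>) no shift is needed: \<open>\<chi>(a d - b c) = \<chi>(a) \<chi>(d - b c/a)\<close>, the residues \<open>b c/a\<close> are
well distributed, and the fourth moment suffices.

The moment rests on Weil's bound \<open>weil_bound\<close> for \<open>\<Sum>c. \<chi>(\<Prod>r. (c + r)\<^bsup>e r\<^esup>)\<close> over the residues modulo
\<open>p\<close>, with square root cancellation and a constant that depends on the number of factors alone. It is
only needed when one exponent is coprime to \<open>p - 1\<close>: after expanding a moment this fails only for the
few tuples in which no entry occurs exactly once. The L-function
\<open>L(z) = \<Sum>g. \<chi>(\<Prod>r. g(r)\<^bsup>e r\<^esup>) z\<^bsup>deg g\<^esup>\<close>, summed over monic polynomials \<open>g\<close> over the field with \<open>p\<close>
elements, is a polynomial whose degree is less than the number of factors (\<open>L_coeff_vanishes\<close>), and its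
linear coefficient is the sum to be bounded. Unique factorisation yields Newton's identities
(\<open>newton_identity\<close>), which express the power sums of its inverse roots as character sums over the field
with \<open>p\<^sup>n\<close> elements. Stepanov's method bounds these by a multiple of \<open>p\<^bsup>n/2\<^esup>\<close>
(\<open>stepanov_polynomial\<close>, \<open>point_sum_bound\<close>). The multiple may depend on \<open>p\<close>, because \<open>n\<close> is unbounded:
growth of the power sums at rate \<open>\<surd>p\<close> forces every inverse root to have modulus at most \<open>\<surd>p\<close>
(\<open>newton_root_bound\<close>).
\<close>

section \<open>Integer polynomials modulo a prime\<close>

text \<open>
The modulus is a term and not a type, because \<open>p\<close> is universally quantified in the theorem. Polynomials over
the field with \<open>p\<close> elements are therefore represented by integer polynomials up to congruence.
\<close>

locale char_p =
  fixes p :: nat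
  assumes prime_p: "prime p"
begin

text \<open>
Congruence modulo the ideal \<open>(p, P)\<close>. With \<open>P = 0\<close> it is coefficientwise congruence modulo \<open>p\<close>; with \<open>P\<close>
prime it is equality in a finite field extension, whose elements are the points in Stepanov's method.
\<close>

definition cg :: "int poly \<Rightarrow> int poly \<Rightarrow> int poly \<Rightarrow> bool" where
  "cg P a b \<longleftrightarrow> (\<exists>u v. a - b = of_nat p * u + P * v)"

lemma cgI: "a - b = of_nat p * u + P * v \<Longrightarrow> cg P a b"
  unfolding cg_def by blast

lemma cgE:
  assumes "cg P a b"
  obtains u v where "a = b + of_nat p * u + P * v"
  using assms unfolding cg_def by (metis add.assoc add.commute diff_add_cancel)

lemma cg_refl [simp]: "cg P a a"
  by (rule cgI[of _ _ 0 _ 0]) simp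

lemma cg_sym: assumes "cg P a b" shows "cg P b a"
proof -
  obtain u v where "a = b + of_nat p * u + P * v" using assms by (rule cgE)
  then show ?thesis by (intro cgI[of _ _ "- u" _ "- v"]) simp
qed

lemma cg_add: assumes "cg P a b" "cg P c d" shows "cg P (a + c) (b + d)"
proof -
  obtain u v where a: "a = b + of_nat p * u + P * v" using assms(1) by (rule cgE)
  obtain u' v' where c: "c = d + of_nat p * u' + P * v'" using assms(2) by (rule cgE)
  show ?thesis by (rule cgI[of _ _ "u + u'" _ "v + v'"]) (simp add: a c algebra_simps)
qed

lemma cg_trans [trans]: assumes "cg P a b" "cg P b c" shows "cg P a c"
proof -
  have "cg P (a + b) (b + c)" using assms by (rule cg_add)
  then show ?thesis unfolding cg_def by (simp add: algebra_simps)
qed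

lemma cg_minus: assumes "cg P a b" shows "cg P (- a) (- b)"
proof -
  obtain u v where "a = b + of_nat p * u + P * v" using assms by (rule cgE)
  then show ?thesis by (intro cgI[of _ _ "- u" _ "- v"]) simp
qed

lemma cg_diff: "cg P a b \<Longrightarrow> cg P c d \<Longrightarrow> cg P (a - c) (b - d)"
  using cg_add[OF _ cg_minus, of P a b c d] by simp

lemma cg_mult:
  assumes "cg P a b" "cg P c d" shows "cg P (a * c) (b * d)"
proof -
  obtain u v where a: "a = b + of_nat p * u + P * v" using assms(1) by (rule cgE)
  obtain u' v' where c: "c = d + of_nat p * u' + P * v'" using assms(2) by (rule cgE)
  show ?thesis
    by (rule cgI[of _ _ "u * c + b * u'" _ "v * c + b * v'"]) (simp add: a c algebra_simps)
qed

lemma cg_power: "cg P a b \<Longrightarrow> cg P (a ^ n) (b ^ n)"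
  by (induction n) (simp_all add: cg_mult)

lemma cg_sum: "(\<And>x. x \<in> A \<Longrightarrow> cg P (f x) (g x)) \<Longrightarrow> cg P (sum f A) (sum g A)"
  by (induction A rule: infinite_finite_induct) (simp_all add: cg_add)

lemma cg_prod: "(\<And>x. x \<in> A \<Longrightarrow> cg P (f x) (g x)) \<Longrightarrow> cg P (prod f A) (prod g A)"
  by (induction A rule: infinite_finite_induct) (simp_all add: cg_mult)

lemma cg_mono: assumes "cg 0 a b" shows "cg P a b"
proof -
  obtain u v where "a = b + of_nat p * u + 0 * v" using assms by (rule cgE)
  then show ?thesis by (intro cgI[of _ _ u _ 0]) simp
qed

lemma cg_modulus [simp]: "cg P (P * v) 0" "cg P (v * P) 0"
  by (rule cgI[of _ _ 0 _ v], simp)+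

lemma cg_diff_iff: "cg P a b \<longleftrightarrow> cg P (a - b) 0"
  unfolding cg_def by simp

lemma cg_mult_0: "cg P a 0 \<Longrightarrow> cg P (a * b) 0" "cg P a 0 \<Longrightarrow> cg P (b * a) 0"
  using cg_mult[of P a 0 b b] cg_mult[of P b b a 0] by simp_all

lemma cg_0_iff_dvd: "cg 0 a b \<longleftrightarrow> of_nat p dvd a - b"
  unfolding cg_def dvd_def by simp

lemma of_nat_dvd_poly_iff: "(of_nat p :: int poly) dvd f \<longleftrightarrow> (\<forall>i. int p dvd coeff f i)"
  unfolding of_nat_poly const_poly_dvd_iff by simp

lemma cg_0_iff: "cg 0 a b \<longleftrightarrow> (\<forall>i. [coeff a i = coeff b i] (mod int p))"
  unfolding cg_0_iff_dvd of_nat_dvd_poly_iff by (simp add: cong_iff_dvd_diff)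

lemma prime_elem_of_nat_poly: "prime_elem (of_nat p :: int poly)"
  unfolding of_nat_poly prime_elem_const_poly_iff using prime_p by simp

lemma p_gt_1: "p > 1" using prime_p by (rule prime_gt_1_nat)

lemma cg_const_iff: "cg 0 [:a:] [:b:] \<longleftrightarrow> [a = b] (mod int p)"
  unfolding cg_0_iff by (auto simp: coeff_pCons split: nat.splits)

lemma cg_0_mult_iff: "cg 0 (a * b) 0 \<longleftrightarrow> cg 0 a 0 \<or> cg 0 b 0"
  unfolding cg_0_iff_dvd using prime_elem_of_nat_poly by (simp add: prime_elem_dvd_mult_iff)

lemma cong_power_p: "[(c::int) ^ p = c] (mod int p)"
proof (cases "int p dvd c")
  case True
  moreover from True have "int p dvd c ^ p" using p_gt_1
    by (meson dvd_power_le dvd_trans le_refl dvd_power less_trans zero_less_one)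
  ultimately show ?thesis by (simp add: cong_iff_dvd_diff)
next
  case False
  then have "coprime c (int p)" using prime_p
    by (metis coprime_commute prime_imp_coprime prime_nat_int_transfer)
  have "residues_prime p" by standard (rule prime_p)
  have "[c ^ totient p = 1] (mod int p)"
    using \<open>coprime c (int p)\<close> p_gt_1 residues.euler_theorem[of "int p" c]
    by (simp add: residues_def)
  then have "[c ^ (p - 1) * c = 1 * c] (mod int p)"
    using prime_p by (intro cong_mult) (simp_all add: totient_prime)
  then show ?thesis using p_gt_1 by (cases p) (simp_all add: mult.commute)
qed

lemma freshman: "cg 0 ((a + b) ^ p) (a ^ p + b ^ p)"
proof -
  have "(a + b) ^ p = (\<Sum>k\<le>p. of_nat (p choose k) * a ^ k * b ^ (p - k))"
    by (rule binomial_ring)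
  also have "{..p} = insert 0 (insert p {1..<p})" using p_gt_1 by auto
  also have "(\<Sum>k\<in>\<dots>. of_nat (p choose k) * a ^ k * b ^ (p - k)) =
      b ^ p + (a ^ p + (\<Sum>k\<in>{1..<p}. of_nat (p choose k) * a ^ k * b ^ (p - k)))"
    using p_gt_1 by simp
  finally have eq: "(a + b) ^ p - (a ^ p + b ^ p) =
      (\<Sum>k\<in>{1..<p}. of_nat (p choose k) * a ^ k * b ^ (p - k))" by simp
  have "of_nat p dvd (\<Sum>k\<in>{1..<p}. of_nat (p choose k) * a ^ k * b ^ (p - k))"
  proof (intro dvd_sum dvd_mult2)
    fix k assume "k \<in> {1..<p}"
    then have "p dvd (p choose k)" using prime_p by (intro dvd_choose_prime) auto
    then show "(of_nat p :: int poly) dvd of_nat (p choose k)" by (auto simp: dvd_def)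
  qed
  then show ?thesis unfolding cg_0_iff_dvd eq .
qed

lemma frobenius_1: "cg 0 (g ^ p) (pcompose g (monom 1 p))"
proof (induction g)
  case 0
  then show ?case using p_gt_1 by (simp add: zero_power)
next
  case (pCons c g)
  have "cg 0 (([:c:] + [:0,1:] * g) ^ p) ([:c:] ^ p + ([:0,1:] * g) ^ p)" by (rule freshman)
  also have "cg 0 ([:c:] ^ p + ([:0,1:] * g) ^ p) ([:c:] + monom 1 p * pcompose g (monom 1 p))"
  proof (rule cg_add)
    show "cg 0 ([:c:] ^ p) [:c:]"
      by (simp add: poly_const_pow cg_const_iff cong_power_p)
    have "cg 0 (monom 1 p * g ^ p) (monom 1 p * pcompose g (monom 1 p))"
      by (intro cg_mult cg_refl pCons.IH)
    moreover have "([:0,1:] * g) ^ p = monom 1 p * g ^ p"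
      unfolding power_mult_distrib by (simp add: monom_altdef)
    ultimately show "cg 0 (([:0,1:] * g) ^ p) (monom 1 p * pcompose g (monom 1 p))"
      by (simp only:)
  qed
  finally show ?case by (simp add: pcompose_pCons)
qed

lemma mono_comp: "pcompose (monom (1::int) a) (monom 1 b) = monom 1 (a * b)"
  by (induction a) (simp_all add: monom_Suc pcompose_pCons mult_monom monom_0 add.commute)

text \<open>
Raising to the exponent \<open>p ^ s\<close> is additive modulo \<open>p\<close> and fixes constants, hence acts by substitution in the
variable.
\<close>

lemma frobenius: "cg 0 (g ^ (p ^ s)) (pcompose g (monom 1 (p ^ s)))"
proof (induction s arbitrary: g)
  case 0
  have "monom 1 1 = [:0, 1::int:]" by (simp add: monom_altdef)
  then show ?case by simp
next
  case (Suc s)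
  have "g ^ (p ^ Suc s) = (g ^ p ^ s) ^ p" by (simp add: power_mult [symmetric] mult.commute)
  also have "cg 0 \<dots> ((pcompose g (monom 1 (p ^ s))) ^ p)" by (intro cg_power Suc.IH)
  also have "cg 0 \<dots> (pcompose (pcompose g (monom 1 (p ^ s))) (monom 1 p))" by (rule frobenius_1)
  also have "\<dots> = pcompose g (monom 1 (p ^ Suc s))"
    by (simp add: pcompose_assoc [symmetric] mono_comp power_commutes)
  finally show ?case .
qed

definition red :: "int poly \<Rightarrow> int poly" where
  "red g = map_poly (\<lambda>c. c mod int p) g"

text \<open>
Canonical representatives of the polynomials of degree below \<open>L\<close>, and in \<open>Mon\<close> of the monic ones of degree \<open>n\<close>:
sums and pigeonhole arguments over polynomials modulo \<open>p\<close> run over these finite sets.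
\<close>

definition Red :: "nat \<Rightarrow> int poly set" where
  "Red L = {g. (\<forall>i<L. coeff g i \<in> {0..<int p}) \<and> (\<forall>i\<ge>L. coeff g i = 0)}"

definition Mon :: "nat \<Rightarrow> int poly set" where
  "Mon n = {g. coeff g n = 1 \<and> (\<forall>i<n. coeff g i \<in> {0..<int p}) \<and> (\<forall>i>n. coeff g i = 0)}"

lemma coeff_red [simp]: "coeff (red g) i = coeff g i mod int p"
  unfolding red_def by (simp add: coeff_map_poly)

lemma cg_red [simp]: "cg P (red g) g" "cg P g (red g)"
proof -
  have "cg 0 (red g) g" unfolding cg_0_iff by (simp add: cong_def)
  then show "cg P (red g) g" "cg P g (red g)" by (auto intro: cg_mono cg_sym)
qed

lemma red_eq_iff: "red g = red h \<longleftrightarrow> cg 0 g h"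
  unfolding cg_0_iff poly_eq_iff by (simp add: cong_def)

lemma red_in_Red: "(\<And>i. i \<ge> L \<Longrightarrow> int p dvd coeff g i) \<Longrightarrow> red g \<in> Red L"
  unfolding Red_def using p_gt_1 by auto

lemma red_in_Mon:
  "[coeff g n = 1] (mod int p) \<Longrightarrow> (\<And>i. i > n \<Longrightarrow> int p dvd coeff g i) \<Longrightarrow> red g \<in> Mon n"
  unfolding Mon_def using p_gt_1 by (auto simp: cong_def)

lemma Red_eqI: "g \<in> Red L \<Longrightarrow> h \<in> Red L \<Longrightarrow> cg 0 g h \<Longrightarrow> g = h"
  unfolding Red_def cg_0_iff poly_eq_iff
  by (clarsimp simp: cong_def) (metis le_less_linear mod_pos_pos_trivial)

lemma Mon_eqI: "g \<in> Mon n \<Longrightarrow> h \<in> Mon n \<Longrightarrow> cg 0 g h \<Longrightarrow> g = h"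
  unfolding Mon_def cg_0_iff poly_eq_iff
  by (clarsimp simp: cong_def) (metis linorder_neqE_nat mod_pos_pos_trivial)

lemma red_Mon: "g \<in> Mon n \<Longrightarrow> red g = g"
  using p_gt_1 by (intro Mon_eqI[of _ n] red_in_Mon cg_red) (auto simp: Mon_def)

lemma card_Red: "finite (Red L)" "card (Red L) = p ^ L"
proof -
  have bij: "bij_betw (\<lambda>g. restrict (coeff g) {..<L}) (Red L) ({..<L} \<rightarrow>\<^sub>E {0..<int p})"
  proof (rule bij_betw_byWitness[where f' = "\<lambda>f. \<Sum>i<L. monom (f i) i"])
    have cf: "coeff (\<Sum>i<L. monom (f i) i) j = (if j < L then f j else 0)" for f :: "nat \<Rightarrow> int" and j
      by (simp add: coeff_sum if_distrib sum.delta cong: if_cong)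
    show "\<forall>g\<in>Red L. (\<Sum>i<L. monom (restrict (coeff g) {..<L} i) i) = g"
      by (auto simp: poly_eq_iff cf Red_def)
    show "\<forall>f\<in>{..<L} \<rightarrow>\<^sub>E {0..<int p}. restrict (coeff (\<Sum>i<L. monom (f i) i)) {..<L} = f"
      by (auto simp: cf fun_eq_iff PiE_def extensional_def)
    show "(\<lambda>g. restrict (coeff g) {..<L}) ` Red L \<subseteq> {..<L} \<rightarrow>\<^sub>E {0..<int p}"
      by (auto simp: Red_def PiE_def extensional_def)
    show "(\<lambda>f. \<Sum>i<L. monom (f i) i) ` ({..<L} \<rightarrow>\<^sub>E {0..<int p}) \<subseteq> Red L"
      by (auto simp: Red_def cf PiE_def Pi_def)
  qed
  have "finite ({..<L} \<rightarrow>\<^sub>E {0..<int p})" by (intro finite_PiE) auto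
  then show "finite (Red L)" using bij bij_betw_finite by blast
  show "card (Red L) = p ^ L"
    using bij_betw_same_card[OF bij] by (simp add: card_funcsetE)
qed

lemma card_Mon: "finite (Mon n)" "card (Mon n) = p ^ n"
proof -
  have bij: "bij_betw (\<lambda>g. monom 1 n + g) (Red n) (Mon n)"
    by (rule bij_betw_byWitness[where f' = "\<lambda>g. g - monom 1 n"])
       (auto simp: Red_def Mon_def)
  show "finite (Mon n)" using bij card_Red(1) bij_betw_finite by blast
  show "card (Mon n) = p ^ n"
    using bij_betw_same_card[OF bij] by (simp add: card_Red)
qed

lemma Mon_degree: assumes "g \<in> Mon n" shows "degree g = n" "coeff g n = 1"
proof -
  show "coeff g n = 1" using assms by (simp add: Mon_def)
  have "degree g \<le> n" using assms by (intro degree_le) (auto simp: Mon_def)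
  moreover have "n \<le> degree g" using assms by (intro le_degree) (auto simp: Mon_def)
  ultimately show "degree g = n" by simp
qed

lemma Mon_0: "Mon 0 = {1}"
  by (auto simp: Mon_def poly_eq_iff coeff_1)

lemma div_monic:
  fixes f P :: "int poly"
  assumes "coeff P (degree P) = 1"
  shows "\<exists>q s. f = P * q + s \<and> (\<forall>i\<ge>degree P. coeff s i = 0)"
proof -
  obtain q s where qs: "pseudo_divmod f P = (q, s)" by fastforce
  have "P \<noteq> 0" using assms by auto
  from pseudo_divmod[OF this qs] assms have "f = P * q + s" "s = 0 \<or> degree s < degree P" by simp_all
  then show ?thesis by (intro exI[of _ q] exI[of _ s]) (auto intro: coeff_eq_0)
qed

lemma coeff_mult_top:
  fixes P v :: "int poly"
  assumes "degree P \<le> r" "degree v \<le> t"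
  shows "coeff (P * v) (r + t) = coeff P r * coeff v t"
proof -
  have "coeff (P * v) (r + t) = (\<Sum>i\<le>r + t. coeff P i * coeff v (r + t - i))"
    by (simp add: coeff_mult)
  also have "\<dots> = (\<Sum>i\<in>{r}. coeff P i * coeff v (r + t - i))"
  proof (rule sum.mono_neutral_right)
    show "\<forall>i\<in>{..r + t} - {r}. coeff P i * coeff v (r + t - i) = 0"
    proof
      fix i assume "i \<in> {..r + t} - {r}"
      then have "i > r \<or> r + t - i > t" by auto
      then show "coeff P i * coeff v (r + t - i) = 0"
        using assms by (auto simp: coeff_eq_0)
    qed
  qed auto
  finally show ?thesis by simp
qed

text \<open>
The product of a monic polynomial with a polynomial that is nonzero modulo \<open>p\<close> keeps a nonzero coefficient in a
degree not below that of the monic factor.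
\<close>

lemma monic_mult_small:
  assumes P: "coeff P (degree P) = 1" and eq: "cg 0 (P * v) s" and s: "\<And>i. i \<ge> degree P \<Longrightarrow> coeff s i = 0"
  shows "cg 0 v 0" "cg 0 s 0"
proof -
  have "red v = 0"
  proof (rule ccontr)
    assume nz: "red v \<noteq> 0"
    have "cg 0 (P * red v) s" using cg_trans[OF cg_mult[OF cg_refl cg_red(1)] eq] .
    then have "[coeff (P * red v) (degree P + degree (red v)) = coeff s (degree P + degree (red v))] (mod int p)"
      unfolding cg_0_iff by blast
    then have "int p dvd coeff (red v) (degree (red v))"
      using P s by (simp add: coeff_mult_top cong_0_iff)
    moreover have "coeff (red v) (degree (red v)) \<noteq> 0" using nz by (metis leading_coeff_0_iff)
    ultimately show False by (simp add: dvd_eq_mod_eq_0)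
  qed
  then show *: "cg 0 v 0" using cg_red(2)[of 0 v] by simp
  show "cg 0 s 0" using cg_trans[OF cg_sym[OF eq] cg_mult_0(2)[OF *]] .
qed

lemma monic_cancel: "coeff P (degree P) = 1 \<Longrightarrow> cg 0 (P * a) (P * b) \<Longrightarrow> cg 0 a b"
  using monic_mult_small(1)[of P "a - b" 0] by (simp add: cg_diff_iff[of 0 "P * a"] cg_diff_iff[of 0 a] right_diff_distrib)

lemma small_multiple_0:
  assumes P: "coeff P (degree P) = 1" and eq: "cg P s 0" and s: "\<And>i. i \<ge> degree P \<Longrightarrow> coeff s i = 0"
  shows "cg 0 s 0"
proof -
  obtain u v where "s = 0 + of_nat p * u + P * v" using eq by (rule cgE)
  then have "cg 0 (P * v) s" by (intro cg_sym[of 0 s]) (auto intro!: cgI[of _ _ u _ 0])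
  then show ?thesis using monic_mult_small(2) P s by blast
qed

lemma red_mult_Mon: "g \<in> Mon a \<Longrightarrow> h \<in> Mon b \<Longrightarrow> red (g * h) \<in> Mon (a + b)"
  using Mon_degree[of g a] Mon_degree[of h b] degree_mult_le[of g h]
  by (intro red_in_Mon) (auto simp: coeff_mult_top coeff_eq_0)

lemma Mon_quotient:
  assumes P: "P \<in> Mon r" and g: "g \<in> Mon n" and "cg P g 0"
  shows "r \<le> n \<and> (\<exists>h\<in>Mon (n - r). cg 0 g (P * h))"
proof -
  obtain u v where "g = 0 + of_nat p * u + P * v" using assms(3) by (rule cgE)
  then have "cg 0 g (P * v)" by (auto intro!: cgI[of _ _ u _ 0])
  also have "cg 0 (P * v) (P * red v)" by (intro cg_mult cg_refl cg_red)
  finally have gh: "cg 0 g (P * red v)" .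
  define h where "h = red v"
  define t where "t = degree h"
  note Pd = Mon_degree[OF P] and gd = Mon_degree[OF g]
  have co: "[coeff g i = coeff (P * h) i] (mod int p)" for i
    using gh unfolding h_def cg_0_iff by blast
  have h: "0 \<le> coeff h i \<and> coeff h i < int p" for i unfolding h_def using p_gt_1 by simp
  have "h \<noteq> 0" using co[of n] gd p_gt_1 by (auto simp: cong_def)
  then have ht: "coeff h t \<noteq> 0" unfolding t_def by (metis leading_coeff_0_iff)
  have top: "coeff (P * h) (r + t) = coeff h t" using Pd by (simp add: coeff_mult_top t_def)
  have "\<not> int p dvd coeff h t" using h[of t] ht by (metis zdvd_not_zless linorder_neqE_linordered_idom not_less)
  then have "r + t \<le> n" using co[of "r + t"] top gd
    by (metis coeff_eq_0 cong_0_iff cong_sym not_le)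
  moreover have "n \<le> r + t"
  proof (rule ccontr)
    assume "\<not> n \<le> r + t"
    moreover have "degree (P * h) \<le> r + t" using degree_mult_le[of P h] Pd by (simp add: t_def)
    ultimately have "coeff (P * h) n = 0" by (intro coeff_eq_0) simp
    then show False using co[of n] gd p_gt_1 by (simp add: cong_def)
  qed
  ultimately have n: "n = r + t" by simp
  then have "[1 = coeff h t] (mod int p)" using co[of n] gd top by simp
  then have "coeff h t = 1" using h[of t] p_gt_1 by (simp add: cong_def)
  then have "h \<in> Mon t" using h by (auto simp: Mon_def coeff_eq_0 t_def)
  then show ?thesis using gh n by (auto simp: h_def)
qed

end

section \<open>Prime polynomials and their residue fields\<close>

context char_p
begin

lemma cg_0_iff_mult: "cg M g 0 \<longleftrightarrow> (\<exists>v. cg 0 g (M * v))"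
proof
  assume "cg M g 0"
  then obtain u v where "g = 0 + of_nat p * u + M * v" by (rule cgE)
  then show "\<exists>v. cg 0 g (M * v)" by (intro exI[of _ v] cgI[of _ _ u _ 0]) simp
next
  assume "\<exists>v. cg 0 g (M * v)"
  then obtain v where "cg 0 g (M * v)" ..
  then have "cg M g (M * v)" by (rule cg_mono)
  also have "cg M (M * v) 0" by simp
  finally show "cg M g 0" .
qed

lemma cg_dvd_trans: assumes "cg P g 0" "cg M P 0" shows "cg M g 0"
proof -
  obtain v where "cg 0 g (P * v)" using assms(1) cg_0_iff_mult by blast
  then have "cg M g (P * v)" by (rule cg_mono)
  also have "cg M (P * v) 0" using assms(2) by (rule cg_mult_0)
  finally show ?thesis .
qed

lemma cg_modulus_cong: assumes "cg 0 M M'" "cg M a b" shows "cg M' a b"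
proof -
  have "cg M' M M'" using assms(1) by (rule cg_mono)
  also have "cg M' M' 0" using cg_modulus(1)[of M' 1] by simp
  finally show ?thesis using cg_dvd_trans[of M "a - b" M'] assms(2) cg_diff_iff by blast
qed

text \<open>
Irreducible monic polynomials over the field with \<open>p\<close> elements, characterised by the primality of \<open>(p, P)\<close>,
which is the form in which irreducibility is always applied.
\<close>

definition Irr :: "int poly set" where
  "Irr = {P. degree P \<ge> 1 \<and> P \<in> Mon (degree P) \<and> (\<forall>a b. cg P (a * b) 0 \<longrightarrow> cg P a 0 \<or> cg P b 0)}"

lemma IrrD:
  assumes "P \<in> Irr"
  shows "degree P \<ge> 1" "P \<in> Mon (degree P)" "coeff P (degree P) = 1"
    "cg P (a * b) 0 \<Longrightarrow> cg P a 0 \<or> cg P b 0"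
  using assms by (auto simp: Irr_def Mon_def)

lemma normalise_to_monic:
  assumes "\<not> cg 0 s 0" and s: "\<And>i. i \<ge> t \<Longrightarrow> coeff s i = 0"
  obtains c e where "e < t" "red ([:c:] * s) \<in> Mon e"
proof -
  define e where "e = degree (red s)"
  have nz: "red s \<noteq> 0" using assms(1) cg_red(2)[of 0 s] by metis
  then have le: "coeff (red s) e \<noteq> 0" unfolding e_def by (metis leading_coeff_0_iff)
  then have "\<not> int p dvd coeff s e" by (simp add: dvd_eq_mod_eq_0)
  then have "coprime (coeff s e) (int p)" using prime_p
    by (metis coprime_commute prime_imp_coprime prime_nat_int_transfer)
  then obtain c where c: "[coeff s e * c = 1] (mod int p)" using cong_solve_coprime_int by blast
  have "e < t"
  proof (rule ccontr)
    assume "\<not> e < t"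
    then have "coeff s e = 0" using s by simp
    then show False using le by simp
  qed
  moreover have "red ([:c:] * s) \<in> Mon e"
  proof (rule red_in_Mon)
    show "[coeff ([:c:] * s) e = 1] (mod int p)" using c by (simp add: mult.commute)
    fix i assume "i > e"
    then have "coeff (red s) i = 0" unfolding e_def by (rule coeff_eq_0)
    then show "int p dvd coeff ([:c:] * s) i" by (simp add: dvd_eq_mod_eq_0[symmetric])
  qed
  ultimately show ?thesis using that by blast
qed

text \<open>
A monic divisor of least positive degree is prime: if it divides \<open>a b\<close> but not \<open>a\<close>, then the monic generator of
the ideal of it and \<open>a\<close> has degree \<open>0\<close>, so that it divides \<open>b\<close>.
\<close>

lemma prime_divisor_exists:
  assumes g: "g \<in> Mon n" "n \<ge> 1"
  shows "\<exists>P\<in>Irr. cg P g 0"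
proof -
  define Q where "Q r \<longleftrightarrow> r \<ge> 1 \<and> (\<exists>P\<in>Mon r. cg P g 0)" for r
  define r where "r = (LEAST r. Q r)"
  have "Q n" unfolding Q_def using g cg_modulus(1)[of g 1] by auto
  then have "Q r" unfolding r_def by (rule LeastI)
  then obtain P where r: "r \<ge> 1" and P: "P \<in> Mon r" and Pg: "cg P g 0" unfolding Q_def by blast
  have least: "r \<le> t" if "t \<ge> 1" "M \<in> Mon t" "cg M g 0" for M t
    unfolding r_def using that by (intro Least_le) (auto simp: Q_def)
  have "cg P b 0" if ab: "cg P (a * b) 0" and na: "\<not> cg P a 0" for a b
  proof -
    define D where "D t \<longleftrightarrow> (\<exists>M\<in>Mon t. \<exists>u v. cg 0 M (u * a + v * P))" for t
    define t where "t = (LEAST t. D t)"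
    have "cg 0 P (0 * a + 1 * P)" by simp
    then have "D r" unfolding D_def using P by blast
    then have "D t" unfolding t_def by (rule LeastI)
    then obtain M u v where M: "M \<in> Mon t" and uv: "cg 0 M (u * a + v * P)" unfolding D_def by blast
    note Md = Mon_degree[OF M]
    have comb: "cg M (u' * a + v' * P) 0" for u' v'
    proof -
      obtain q s where qs: "u' * a + v' * P = M * q + s" and s: "\<And>i. i \<ge> t \<Longrightarrow> coeff s i = 0"
        using div_monic[of M "u' * a + v' * P"] Md by auto
      have "cg 0 s 0"
      proof (rule ccontr)
        assume "\<not> cg 0 s 0"
        then obtain c e where e: "e < t" "red ([:c:] * s) \<in> Mon e"
          using normalise_to_monic s by blast
        have s_eq: "s = u' * a + v' * P - M * q" using qs by simp
        have "cg 0 ([:c:] * s) ([:c:] * (u' * a + v' * P - (u * a + v * P) * q))"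
          unfolding s_eq by (intro cg_mult cg_diff cg_refl uv)
        also have "[:c:] * (u' * a + v' * P - (u * a + v * P) * q) =
            ([:c:] * (u' - u * q)) * a + ([:c:] * (v' - v * q)) * P"
          by (simp add: algebra_simps)
        finally have "cg 0 (red ([:c:] * s)) (([:c:] * (u' - u * q)) * a + ([:c:] * (v' - v * q)) * P)"
          by (rule cg_trans[OF cg_red(1)])
        then have "D e" unfolding D_def using e by blast
        then have "t \<le> e" unfolding t_def by (rule Least_le)
        then show False using e by simp
      qed
      then have "cg M (M * q + s) (0 + 0)" using cg_mono[of s 0 M] by (intro cg_add) simp_all
      then show ?thesis by (simp add: qs)
    qed
    have MP: "cg M P 0" using comb[of 0 1] by simp
    have Ma: "cg M a 0" using comb[of 1 0] by simp
    have "t = 0"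
    proof (rule ccontr)
      assume "t \<noteq> 0"
      then have "r \<le> t" using least M cg_dvd_trans[OF Pg MP] by simp
      moreover obtain h where "t \<le> r" "h \<in> Mon (r - t)" "cg 0 P (M * h)"
        using Mon_quotient[OF M P MP] by blast
      ultimately have "P = M" using P M by (intro Mon_eqI[of P r M]) (simp_all add: Mon_0)
      then show False using Ma na by simp
    qed
    then have "M = 1" using M by (simp add: Mon_0)
    have "cg P (1 * b) ((u * a + v * P) * b)"
      using uv unfolding \<open>M = 1\<close> by (intro cg_mult[OF cg_mono cg_refl])
    also have "(u * a + v * P) * b = u * (a * b) + P * (v * b)" by (simp add: algebra_simps)
    also have "cg P \<dots> (0 + 0)" by (intro cg_add cg_mult_0 ab cg_modulus)
    finally show ?thesis by simp
  qed
  then have "P \<in> Irr" unfolding Irr_def using r P Mon_degree(1)[OF P] by auto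
  then show ?thesis using Pg by blast
qed

lemma Irr_one: assumes "P \<in> Irr" shows "\<not> cg P 1 0"
proof
  assume "cg P 1 0"
  moreover have "coeff 1 i = (0::int)" if "i \<ge> degree P" for i
    using that IrrD(1)[OF assms] by (simp add: coeff_1)
  ultimately have "cg 0 1 0" by (intro small_multiple_0[OF IrrD(3)[OF assms]])
  then have "[coeff 1 0 = coeff 0 (0::nat)] (mod int p)" unfolding cg_0_iff by blast
  then show False using p_gt_1 by (simp add: cong_0_iff)
qed

lemma Irr_power_0: "P \<in> Irr \<Longrightarrow> cg P (a ^ n) 0 \<Longrightarrow> cg P a 0"
proof (induction n)
  case 0
  then show ?case using Irr_one by simp
next
  case (Suc n)
  then show ?case using IrrD(4)[of P a "a ^ n"] unfolding power_Suc by blast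
qed

lemma Irr_prod_0: "finite A \<Longrightarrow> P \<in> Irr \<Longrightarrow> cg P (prod f A) 0 \<Longrightarrow> \<exists>x\<in>A. cg P (f x) 0"
proof (induction A rule: finite_induct)
  case empty
  then show ?case using Irr_one by simp
next
  case (insert x A)
  then show ?case using IrrD(4)[of P "f x" "prod f A"] by (auto simp del: cg_refl)
qed

lemma Irr_cancel: "P \<in> Irr \<Longrightarrow> \<not> cg P w 0 \<Longrightarrow> cg P (w * a) (w * b) \<Longrightarrow> cg P a b"
  using IrrD(4)[of P w "a - b"] cg_diff_iff[of P a b] cg_diff_iff[of P "w * a" "w * b"]
  by (auto simp: right_diff_distrib)

lemma Red_distinct:
  assumes "P \<in> Irr" "z \<in> Red (degree P)" "z' \<in> Red (degree P)" "cg P z z'"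
  shows "z = z'"
proof (rule Red_eqI)
  have "cg 0 (z - z') 0"
    using assms IrrD[OF assms(1)] cg_diff_iff[of P z z']
    by (intro small_multiple_0[of P]) (auto simp: Red_def)
  then show "cg 0 z z'" by (subst cg_diff_iff)
qed (use assms in auto)

lemma Red_representative:
  assumes "P \<in> Irr"
  shows "\<exists>s\<in>Red (degree P). cg P f s"
proof -
  obtain q s where qs: "f = P * q + s" and s: "\<And>i. i \<ge> degree P \<Longrightarrow> coeff s i = 0"
    using div_monic[of P f] IrrD[OF assms] by auto
  have "cg P (P * q + s) (0 + red s)" by (intro cg_add) simp_all
  then show ?thesis using red_in_Red[of "degree P" s] s qs by auto
qed

text \<open>
Multiplication by \<open>w\<close> permutes the nonzero residues; compare the products of all of them.
\<close>

lemma fermat_Irr_aux: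
  assumes P: "P \<in> Irr" and w: "\<not> cg P w 0"
  shows "cg P (w ^ (p ^ degree P - 1)) 1"
proof -
  define Z where "Z = Red (degree P) - {0}"
  obtain rp where rp: "\<And>f. rp f \<in> Red (degree P) \<and> cg P f (rp f)"
    using Red_representative[OF P] by metis
  have fin: "finite Z" unfolding Z_def using card_Red by simp
  have Znz: "\<not> cg P z 0" if "z \<in> Z" for z
    using Red_distinct[OF P, of z 0] that p_gt_1 by (auto simp: Z_def Red_def)
  have inj: "inj_on (\<lambda>z. rp (w * z)) Z"
  proof (rule inj_onI)
    fix z z' assume z: "z \<in> Z" "z' \<in> Z" and eq: "rp (w * z) = rp (w * z')"
    have "cg P (w * z) (rp (w * z))" using rp by blast
    also have "cg P (rp (w * z)) (w * z')" using rp cg_sym eq by metis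
    finally have "cg P z z'" using Irr_cancel[OF P w] by blast
    then show "z = z'" using Red_distinct[OF P] z by (auto simp: Z_def)
  qed
  have "(\<lambda>z. rp (w * z)) ` Z \<subseteq> Z"
  proof clarify
    fix z assume z: "z \<in> Z"
    have "rp (w * z) \<noteq> 0"
      using rp[of "w * z"] IrrD(4)[OF P, of w z] w Znz[OF z] by auto
    then show "rp (w * z) \<in> Z" using rp by (auto simp: Z_def)
  qed
  then have im: "(\<lambda>z. rp (w * z)) ` Z = Z"
    using endo_inj_surj[OF fin _ inj] by blast
  have "cg P (\<Prod>z\<in>Z. w * z) (\<Prod>z\<in>Z. rp (w * z))" by (intro cg_prod) (use rp in blast)
  also have "(\<Prod>z\<in>Z. rp (w * z)) = \<Prod>Z"
    using prod.reindex[OF inj, of "\<lambda>z. z"] im by simp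
  finally have "cg P (\<Prod>Z * w ^ card Z) (\<Prod>Z * 1)" by (simp add: prod.distrib mult.commute)
  then have "cg P (w ^ card Z) 1"
    using Irr_cancel[OF P] Irr_prod_0[OF fin P] Znz by blast
  moreover have "0 \<in> Red (degree P)" using p_gt_1 by (simp add: Red_def)
  then have "card Z = p ^ degree P - 1"
    unfolding Z_def using card_Red[of "degree P"] by simp
  ultimately show ?thesis by simp
qed

lemma fermat_Irr:
  assumes P: "P \<in> Irr"
  shows "cg P (w ^ (p ^ degree P)) w"
proof (cases "cg P w 0")
  case True
  have "cg P (w ^ (p ^ degree P)) (0 ^ (p ^ degree P))" using True by (rule cg_power)
  also have "0 ^ (p ^ degree P) = (0 :: int poly)" using p_gt_1 by (simp add: zero_power)
  also have "cg P 0 w" using True by (rule cg_sym)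
  finally show ?thesis .
next
  case False
  have "w ^ (p ^ degree P) = w * w ^ (p ^ degree P - 1)"
    using p_gt_1 by (simp flip: power_Suc)
  also have "cg P \<dots> (w * 1)" by (intro cg_mult cg_refl fermat_Irr_aux P False)
  finally show ?thesis by simp
qed

lemma fermat_Irr_mult:
  assumes P: "P \<in> Irr"
  shows "cg P (w ^ (p ^ (degree P * t))) w"
proof (induction t)
  case (Suc t)
  have "w ^ (p ^ (degree P * Suc t)) = (w ^ (p ^ (degree P * t))) ^ (p ^ degree P)"
    by (simp add: power_mult [symmetric] power_add [symmetric] algebra_simps)
  also have "cg P \<dots> (w ^ (p ^ (degree P * t)))" by (rule fermat_Irr[OF P])
  also note Suc.IH
  finally show ?case .
qed simp

text \<open>
Splitting off one linear factor at a time, as for polynomials over a field; stated for coefficients in the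
polynomial ring, with congruence modulo \<open>(p, P)\<close> in place of equality in the quotient field.
\<close>

lemma lagrange:
  fixes F :: "int poly poly"
  assumes P: "P \<in> Irr" and "finite Z" and "\<And>z z'. z \<in> Z \<Longrightarrow> z' \<in> Z \<Longrightarrow> cg P z z' \<Longrightarrow> z = z'"
    and "\<And>z. z \<in> Z \<Longrightarrow> cg P (poly F z) 0" and "degree F < card Z"
  shows "cg P (coeff F i) 0"
  using assms(2-5)
proof (induction Z arbitrary: F i rule: finite_induct)
  case (insert z Z)
  show ?case
  proof (cases "degree F = 0")
    case True
    then obtain c where "F = [:c:]" by (rule degree_eq_zeroE)
    then show ?thesis using insert.prems(2)[of z] by (auto simp: coeff_pCons split: nat.splits)
  next
    case False
    define G where "G = synthetic_div F z"
    have F: "F = [:- z, 1:] * G + [:poly F z:]"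
      unfolding G_def by (rule synthetic_div_correct' [symmetric])
    have root: "cg P (poly F z) 0" using insert.prems by simp
    have "cg P (coeff G j) 0" for j
    proof (rule insert.IH)
      show "degree G < card Z" using insert False by (simp add: G_def degree_synthetic_div)
      fix z' assume z': "z' \<in> Z"
      have "poly F z' = (z' - z) * poly G z' + poly F z" by (subst F) (simp add: algebra_simps)
      then have "(z' - z) * poly G z' = poly F z' - poly F z" by simp
      also have "cg P \<dots> (0 - 0)" using insert.prems(2) z' by (intro cg_diff root) auto
      finally have "cg P (z' - z) 0 \<or> cg P (poly G z') 0" using IrrD(4)[OF P] by simp
      moreover have "\<not> cg P (z' - z) 0"
        using insert.prems(1)[of z' z] insert.hyps z' cg_diff_iff[of P z' z] by auto
      ultimately show "cg P (poly G z') 0" by blast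
    qed (use insert.prems in auto)
    then have "cg P (coeff (smult (- z) G + pCons 0 G + [:poly F z:]) i) (0 + 0 + 0)"
      unfolding coeff_add
      by (intro cg_add) (auto simp: coeff_pCons root intro: cg_mult_0 cg_minus[of P _ 0, simplified] split: nat.splits)
    moreover have "F = smult (- z) G + pCons 0 G + [:poly F z:]"
      by (subst F) simp
    ultimately show ?thesis by (simp only: add_0_left)
  qed
qed simp

lemma cg_poly_coeffs:
  fixes F :: "int poly poly"
  assumes "\<And>i. cg P (coeff F i) 0"
  shows "cg P (poly F y) 0"
proof -
  have "cg P (\<Sum>i\<le>degree F. coeff F i * y ^ i) (\<Sum>i\<le>degree F. 0)"
    by (intro cg_sum cg_mult_0 assms)
  then show ?thesis by (simp add: poly_altdef)
qed

lemma cg_pcompose_right: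
  assumes "cg P a b" shows "cg P (pcompose w a) (pcompose w b)"
  by (induction w) (simp_all add: pcompose_pCons cg_add cg_mult assms)

text \<open>
If two conjugates \<open>x\<^bsup>p^l\<^esup>\<close> agreed, a smaller power of the Frobenius map would fix the whole residue field of
\<open>P\<close>, and \<open>y\<^bsup>p^q\<^esup> - y\<close> would have more roots than its degree.
\<close>

lemma conjugates_distinct:
  assumes P: "P \<in> Irr" and l: "l < l'" "l' < degree P"
    and eq: "cg P (monom 1 (p ^ l)) (monom 1 (p ^ l'))"
  shows False
proof -
  define q where "q = l' - l"
  define r where "r = degree P"
  have q: "0 < q" "q < r" "l' = l + q" using l by (auto simp: q_def r_def)
  define x where "x = monom (1::int) 1"
  have mon: "monom 1 k = x ^ k" for k by (simp add: x_def monom_altdef)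
  have "cg P x (x ^ (p ^ r))" unfolding r_def by (rule cg_sym[OF fermat_Irr[OF P]])
  also have "x ^ (p ^ r) = (x ^ (p ^ l)) ^ (p ^ (r - l))"
    using l by (simp add: r_def power_mult [symmetric] power_add [symmetric])
  also have "cg P \<dots> ((x ^ (p ^ l')) ^ (p ^ (r - l)))"
    using eq by (intro cg_power) (simp add: mon)
  also have "\<dots> = (x ^ (p ^ r)) ^ (p ^ q)"
    using l q by (simp add: r_def power_mult [symmetric] power_add [symmetric] add.commute)
  also have "cg P \<dots> (x ^ (p ^ q))"
    unfolding r_def by (intro cg_power fermat_Irr P)
  finally have x: "cg P (x ^ (p ^ q)) x" by (rule cg_sym)
  have all: "cg P (w ^ (p ^ q)) w" for w
  proof -
    have "cg P (w ^ (p ^ q)) (pcompose w (monom 1 (p ^ q)))" by (rule cg_mono[OF frobenius])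
    also have "cg P \<dots> (pcompose w x)" using x by (intro cg_pcompose_right) (simp add: mon)
    also have "x = [:0, 1:]" by (simp add: x_def monom_altdef)
    finally show ?thesis by (simp add: pcompose_idR)
  qed
  have gt: "p ^ q > 1" using q p_gt_1 one_less_power[of p q] by blast
  define F :: "int poly poly" where "F = monom 1 (p ^ q) - monom 1 1"
  have "cg P (coeff F (p ^ q)) 0"
  proof (rule lagrange[OF P, of "Red r"])
    have "degree F \<le> p ^ q" unfolding F_def using gt
      by (intro degree_diff_le) (auto intro: order.trans[OF degree_monom_le])
    also have "\<dots> < p ^ r" using q p_gt_1 by (intro power_strict_increasing) auto
    finally show "degree F < card (Red r)" by (simp add: card_Red)
    show "cg P (poly F z) 0" for z
      using all[of z] cg_diff_iff[of P "z ^ (p ^ q)" z] by (simp add: F_def poly_monom)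
  qed (use Red_distinct[OF P] card_Red in \<open>auto simp: r_def\<close>)
  then show False using gt Irr_one[OF P] by (simp add: F_def)
qed

text \<open>
\<open>P\<close> and the product of the \<open>y - x\<^bsup>p^l\<^esup>\<close> are monic in \<open>y\<close> of the same degree and share as many distinct
roots in the residue field, hence coincide; evaluate at \<open>y = c\<close>. So the norm of \<open>c - x\<close> is \<open>P(c)\<close>.
\<close>

lemma norm_Irr:
  assumes P: "P \<in> Irr"
  shows "cg P (\<Prod>l<degree P. [:c:] - monom 1 (p ^ l)) [:poly P c:]"
proof -
  define r where "r = degree P"
  define PP where "PP = map_poly (\<lambda>c. [:c:]) P"
  define G where "G = (\<Prod>l<r. [:- monom (1::int) (p ^ l), 1:])"
  define Z where "Z = (\<lambda>l. monom (1::int) (p ^ l)) ` {..<r}"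
  have inj: "inj_on (\<lambda>l. monom (1::int) (p ^ l)) {..<r}"
    using p_gt_1 by (auto simp: inj_on_def monom_eq_iff')
  have degG: "degree G = r" "coeff G r = 1"
  proof -
    have "degree G = (\<Sum>l<r. degree [:- monom (1::int) (p ^ l), 1:])"
      unfolding G_def by (intro degree_prod_eq_sum_degree) simp
    then show *: "degree G = r" by simp
    have "lead_coeff G = (\<Prod>l<r. lead_coeff [:- monom (1::int) (p ^ l), 1:])"
      unfolding G_def by (rule lead_coeff_prod)
    then show "coeff G r = 1" using * by simp
  qed
  have PPc: "coeff PP i = [:coeff P i:]" for i unfolding PP_def by (simp add: coeff_map_poly)
  have co: "coeff (PP - G) i = 0" if "i \<ge> r" for i
    using that degG IrrD(3)[OF P] by (cases "i = r") (auto simp: PPc coeff_eq_0 r_def one_pCons)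
  have r1: "r \<ge> 1" using IrrD(1)[OF P] by (simp add: r_def)
  have deg: "degree (PP - G) < r"
    using co r1 by (metis degree_0 leading_coeff_0_iff not_le less_le_trans zero_less_one)
  have "cg P (coeff (PP - G) i) 0" for i
  proof (rule lagrange[OF P, of Z])
    show "finite Z" by (simp add: Z_def)
    show "degree (PP - G) < card Z" using deg by (simp add: Z_def card_image[OF inj])
    show "z = z'" if "z \<in> Z" "z' \<in> Z" "cg P z z'" for z z'
    proof -
      obtain l l' where l: "l < r" "z = monom 1 (p ^ l)" "l' < r" "z' = monom 1 (p ^ l')"
        using \<open>z \<in> Z\<close> \<open>z' \<in> Z\<close> by (auto simp: Z_def)
      have "\<not> l < l'" using conjugates_distinct[OF P, of l l'] that(3) l by (auto simp: r_def)
      moreover have "\<not> l' < l" using conjugates_distinct[OF P, of l' l] cg_sym[OF that(3)] l by (auto simp: r_def)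
      ultimately show "z = z'" using l by simp
    qed
    fix z assume "z \<in> Z"
    then obtain l where l: "l < r" "z = monom 1 (p ^ l)" by (auto simp: Z_def)
    have "poly G z = 0" unfolding G_def poly_prod using l by (auto intro!: bexI[of _ l])
    moreover have "poly PP z = pcompose P z" by (simp add: PP_def pcompose_altdef)
    moreover have "cg P (pcompose P z) 0"
    proof -
      have "cg P (pcompose P z) (P ^ (p ^ l))"
        unfolding l by (rule cg_sym[OF cg_mono[OF frobenius]])
      also have "P ^ (p ^ l) = P * P ^ (p ^ l - 1)"
        using p_gt_1 power_minus_mult[of "p ^ l" P] by (simp add: mult.commute)
      also have "cg P \<dots> 0" by (rule cg_modulus)
      finally show ?thesis .
    qed
    ultimately show "cg P (poly (PP - G) z) 0" by simp
  qed
  then have "cg P (poly (PP - G) [:c:]) 0" by (rule cg_poly_coeffs)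
  moreover have "poly PP [:c:] = [:poly P c:]"
    by (simp add: PP_def pcompose_altdef [symmetric] pcompose_pCons_0)
  moreover have "poly G [:c:] = (\<Prod>l<r. [:c:] - monom 1 (p ^ l))"
    by (simp add: G_def poly_prod)
  ultimately have "cg P [:poly P c:] (\<Prod>l<r. [:c:] - monom 1 (p ^ l))"
    by (subst cg_diff_iff) simp
  then show ?thesis unfolding r_def by (rule cg_sym)
qed

lemma norm_Irr_mult:
  assumes P: "P \<in> Irr"
  shows "cg P (\<Prod>l<degree P * t. [:c:] - monom 1 (p ^ l)) ([:poly P c:] ^ t)"
proof (induction t)
  case (Suc t)
  define r where "r = degree P"
  have split: "{..<r * Suc t} = {..<r * t} \<union> (\<lambda>l. r * t + l) ` {..<r}"
  proof (intro equalityI subsetI)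
    fix l assume "l \<in> {..<r * Suc t}"
    then show "l \<in> {..<r * t} \<union> (\<lambda>l. r * t + l) ` {..<r}"
      by (cases "l < r * t") (auto intro!: image_eqI[of _ _ "l - r * t"])
  qed auto
  have "(\<Prod>l<r * Suc t. [:c:] - monom 1 (p ^ l)) =
     (\<Prod>l<r * t. [:c:] - monom 1 (p ^ l)) * (\<Prod>l\<in>(\<lambda>l. r * t + l) ` {..<r}. [:c:] - monom (1::int) (p ^ l))"
    unfolding split by (subst prod.union_disjoint) auto
  also have "(\<Prod>l\<in>(\<lambda>l. r * t + l) ` {..<r}. [:c:] - monom 1 (p ^ l)) =
      (\<Prod>l<r. [:c:] - monom (1::int) (p ^ (r * t + l)))"
    by (subst prod.reindex) auto
  also have "cg P ((\<Prod>l<r * t. [:c:] - monom 1 (p ^ l)) * \<dots>) ([:poly P c:] ^ t * [:poly P c:])"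
  proof (intro cg_mult)
    show "cg P (\<Prod>l<r * t. [:c:] - monom 1 (p ^ l)) ([:poly P c:] ^ t)"
      using Suc.IH by (simp add: r_def)
    have "cg P (\<Prod>l<r. [:c:] - monom 1 (p ^ (r * t + l))) (\<Prod>l<r. [:c:] - monom 1 (p ^ l))"
    proof (intro cg_prod cg_diff cg_refl)
      fix l
      have "monom (1::int) (p ^ (r * t + l)) = (monom 1 (p ^ l)) ^ (p ^ (r * t))"
        by (simp add: monom_power power_add mult.commute)
      also have "cg P \<dots> (monom 1 (p ^ l))" unfolding r_def by (rule fermat_Irr_mult[OF P])
      finally show "cg P (monom 1 (p ^ (r * t + l))) (monom 1 (p ^ l))" .
    qed
    also have "cg P \<dots> [:poly P c:]" unfolding r_def by (rule norm_Irr[OF P])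
    finally show "cg P (\<Prod>l<r. [:c:] - monom 1 (p ^ (r * t + l))) [:poly P c:]" .
  qed
  finally show ?case by (simp add: r_def mult.commute)
qed simp

end

section \<open>Unique factorisation and Newton's identities for the L-function\<close>

context char_p
begin

lemma Irr_power_monic:
  assumes "P \<in> Irr"
  shows "coeff (P ^ k) (degree (P ^ k)) = 1" "degree (P ^ k) = k * degree P"
    "red (P ^ k) \<in> Mon (k * degree P)"
proof -
  show 1: "coeff (P ^ k) (degree (P ^ k)) = 1"
    using IrrD(3)[OF assms] by (metis lead_coeff_power power_one)
  have "P \<noteq> 0" using IrrD(3)[OF assms] by auto
  then show 2: "degree (P ^ k) = k * degree P" by (simp add: degree_power_eq)
  show "red (P ^ k) \<in> Mon (k * degree P)"
    using 1 2 by (intro red_in_Mon) (auto simp: coeff_eq_0)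
qed

lemma Irr_eqI:
  assumes P: "P \<in> Irr" and P0: "P0 \<in> Irr" and dvd: "cg P P0 0"
  shows "P = P0"
proof -
  obtain h where h: "degree P \<le> degree P0" "h \<in> Mon (degree P0 - degree P)" "cg 0 P0 (P * h)"
    using Mon_quotient[OF IrrD(2)[OF P] IrrD(2)[OF P0] dvd] by blast
  have "cg P0 (P * h) P0" by (rule cg_sym[OF cg_mono[OF h(3)]])
  also have "cg P0 P0 0" using cg_modulus(1)[of P0 1] by simp
  finally have "cg P0 P 0 \<or> cg P0 h 0" using IrrD(4)[OF P0] by blast
  then show ?thesis
  proof
    assume "cg P0 P 0"
    then have "degree P0 \<le> degree P" using Mon_quotient[OF IrrD(2)[OF P0] IrrD(2)[OF P]] by blast
    then have "h = 1" "degree P0 = degree P" using h by (simp_all add: Mon_0)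
    then show ?thesis using h(3) IrrD(2)[OF P] IrrD(2)[OF P0] cg_sym
      by (intro Mon_eqI[of P "degree P0" P0]) auto
  next
    assume "cg P0 h 0"
    then have "degree P0 \<le> degree P0 - degree P" using Mon_quotient[OF IrrD(2)[OF P0] h(2)] by blast
    then show ?thesis using IrrD(1)[OF P] h(1) by simp
  qed
qed

text \<open>
The prime powers dividing \<open>g\<close>. Weighted by \<open>degree P\<close> they are the divisors counted by the von Mangoldt
function.
\<close>

definition prime_powers_of :: "int poly \<Rightarrow> (int poly \<times> nat) set" where
  "prime_powers_of g = {(P, k). P \<in> Irr \<and> k \<ge> 1 \<and> cg (P ^ k) g 0}"

definition prime_powers_upto :: "nat \<Rightarrow> (int poly \<times> nat) set" where
  "prime_powers_upto n = {(P, k). P \<in> Irr \<and> k \<ge> 1 \<and> k * degree P \<le> n}"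

lemma finite_Irr_le: "finite {P \<in> Irr. degree P \<le> n}"
proof (rule finite_subset)
  show "{P \<in> Irr. degree P \<le> n} \<subseteq> (\<Union>r\<le>n. Mon r)" using IrrD(2) by auto
qed (simp add: card_Mon)

lemma finite_prime_powers_upto: "finite (prime_powers_upto n)"
proof (rule finite_subset)
  show "prime_powers_upto n \<subseteq> {P \<in> Irr. degree P \<le> n} \<times> {..n}"
  proof
    fix x assume "x \<in> prime_powers_upto n"
    then obtain P k where "x = (P, k)" "degree P \<ge> 1" "k \<ge> 1" "k * degree P \<le> n" "P \<in> Irr"
      using IrrD(1) by (auto simp: prime_powers_upto_def)
    moreover from this have "k * 1 \<le> n" "1 * degree P \<le> n"
      using mult_le_mono le_trans by blast+
    ultimately show "x \<in> {P \<in> Irr. degree P \<le> n} \<times> {..n}" by simp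
  qed
qed (simp add: finite_Irr_le)

lemma Mon_quotient_power:
  assumes "P \<in> Irr" "g \<in> Mon n" "cg (P ^ k) g 0"
  shows "k * degree P \<le> n \<and> (\<exists>h\<in>Mon (n - k * degree P). cg 0 g (P ^ k * h))"
proof -
  have "cg (red (P ^ k)) g 0" using cg_modulus_cong[OF cg_red(2)] assms(3) .
  from Mon_quotient[OF Irr_power_monic(3)[OF assms(1)] assms(2) this]
  obtain h where "k * degree P \<le> n" "h \<in> Mon (n - k * degree P)" "cg 0 g (red (P ^ k) * h)" by blast
  moreover have "cg 0 (red (P ^ k) * h) (P ^ k * h)" by (intro cg_mult cg_red cg_refl)
  ultimately show ?thesis using cg_trans by blast
qed

lemma prime_powers_of_subset: "g \<in> Mon n \<Longrightarrow> prime_powers_of g \<subseteq> prime_powers_upto n"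
  using Mon_quotient_power by (auto simp: prime_powers_of_def prime_powers_upto_def)

text \<open>
Remove the factors \<open>P\<close> one at a time: \<open>P\<close> divides \<open>P0 * h\<close> but not \<open>P0\<close>, hence divides \<open>h\<close>.
\<close>

lemma coprime_power_dvd:
  assumes P: "P \<in> Irr" and P0: "P0 \<in> Irr" and ne: "P \<noteq> P0" and "cg (P ^ k) (P0 * h) 0"
  shows "cg (P ^ k) h 0"
  using assms(4)
proof (induction k arbitrary: h)
  case 0
  have "cg 1 (1 * h) 0" by (rule cg_modulus)
  then show ?case by simp
next
  case (Suc k)
  obtain v where v: "cg 0 (P0 * h) (P ^ Suc k * v)" using Suc.prems cg_0_iff_mult by blast
  then have "cg 0 (P0 * h) (P * (P ^ k * v))" by (simp add: mult.assoc)
  then have "cg P (P0 * h) 0" using cg_0_iff_mult by blast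
  then have "cg P h 0" using IrrD(4)[OF P] Irr_eqI[OF P P0] ne by blast
  then obtain h' where h': "cg 0 h (P * h')" using cg_0_iff_mult by blast
  have "cg 0 (P * (P0 * h')) (P0 * h)"
    using cg_mult[OF cg_refl[of 0 P0] cg_sym[OF h']] by (simp add: mult.left_commute)
  also have "cg 0 (P0 * h) (P * (P ^ k * v))" by fact
  finally have "cg 0 (P0 * h') (P ^ k * v)" using monic_cancel IrrD(3)[OF P] by blast
  then have "cg (P ^ k) h' 0" using Suc.IH cg_0_iff_mult by blast
  then obtain w where "cg 0 h' (P ^ k * w)" using cg_0_iff_mult by blast
  then have "cg 0 (P * h') (P * (P ^ k * w))" by (intro cg_mult cg_refl)
  with h' have "cg 0 h (P ^ Suc k * w)" using cg_trans by (auto simp: mult.assoc)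
  then show ?case using cg_0_iff_mult by blast
qed

lemma prime_powers_of_mult:
  assumes P0: "P0 \<in> Irr" and gh: "cg 0 g (P0 * h)"
  defines "\<phi> \<equiv> \<lambda>(P, k). if P = P0 then (P, Suc k) else (P, k)"
  shows "prime_powers_of g = insert (P0, 1) (\<phi> ` prime_powers_of h)"
proof -
  have same: "cg (P0 ^ Suc k) g 0 \<longleftrightarrow> cg (P0 ^ k) h 0" for k
  proof
    assume "cg (P0 ^ Suc k) g 0"
    then obtain v where "cg 0 g (P0 ^ Suc k * v)" using cg_0_iff_mult by blast
    then have "cg 0 (P0 * h) (P0 * (P0 ^ k * v))"
      using cg_trans[OF cg_sym[OF gh]] by (simp add: mult.assoc)
    then have "cg 0 h (P0 ^ k * v)" using monic_cancel IrrD(3)[OF P0] by blast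
    then show "cg (P0 ^ k) h 0" using cg_0_iff_mult by blast
  next
    assume "cg (P0 ^ k) h 0"
    then obtain v where "cg 0 h (P0 ^ k * v)" using cg_0_iff_mult by blast
    then have "cg 0 (P0 * h) (P0 * (P0 ^ k * v))" by (intro cg_mult cg_refl)
    then have "cg 0 g (P0 ^ Suc k * v)" using cg_trans[OF gh] by (simp add: mult.assoc)
    then show "cg (P0 ^ Suc k) g 0" using cg_0_iff_mult by blast
  qed
  have other: "cg (P ^ k) g 0 \<longleftrightarrow> cg (P ^ k) h 0" if "P \<in> Irr" "P \<noteq> P0" for P k
  proof
    assume "cg (P ^ k) g 0"
    then have "cg (P ^ k) (P0 * h) 0" using cg_trans[OF cg_sym[OF cg_mono[OF gh]]] by blast
    then show "cg (P ^ k) h 0" using coprime_power_dvd that P0 by blast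
  next
    assume "cg (P ^ k) h 0"
    then have "cg (P ^ k) (P0 * h) 0" by (rule cg_mult_0)
    then show "cg (P ^ k) g 0" using cg_trans[OF cg_mono[OF gh]] by blast
  qed
  have one: "cg (P0 ^ 1) g 0" using cg_0_iff_mult gh by auto
  show ?thesis
  proof (intro equalityI subsetI)
    fix x assume "x \<in> prime_powers_of g"
    then obtain P k where x: "x = (P, k)" "P \<in> Irr" "k \<ge> 1" "cg (P ^ k) g 0"
      by (auto simp: prime_powers_of_def)
    show "x \<in> insert (P0, 1) (\<phi> ` prime_powers_of h)"
    proof (cases "P = P0")
      case True
      show ?thesis
      proof (cases "k = 1")
        case False
        then obtain k' where k: "k = Suc k'" "k' \<ge> 1" using x by (cases k) auto
        then have "(P0, k') \<in> prime_powers_of h" using x True P0 same by (auto simp: prime_powers_of_def)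
        then have "\<phi> (P0, k') \<in> \<phi> ` prime_powers_of h" by (rule imageI)
        then show ?thesis using k True x by (simp add: \<phi>_def)
      qed (use x True in simp)
    next
      case False
      then have "(P, k) \<in> prime_powers_of h" using x other by (auto simp: prime_powers_of_def)
      then have "\<phi> (P, k) \<in> \<phi> ` prime_powers_of h" by (rule imageI)
      then show ?thesis using x False by (simp add: \<phi>_def)
    qed
  next
    fix x assume "x \<in> insert (P0, 1) (\<phi> ` prime_powers_of h)"
    then show "x \<in> prime_powers_of g"
      using P0 one same other by (auto simp: prime_powers_of_def \<phi>_def simp del: power_Suc split: if_splits)
  qed
qed

text \<open>
Unique factorisation, expressed through degrees. Dividing \<open>g\<close> by a prime \<open>P0\<close> removes \<open>(P0, 1)\<close> and lowers the
exponents of the other powers of \<open>P0\<close> by one.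
\<close>

lemma degree_eq_sum_prime_powers:
  "g \<in> Mon n \<Longrightarrow> (\<Sum>(P, k)\<in>prime_powers_of g. degree P) = n"
proof (induction n arbitrary: g rule: less_induct)
  case (less n)
  show ?case
  proof (cases "n = 0")
    case True
    then have "prime_powers_upto n = {}" using IrrD(1) by (fastforce simp: prime_powers_upto_def)
    then have "prime_powers_of g = {}" using prime_powers_of_subset[OF less.prems] by simp
    then show ?thesis using True by simp
  next
    case False
    then obtain P0 where P0: "P0 \<in> Irr" "cg P0 g 0" using prime_divisor_exists[OF less.prems] by auto
    from Mon_quotient[OF IrrD(2)[OF P0(1)] less.prems P0(2)]
    obtain h where h: "degree P0 \<le> n" "h \<in> Mon (n - degree P0)" "cg 0 g (P0 * h)" by blast
    define \<phi> where "\<phi> = (\<lambda>(P, k). if P = P0 then (P, Suc k) else (P, k))"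
    have eq: "prime_powers_of g = insert (P0, 1) (\<phi> ` prime_powers_of h)"
      unfolding \<phi>_def by (rule prime_powers_of_mult[OF P0(1) h(3)])
    have fin: "finite (prime_powers_of h)"
      using prime_powers_of_subset[OF h(2)] finite_prime_powers_upto finite_subset by blast
    have notin: "(P0, 1) \<notin> \<phi> ` prime_powers_of h"
      by (auto simp: \<phi>_def prime_powers_of_def split: if_splits)
    have inj: "inj_on \<phi> (prime_powers_of h)" by (auto simp: inj_on_def \<phi>_def split: if_splits)
    have "(\<Sum>(P, k)\<in>\<phi> ` prime_powers_of h. degree P) = (\<Sum>x\<in>prime_powers_of h. (\<lambda>(P, k). degree P) (\<phi> x))"
      by (rule sum.reindex[OF inj, unfolded o_def])
    also have "\<dots> = (\<Sum>(P, k)\<in>prime_powers_of h. degree P)"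
      by (intro sum.cong) (auto simp: \<phi>_def)
    also have "\<dots> = n - degree P0" using less.IH h(1,2) IrrD(1)[OF P0(1)] False by simp
    finally show ?thesis unfolding eq using fin notin h(1) by simp
  qed
qed

definition Irr_dvd :: "nat \<Rightarrow> int poly set" where
  "Irr_dvd j = {P \<in> Irr. degree P dvd j}"

lemma finite_Irr_dvd: "j \<ge> 1 \<Longrightarrow> finite (Irr_dvd j)"
  by (rule finite_subset[OF _ finite_Irr_le[of j]]) (auto simp: Irr_dvd_def dvd_imp_le)

text \<open>
The coefficient of \<open>z\<^sup>n\<close> in the L-function \<open>\<Sum>g. X g * z\<^bsup>deg g\<^esup>\<close> of a completely multiplicative \<open>X\<close>.
\<close>

definition L_coeff :: "(int poly \<Rightarrow> complex) \<Rightarrow> nat \<Rightarrow> complex" where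
  "L_coeff X n = (\<Sum>g\<in>Mon n. X g)"

text \<open>
The sum of \<open>X\<close> over the points of the field with \<open>p\<^sup>j\<close> elements: a prime of degree \<open>r\<close> dividing \<open>j\<close>
accounts for \<open>r\<close> conjugate points, and the exponent \<open>j div r\<close> comes from the norm down from that field.
\<close>

definition point_sum :: "(int poly \<Rightarrow> complex) \<Rightarrow> nat \<Rightarrow> complex" where
  "point_sum X j = (\<Sum>P\<in>Irr_dvd j. of_nat (degree P) * X P ^ (j div degree P))"

text \<open>
This is \<open>z L' = L S\<close>, the logarithmic derivative of the Euler product. Write \<open>n\<close> as the sum of the degrees of the
prime powers dividing \<open>g\<close> and exchange the order of summation.
\<close>

lemma newton_identity:
  assumes mult: "\<And>g h. X (g * h) = X g * X h" and cong: "\<And>g h. cg 0 g h \<Longrightarrow> X g = X h"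
  shows "of_nat n * L_coeff X n = (\<Sum>j=1..n. point_sum X j * L_coeff X (n - j))"
proof -
  have Xpow: "X (P ^ k * h) = X P ^ k * X h" for P k h
    by (induction k) (simp_all add: mult mult.assoc)
  have inner: "(\<Sum>g | g \<in> Mon n \<and> cg (P ^ k) g 0. X g) = X P ^ k * L_coeff X (n - k * degree P)"
    if P: "P \<in> Irr" and le: "k * degree P \<le> n" for P k
  proof -
    have "bij_betw (\<lambda>h. red (P ^ k * h)) (Mon (n - k * degree P)) {g \<in> Mon n. cg (P ^ k) g 0}"
    proof (rule bij_betwI')
      fix h h' assume h: "h \<in> Mon (n - k * degree P)" "h' \<in> Mon (n - k * degree P)"
      show "red (P ^ k * h) = red (P ^ k * h') \<longleftrightarrow> h = h'"
        using monic_cancel[OF Irr_power_monic(1)[OF P]] Mon_eqI[OF h] by (auto simp: red_eq_iff)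
    next
      fix h assume h: "h \<in> Mon (n - k * degree P)"
      have "red (red (P ^ k) * h) \<in> Mon (k * degree P + (n - k * degree P))"
        by (intro red_mult_Mon Irr_power_monic P h)
      moreover have "red (red (P ^ k) * h) = red (P ^ k * h)"
        unfolding red_eq_iff by (intro cg_mult cg_red cg_refl)
      ultimately have "red (P ^ k * h) \<in> Mon n" using le by simp
      moreover have "cg (P ^ k) (red (P ^ k * h)) 0" using cg_0_iff_mult cg_red(1) by blast
      ultimately show "red (P ^ k * h) \<in> {g \<in> Mon n. cg (P ^ k) g 0}" by simp
    next
      fix g assume "g \<in> {g \<in> Mon n. cg (P ^ k) g 0}"
      then have g: "g \<in> Mon n" "cg (P ^ k) g 0" by auto
      from Mon_quotient_power[OF P g] obtain h where "h \<in> Mon (n - k * degree P)" "cg 0 g (P ^ k * h)" by blast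
      then show "\<exists>h\<in>Mon (n - k * degree P). g = red (P ^ k * h)"
        using red_Mon[OF g(1)] red_eq_iff by metis
    qed
    from sum.reindex_bij_betw[OF this, of X]
    have "(\<Sum>g | g \<in> Mon n \<and> cg (P ^ k) g 0. X g) = (\<Sum>h\<in>Mon (n - k * degree P). X (red (P ^ k * h)))"
      by simp
    also have "\<dots> = (\<Sum>h\<in>Mon (n - k * degree P). X P ^ k * X h)"
      using cong[OF cg_red(1)] by (simp add: Xpow)
    finally show ?thesis by (simp add: L_coeff_def sum_distrib_left)
  qed
  have "of_nat n * L_coeff X n = (\<Sum>g\<in>Mon n. X g * (\<Sum>(P, k)\<in>prime_powers_of g. of_nat (degree P)))"
    unfolding L_coeff_def sum_distrib_left[of "of_nat n" X "Mon n"]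
  proof (intro sum.cong refl)
    fix g assume g: "g \<in> Mon n"
    have "of_nat n = (of_nat (\<Sum>(P, k)\<in>prime_powers_of g. degree P) :: complex)"
      using degree_eq_sum_prime_powers[OF g] by simp
    then show "of_nat n * X g = X g * (\<Sum>(P, k)\<in>prime_powers_of g. of_nat (degree P))"
      by (simp add: case_prod_unfold)
  qed
  also have "\<dots> = (\<Sum>g\<in>Mon n. \<Sum>x\<in>prime_powers_upto n. if cg (fst x ^ snd x) g 0 then X g * of_nat (degree (fst x)) else 0)"
  proof (intro sum.cong refl)
    fix g assume g: "g \<in> Mon n"
    have sub: "prime_powers_of g = {x \<in> prime_powers_upto n. cg (fst x ^ snd x) g 0}"
      using prime_powers_of_subset[OF g] by (auto simp: prime_powers_of_def prime_powers_upto_def)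
    show "X g * (\<Sum>(P, k)\<in>prime_powers_of g. of_nat (degree P)) =
      (\<Sum>x\<in>prime_powers_upto n. if cg (fst x ^ snd x) g 0 then X g * of_nat (degree (fst x)) else 0)"
      unfolding sub sum_distrib_left
      by (subst sum.inter_filter[OF finite_prime_powers_upto]) (auto intro!: sum.cong simp: case_prod_unfold)
  qed
  also have "\<dots> = (\<Sum>x\<in>prime_powers_upto n. of_nat (degree (fst x)) * (X (fst x) ^ snd x * L_coeff X (n - snd x * degree (fst x))))"
  proof (subst sum.swap, intro sum.cong refl)
    fix x assume x: "x \<in> prime_powers_upto n"
    have "(\<Sum>g\<in>Mon n. if cg (fst x ^ snd x) g 0 then X g * of_nat (degree (fst x)) else 0) =
      (\<Sum>g | g \<in> Mon n \<and> cg (fst x ^ snd x) g 0. X g * of_nat (degree (fst x)))"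
      by (subst sum.inter_filter[OF card_Mon(1)]) simp
    also have "\<dots> = of_nat (degree (fst x)) * (X (fst x) ^ snd x * L_coeff X (n - snd x * degree (fst x)))"
      using x inner[of "fst x" "snd x"]
      by (simp add: sum_distrib_right [symmetric] prime_powers_upto_def case_prod_unfold mult.commute)
    finally show "(\<Sum>g\<in>Mon n. if cg (fst x ^ snd x) g 0 then X g * of_nat (degree (fst x)) else 0) = \<dots>" .
  qed
  also have "\<dots> = (\<Sum>y\<in>(SIGMA j:{1..n}. Irr_dvd j).
      of_nat (degree (snd y)) * (X (snd y) ^ (fst y div degree (snd y)) * L_coeff X (n - fst y)))"
  proof (rule sum.reindex_bij_witness[where i = "\<lambda>(j, P). (P, j div degree P)" and j = "\<lambda>(P, k). (k * degree P, P)"])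
    fix x assume "x \<in> prime_powers_upto n"
    then obtain P k where x: "x = (P, k)" "P \<in> Irr" "k \<ge> 1" "k * degree P \<le> n"
      by (auto simp: prime_powers_upto_def)
    have d: "degree P \<ge> 1" using IrrD(1) x by blast
    show "(case case x of (P, k) \<Rightarrow> (k * degree P, P) of (j, P) \<Rightarrow> (P, j div degree P)) = x"
      using x d by simp
    have "1 * 1 \<le> k * degree P" using x d by (intro mult_le_mono) auto
    then show "(case x of (P, k) \<Rightarrow> (k * degree P, P)) \<in> (SIGMA j:{1..n}. Irr_dvd j)"
      using x by (simp add: Irr_dvd_def)
    show "of_nat (degree (snd (case x of (P, k) \<Rightarrow> (k * degree P, P)))) *
        (X (snd (case x of (P, k) \<Rightarrow> (k * degree P, P))) ^
          (fst (case x of (P, k) \<Rightarrow> (k * degree P, P)) div degree (snd (case x of (P, k) \<Rightarrow> (k * degree P, P)))) *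
         L_coeff X (n - fst (case x of (P, k) \<Rightarrow> (k * degree P, P)))) =
        of_nat (degree (fst x)) * (X (fst x) ^ snd x * L_coeff X (n - snd x * degree (fst x)))"
      using x d by simp
  next
    fix y assume "y \<in> (SIGMA j:{1..n}. Irr_dvd j)"
    then obtain j P where y: "y = (j, P)" "1 \<le> j" "j \<le> n" "P \<in> Irr" "degree P dvd j"
      by (auto simp: Irr_dvd_def)
    then obtain k where k: "j = degree P * k" by (elim dvdE)
    have d: "degree P \<ge> 1" using IrrD(1) y by blast
    show "(case case y of (j, P) \<Rightarrow> (P, j div degree P) of (P, k) \<Rightarrow> (k * degree P, P)) = y"
      using y by simp
    have "k \<noteq> 0" using k y by auto
    then show "(case y of (j, P) \<Rightarrow> (P, j div degree P)) \<in> prime_powers_upto n"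
      using y k d by (simp add: prime_powers_upto_def mult.commute)
  qed
  also have "\<dots> = (\<Sum>j=1..n. \<Sum>P\<in>Irr_dvd j. of_nat (degree P) * (X P ^ (j div degree P) * L_coeff X (n - j)))"
    by (subst sum.Sigma) (auto simp: finite_Irr_dvd case_prod_unfold)
  also have "\<dots> = (\<Sum>j=1..n. point_sum X j * L_coeff X (n - j))"
    by (simp add: point_sum_def sum_distrib_right mult.assoc)
  finally show ?thesis .
qed

text \<open>
Newton's identities for the trivial function \<open>X = 1\<close>, whose L-function is \<open>1 / (1 - p z)\<close>.
\<close>

lemma sum_degree_Irr_dvd:
  assumes "n \<ge> 1" shows "(\<Sum>P\<in>Irr_dvd n. degree P) = p ^ n"
proof -
  define S where "S j = point_sum (\<lambda>_. 1) j" for j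
  have newton: "of_nat n * of_nat p ^ n = (\<Sum>j=1..n. S j * of_nat p ^ (n - j))" for n
    using newton_identity[of "\<lambda>_. 1" n] by (simp add: L_coeff_def card_Mon S_def)
  have "S n = of_nat p ^ n" if "n \<ge> 1" for n
    using that
  proof (induction n rule: less_induct)
    case (less n)
    have "of_nat n * of_nat p ^ n = S n + (\<Sum>j=1..<n. S j * of_nat p ^ (n - j))"
      unfolding newton using less.prems by (subst sum.last_plus) (auto simp: atLeastLessThanSuc_atLeastAtMost[symmetric])
    also have "(\<Sum>j=1..<n. S j * of_nat p ^ (n - j)) = (\<Sum>j=1..<n. of_nat p ^ n)"
      using less.IH by (intro sum.cong) (auto simp: power_add [symmetric])
    also have "\<dots> = (of_nat n - 1) * of_nat p ^ n" using less.prems by (simp add: of_nat_diff)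
    finally show ?case by (simp add: algebra_simps)
  qed
  then have "(\<Sum>P\<in>Irr_dvd n. of_nat (degree P)) = (of_nat p ^ n :: complex)"
    using assms by (simp add: S_def point_sum_def)
  then have "of_nat (\<Sum>P\<in>Irr_dvd n. degree P) = (of_nat (p ^ n) :: complex)" by simp
  then show ?thesis unfolding of_nat_eq_iff .
qed

text \<open>
The counting step of Stepanov's method: a nonzero polynomial has at most as many zeros as its degree.
\<close>

lemma sum_degree_divisors_le:
  assumes "finite \<P>" "\<P> \<subseteq> Irr" "\<And>P. P \<in> \<P> \<Longrightarrow> cg P H 0" "\<not> cg 0 H 0"
  shows "(\<Sum>P\<in>\<P>. degree P) \<le> degree H"
proof -
  obtain c e where e: "e < Suc (degree H)" "red ([:c:] * H) \<in> Mon e"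
    using normalise_to_monic[OF assms(4), of "Suc (degree H)"] by (metis coeff_eq_0 Suc_le_eq)
  define g where "g = red ([:c:] * H)"
  have g: "g \<in> Mon e" using e by (simp add: g_def)
  have "cg P g 0" if "P \<in> \<P>" for P
    unfolding g_def using cg_trans[OF cg_red(1)] cg_mult_0(2)[OF assms(3)[OF that]] by blast
  then have "(\<lambda>P. (P, 1)) ` \<P> \<subseteq> prime_powers_of g" using assms(2) by (auto simp: prime_powers_of_def)
  moreover have "finite (prime_powers_of g)"
    using prime_powers_of_subset[OF g] finite_prime_powers_upto finite_subset by blast
  ultimately have "(\<Sum>(P, k)\<in>(\<lambda>P. (P, 1::nat)) ` \<P>. degree P) \<le> (\<Sum>(P, k)\<in>prime_powers_of g. degree P)"
    by (intro sum_mono2) auto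
  also have "\<dots> = e" using g by (rule degree_eq_sum_prime_powers)
  also have "(\<Sum>(P, k)\<in>(\<lambda>P. (P, 1::nat)) ` \<P>. degree P) = (\<Sum>P\<in>\<P>. degree P)"
    by (subst sum.reindex) (auto simp: inj_on_def)
  finally show ?thesis using e by simp
qed

end

section \<open>Stepanov's auxiliary polynomial\<close>

context char_p
begin

lemma low_coeff_mult:
  fixes u v :: "int poly"
  assumes "\<And>l. l < t \<Longrightarrow> int p dvd coeff u l"
  shows "l < t \<Longrightarrow> int p dvd coeff (u * v) l"
    and "[coeff (u * v) t = coeff u t * coeff v 0] (mod int p)"
proof -
  show "int p dvd coeff (u * v) l" if "l < t"
    unfolding coeff_mult using assms that by (intro dvd_sum dvd_mult2) auto
  have "coeff (u * v) t = (\<Sum>i<t. coeff u i * coeff v (t - i)) + coeff u t * coeff v 0"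
    unfolding coeff_mult by (simp add: lessThan_Suc_atMost [symmetric])
  moreover have "int p dvd (\<Sum>i<t. coeff u i * coeff v (t - i))"
    using assms by (intro dvd_sum dvd_mult2) auto
  ultimately show "[coeff (u * v) t = coeff u t * coeff v 0] (mod int p)"
    by (simp add: cong_iff_dvd_diff)
qed

lemma coeff_monom_mult_dvd:
  fixes u v :: "int poly"
  assumes "\<And>l. l < t \<Longrightarrow> int p dvd coeff u l" "n < s + t"
  shows "int p dvd coeff (u * v * monom 1 s) n"
  using low_coeff_mult(1)[where t = t and u = u and l = "n - s" and v = v, OF assms(1)] assms(2)
  by (auto simp: coeff_monom_mult mult.commute[of _ "monom 1 s"])

text \<open>
The terms have pairwise different orders of vanishing at \<open>0\<close>. Multiplied by \<open>d\<close>, the order of a term is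
\<open>R (e0 i + d j)\<close> up to an error in an interval shorter than \<open>R\<close>, and \<open>e0 i + d j\<close> determines \<open>(i, j)\<close> because
\<open>i < d\<close> and \<open>e0\<close> is coprime to \<open>d\<close>. So the nonzero term with the least \<open>e0 i + d j\<close> cannot cancel.
\<close>

lemma distinct_orders_nonzero:
  fixes \<delta> :: "nat \<times> nat \<Rightarrow> int poly" and h :: "int poly"
  assumes K: "finite K" "K \<subseteq> {..<d} \<times> UNIV"
    and d: "d > 0" "d * \<rho> + 1 = R" and cop: "coprime e0 d" and L: "d * L + d * e0 < R"
    and h: "\<not> int p dvd coeff h 0"
    and small: "\<And>x l. x \<in> K \<Longrightarrow> l \<ge> L \<Longrightarrow> coeff (\<delta> x) l = 0"
    and nz: "\<exists>x\<in>K. \<not> cg 0 (\<delta> x) 0"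
  shows "\<not> cg 0 (\<Sum>(i, j)\<in>K. \<delta> (i, j) * h ^ (i * \<rho>) * monom 1 (e0 * i * \<rho> + j * R)) 0"
proof -
  define N where "N = {x \<in> K. \<not> cg 0 (\<delta> x) 0}"
  define l where "l x = (LEAST l. \<not> int p dvd coeff (\<delta> x) l)" for x
  have lN: "\<not> int p dvd coeff (\<delta> x) (l x)" if "x \<in> N" for x
  proof -
    have "\<exists>l. \<not> int p dvd coeff (\<delta> x) l"
      using that by (auto simp: N_def cg_0_iff cong_0_iff)
    then show ?thesis unfolding l_def by (rule LeastI_ex)
  qed
  have below: "int p dvd coeff (\<delta> x) k" if "k < l x" for x k
    using not_less_Least[OF that[unfolded l_def]] by simp
  have lL: "l x < L" if "x \<in> N" for x
    using lN[OF that] small[of x "l x"] that by (cases "l x < L") (auto simp: N_def)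
  define \<kappa> where "\<kappa> = (\<lambda>(i, j). e0 * i + d * j :: nat)"
  have \<kappa>_inj: "x = y" if xy: "x \<in> K" "y \<in> K" "\<kappa> x = \<kappa> y" for x y
  proof -
    obtain i j i' j' where x: "x = (i, j)" and y: "y = (i', j')" by fastforce
    have ii: "i < d" "i' < d" using xy K x y by auto
    have "[e0 * i + d * j = e0 * i' + d * j'] (mod d)" using xy by (simp add: \<kappa>_def x y)
    then have "[e0 * i = e0 * i'] (mod d)" by (simp add: cong_def)
    then have "[i = i'] (mod d)" using cop by (simp add: cong_mult_lcancel_nat)
    then have "i = i'" using ii by (simp add: cong_def)
    then show ?thesis using xy d by (simp add: \<kappa>_def x y)
  qed
  have "N \<noteq> {}" "finite N" using nz K by (auto simp: N_def)
  then obtain z where z: "z \<in> N" and zmin: "\<And>x. x \<in> N \<Longrightarrow> \<kappa> z \<le> \<kappa> x"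
    using ex_is_arg_min_if_finite[of N \<kappa>] unfolding is_arg_min_def by (metis not_le)
  define s where "s = (\<lambda>(i, j). e0 * i * \<rho> + j * R)"
  define u where "u = (\<lambda>(i, j). \<delta> (i, j) * h ^ (i * \<rho>) * monom 1 (e0 * i * \<rho> + j * R))"
  define n where "n = s z + l z"
  have other: "int p dvd coeff (u x) n" if x: "x \<in> K" "x \<noteq> z" for x
  proof (cases "x \<in> N")
    case False
    then have "cg 0 (\<delta> x) 0" using x by (simp add: N_def)
    then have "cg 0 (\<delta> x * (h ^ (fst x * \<rho>) * monom 1 (e0 * fst x * \<rho> + snd x * R))) 0" by (rule cg_mult_0)
    then have "cg 0 (u x) 0" by (simp add: u_def case_prod_unfold mult.assoc)
    then show ?thesis by (simp add: cg_0_iff cong_0_iff)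
  next
    case True
    have "\<kappa> z < \<kappa> x" using zmin[OF True] \<kappa>_inj[of z x] x z by (auto simp: N_def le_less)
    obtain i j i' j' where zi: "z = (i, j)" and xi: "x = (i', j')" by fastforce
    have ii: "i < d" "i' < d" using K x z by (auto simp: N_def zi xi)
    have "s z + l z < s x + l x"
    proof -
      have lt: "e0 * i + d * j + 1 \<le> e0 * i' + d * j'" using \<open>\<kappa> z < \<kappa> x\<close> by (simp add: \<kappa>_def zi xi)
      have eq: "d * (e0 * k * \<rho> + m * R) + e0 * k = R * (e0 * k + d * m)" for k m
        unfolding d(2)[symmetric] by (simp add: algebra_simps)
      have "d * (s z + l z) + e0 * i = R * (e0 * i + d * j) + d * l z"
        using eq[of i j] by (simp add: s_def zi algebra_simps)
      also have "\<dots> + (d * e0 + d) \<le> R * (e0 * i + d * j) + (d * L + d * e0)"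
        using mult_le_mono2[of "l z + 1" L d] lL[OF z] by simp
      also have "\<dots> < R * (e0 * i + d * j) + R" using L by simp
      also have "\<dots> \<le> R * (e0 * i' + d * j')"
        using mult_le_mono2[OF lt, of R] by (simp add: algebra_simps)
      also have "\<dots> \<le> d * (s x + l x) + e0 * i'"
        using eq[of i' j'] by (simp add: s_def xi algebra_simps)
      also have "\<dots> \<le> d * (s x + l x) + d * e0" using ii by (simp add: mult.commute mult_le_mono)
      finally have "d * (s z + l z) + (d * e0 + d) < d * (s x + l x) + d * e0" by (simp only: ac_simps) 
      then have "d * (s z + l z) < d * (s x + l x)" by linarith
      then show ?thesis by (simp only: nat_mult_less_cancel_disj)
    qed
    then show ?thesis unfolding u_def xi n_def
      using below[of _ x] by (auto intro!: coeff_monom_mult_dvd[where t = "l x"] simp: s_def xi)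
  qed
  have main: "\<not> int p dvd coeff (u z) n"
  proof -
    obtain i j where zi: "z = (i, j)" by fastforce
    have "coeff (u z) n = coeff (\<delta> z * h ^ (i * \<rho>)) (l z)"
      by (simp add: u_def n_def s_def zi coeff_monom_mult mult.commute[of _ "monom 1 _"])
    moreover have "[coeff (\<delta> z * h ^ (i * \<rho>)) (l z) = coeff (\<delta> z) (l z) * coeff (h ^ (i * \<rho>)) 0] (mod int p)"
      using below by (rule low_coeff_mult(2))
    moreover have "coeff (h ^ (i * \<rho>)) 0 = coeff h 0 ^ (i * \<rho>)" by (simp add: coeff_0_power)
    moreover have "prime (int p)" using prime_p by simp
    then have "\<not> int p dvd coeff (\<delta> z) (l z) * coeff h 0 ^ (i * \<rho>)"
      using lN[OF z] h by (meson prime_dvd_multD prime_dvd_power)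
    ultimately show ?thesis by (simp add: cong_dvd_iff)
  qed
  have "z \<in> K" using z by (simp add: N_def)
  then have "coeff (\<Sum>x\<in>K. u x) n = coeff (u z) n + (\<Sum>x\<in>K - {z}. coeff (u x) n)"
    using K by (simp add: coeff_sum sum.remove)
  moreover have "int p dvd (\<Sum>x\<in>K - {z}. coeff (u x) n)" using other by (intro dvd_sum) auto
  ultimately have "\<not> int p dvd coeff (\<Sum>x\<in>K. u x) n" using main by (simp add: dvd_add_left_iff)
  then have "\<not> cg 0 (\<Sum>x\<in>K. u x) 0" by (auto simp: cg_0_iff cong_0_iff)
  then show ?thesis by (simp add: u_def)
qed

text \<open>
A homogeneous linear system with more unknowns than equations over the field with \<open>p\<close> elements has a
nontrivial solution; here there are finitely many candidates, and two with the same image are subtracted.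
\<close>

lemma pigeonhole_relation:
  fixes \<Phi> :: "'k \<Rightarrow> int poly \<Rightarrow> int poly"
  assumes fin: "finite K" and add: "\<And>x g g'. \<Phi> x (g - g') = \<Phi> x g - \<Phi> x g'"
    and deg: "\<And>x g. x \<in> K \<Longrightarrow> g \<in> Red L \<Longrightarrow> degree (\<Phi> x g) < D" and count: "D < card K * L"
  obtains \<delta> where "\<And>x l. x \<in> K \<Longrightarrow> l \<ge> L \<Longrightarrow> coeff (\<delta> x) l = 0" "\<exists>x\<in>K. \<not> cg 0 (\<delta> x) 0"
    "cg 0 (\<Sum>x\<in>K. \<Phi> x (\<delta> x)) 0"
proof -
  define Fam where "Fam = (K \<rightarrow>\<^sub>E Red L)"
  define T where "T g = red (\<Sum>x\<in>K. \<Phi> x (g x))" for g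
  have "card Fam = (p ^ L) ^ card K" unfolding Fam_def using fin by (simp add: card_funcsetE card_Red)
  then have card: "card Fam = p ^ (card K * L)" by (simp add: power_mult [symmetric] mult.commute)
  have "T ` Fam \<subseteq> Red D"
  proof clarify
    fix g assume g: "g \<in> Fam"
    show "T g \<in> Red D" unfolding T_def
    proof (rule red_in_Red)
      fix i assume "i \<ge> D"
      then have "coeff (\<Phi> x (g x)) i = 0" if "x \<in> K" for x
        using deg[OF that, of "g x"] PiE_mem[OF g[unfolded Fam_def] that] by (intro coeff_eq_0) simp
      then show "int p dvd coeff (\<Sum>x\<in>K. \<Phi> x (g x)) i" by (simp add: coeff_sum)
    qed
  qed
  then have "card (T ` Fam) \<le> p ^ D" using card_mono[OF card_Red(1)] card_Red(2) by metis
  also have "\<dots> < card Fam" unfolding card using p_gt_1 count by (intro power_strict_increasing)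
  finally have "\<not> inj_on T Fam" using pigeonhole by blast
  then obtain g g' where g: "g \<in> Fam" "g' \<in> Fam" "T g = T g'" "g \<noteq> g'" unfolding inj_on_def by blast
  show ?thesis
  proof (rule that[of "\<lambda>x. g x - g' x"])
    show "coeff (g x - g' x) l = 0" if "x \<in> K" "l \<ge> L" for x l
    proof -
      have "g x \<in> Red L" "g' x \<in> Red L" using g that by (auto simp: Fam_def)
      then show ?thesis using that by (simp add: Red_def)
    qed
    obtain x where x: "x \<in> K" "g x \<noteq> g' x" using g by (metis Fam_def PiE_ext)
    then have "\<not> cg 0 (g x) (g' x)"
      using Red_eqI PiE_mem[OF g(1)[unfolded Fam_def] x(1)] PiE_mem[OF g(2)[unfolded Fam_def] x(1)] by blast
    then show "\<exists>x\<in>K. \<not> cg 0 (g x - g' x) 0" using x cg_diff_iff[of 0 "g x" "g' x"] by blast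
    have "cg 0 (\<Sum>x\<in>K. \<Phi> x (g x)) (\<Sum>x\<in>K. \<Phi> x (g' x))" using g(3) by (simp add: T_def red_eq_iff)
    then have "cg 0 ((\<Sum>x\<in>K. \<Phi> x (g x)) - (\<Sum>x\<in>K. \<Phi> x (g' x))) 0" by (subst (asm) cg_diff_iff)
    then show "cg 0 (\<Sum>x\<in>K. \<Phi> x (g x - g' x)) 0" by (simp add: add sum_subtractf)
  qed
qed

lemma degree_power_le': "degree (f ^ k) \<le> k * degree (f :: int poly)"
  using degree_power_le[of f k] by (simp add: mult.commute)

text \<open>
Take \<open>H\<close> of the form \<open>\<Sum>i,j. g\<^sub>i\<^sub>j f\<^bsup>i\<rho>\<^esup> x\<^bsup>jR\<^esup>\<close> with \<open>i < d = p - 1\<close>, \<open>j < J\<close> and \<open>g\<^sub>i\<^sub>j\<close> of degree below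
\<open>L\<close>. At a point with \<open>x\<^bsup>R^2\<^esup> = x\<close> and \<open>f\<^bsup>\<rho>(R+1)\<^esup> = a\<close> the product \<open>f\<^bsup>d\<rho>\<^esup> H\<^sup>R\<close> equals
\<open>W = \<Sum>i,j. g\<^sub>i\<^sub>j(x\<^sup>R) a\<^sup>i f\<^bsup>(d-i)\<rho>\<^esup> x\<^sup>j\<close>, whose degree is only about \<open>L R\<close>. There are about \<open>d J L\<close> unknown
coefficients, so with \<open>J\<close> slightly larger than \<open>R/d\<close> they can be chosen nontrivially with \<open>W = 0\<close>. Then \<open>H\<close>
vanishes at all these points although its degree is just \<open>R\<^sup>2/d + O(R)\<close>. That \<open>W\<close> is obtained from an \<open>R\<close>-th power
replaces the high order of vanishing in the usual form of the method, and makes derivatives unnecessary.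
\<close>

lemma stepanov_polynomial:
  fixes a :: int
  assumes d: "d = p - 1" and R: "R = p ^ \<mu>" and \<rho>: "d * \<rho> + 1 = R"
    and f: "f = monom 1 e0 * h" and h: "\<not> int p dvd coeff h 0" and cop: "coprime e0 d"
    and m: "m = degree f" and large: "(2 + d * e0) * (m + 3) < R" and a: "\<not> int p dvd a"
  obtains H where "\<not> cg 0 H 0" "degree H \<le> R * \<rho> + (2 * m + 3) * R"
    "\<And>P. P \<in> Irr \<Longrightarrow> cg P (monom 1 (R ^ 2)) (monom 1 1) \<Longrightarrow> cg P (f ^ (\<rho> * (R + 1))) [:a:] \<Longrightarrow> cg P H 0"
proof -
  define x where "x = monom (1::int) 1"
  have xm: "monom 1 k = x ^ k" for k by (simp add: x_def monom_altdef)
  have d0: "d > 0" using p_gt_1 d by simp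
  have "d * e0 < d * \<rho>"
  proof -
    have "(2 + d * e0) * 1 \<le> (2 + d * e0) * (m + 3)" by (intro mult_le_mono2) simp
    then have "2 + d * e0 < d * \<rho> + 1" using large unfolding \<rho> mult_1_right by (rule le_less_trans)
    moreover have "2 + a < b + 1 \<Longrightarrow> a < b" for a b :: nat by simp
    ultimately show ?thesis by blast
  qed
  then have e\<rho>: "e0 < \<rho>" by simp
  \<comment> \<open>The largest \<open>L\<close> with \<open>d * L + d * e0 < R\<close>, which keeps the orders of the terms of \<open>H\<close> distinct.\<close>
  define L where "L = \<rho> - e0"
  \<comment> \<open>The excess of \<open>J\<close> over \<open>\<rho>\<close>, about \<open>R/d\<close>, makes the unknowns outnumber the coefficients of \<open>W\<close>.\<close>
  define J where "J = \<rho> + m + 3"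
  define K where "K = {..<d} \<times> {..<J}"
  define \<Phi> where "\<Phi> = (\<lambda>(i, j) g. pcompose g (monom 1 R) * (of_int (a ^ i) * f ^ ((d - i) * \<rho>) * monom 1 j))"
  define D where "D = R * L + m * R + J"
  have R0: "R > 0" using \<rho> by simp
  have L0: "L > 0" "L \<le> \<rho>" using e\<rho> by (auto simp: L_def)
  have d\<rho>: "d * \<rho> \<le> R" "\<rho> \<le> R" using \<rho> mult_le_mono1[of 1 d \<rho>] d0 by linarith+
  have dL: "d * L + d * e0 + 1 = R" using e\<rho> \<rho> by (simp add: L_def diff_mult_distrib2)
  obtain \<delta> where \<delta>: "\<And>x l. x \<in> K \<Longrightarrow> l \<ge> L \<Longrightarrow> coeff (\<delta> x) l = 0" "\<exists>x\<in>K. \<not> cg 0 (\<delta> x) 0"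
    "cg 0 (\<Sum>x\<in>K. \<Phi> x (\<delta> x)) 0"
  proof (rule pigeonhole_relation[of K \<Phi> L D])
    show "finite K" by (simp add: K_def)
    show "\<Phi> x (g - g') = \<Phi> x g - \<Phi> x g'" for x g g'
      by (simp add: \<Phi>_def case_prod_unfold pcompose_diff left_diff_distrib)
    show "degree (\<Phi> y g) < D" if yK: "y \<in> K" and gL: "g \<in> Red L" for y g
    proof -
      obtain i j where x: "y = (i, j)" "i < d" "j < J" using yK by (auto simp: K_def)
      have "degree g \<le> L - 1" using gL L0 by (intro degree_le) (auto simp: Red_def)
      then have "degree (pcompose g (monom 1 R)) \<le> (L - 1) * R"
        using degree_pcompose_le[of g "monom (1::int) R"] degree_monom_le[of "1::int" R]
        by (meson le_trans mult_le_mono)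
      moreover have "degree (f ^ ((d - i) * \<rho>)) \<le> m * R"
      proof -
        have "degree (f ^ ((d - i) * \<rho>)) \<le> (d - i) * \<rho> * m" unfolding m by (rule degree_power_le')
        also have "\<dots> \<le> R * m" using d\<rho> by (intro mult_le_mono) (auto intro: order.trans[OF mult_le_mono1[of "d - i" d]])
        finally show ?thesis by (simp add: mult.commute)
      qed
      moreover have "degree (of_int (a ^ i) :: int poly) = 0" by (simp only: degree_of_int)
      ultimately have "degree (\<Phi> y g) \<le> (L - 1) * R + (0 + m * R + j)"
        unfolding \<Phi>_def x by (auto intro!: order.trans[OF degree_mult_le] add_mono degree_monom_le simp del: of_int_power)
      also have "(L - 1) * R \<le> R * L" by (subst mult.commute) (intro mult_le_mono2, simp)
      then have "(L - 1) * R + (0 + m * R + j) < D" using x unfolding D_def by linarith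
      finally show ?thesis .
    qed
    have "(2 + d * e0) * J = 2 * \<rho> + e0 * (d * \<rho>) + (2 + d * e0) * (m + 3)"
      by (simp add: J_def algebra_simps)
    also have "\<dots> < 2 * R + e0 * R + R" using d\<rho> large by (intro add_le_less_mono add_mono mult_le_mono2) auto
    finally have *: "(2 + d * e0) * J < (3 + e0) * R" by (simp add: algebra_simps)
    have "R * J = (d * L) * J + (d * e0 + 1) * J" unfolding dL[symmetric] by (simp add: algebra_simps)
    moreover have "R * J = R * L + R * e0 + R * m + 3 * R" using e\<rho> by (simp add: J_def L_def algebra_simps)
    moreover have "(2 + d * e0) * J = (d * e0 + 1) * J + J" by (simp add: algebra_simps)
    ultimately have "D < d * L * J" using * by (simp add: D_def algebra_simps)
    then show "D < card K * L" by (simp add: K_def card_cartesian_product mult_ac)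
  qed blast
  define H where "H = (\<Sum>(i, j)\<in>K. \<delta> (i, j) * f ^ (i * \<rho>) * monom 1 (j * R))"
  show ?thesis
  proof (rule that[of H])
    have "H = (\<Sum>(i, j)\<in>K. \<delta> (i, j) * h ^ (i * \<rho>) * monom 1 (e0 * i * \<rho> + j * R))"
      unfolding H_def f by (intro sum.cong refl) (auto simp: power_mult_distrib xm power_mult [symmetric] power_add mult_ac)
    moreover have "\<not> cg 0 \<dots> 0"
      by (rule distinct_orders_nonzero[where d = d and L = L])
         (use \<delta> d0 \<rho> cop h dL in \<open>auto simp: K_def\<close>)
    ultimately show "\<not> cg 0 H 0" by simp
    show "degree H \<le> R * \<rho> + (2 * m + 3) * R"
      unfolding H_def
    proof (rule degree_sum_le)
      fix x assume "x \<in> K"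
      then obtain i j where x: "x = (i, j)" "i < d" "j < J" by (auto simp: K_def)
      have "degree (\<delta> x) \<le> R" using \<delta>(1)[OF \<open>x \<in> K\<close>] L0 d\<rho> by (intro degree_le) auto
      moreover have "degree (f ^ (i * \<rho>)) \<le> m * R"
      proof -
        have "degree (f ^ (i * \<rho>)) \<le> i * \<rho> * m" unfolding m by (rule degree_power_le')
        also have "\<dots> \<le> R * m" using d\<rho> x by (intro mult_le_mono) (auto intro: order.trans[OF mult_le_mono1[of i d]])
        finally show ?thesis by (simp add: mult.commute)
      qed
      ultimately have "degree (\<delta> x * f ^ (i * \<rho>) * monom 1 (j * R)) \<le> R + m * R + j * R"
        by (auto intro!: order.trans[OF degree_mult_le] add_mono degree_monom_le)
      also have "\<dots> = (1 + m + j) * R" by (simp add: algebra_simps)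
      also have "\<dots> \<le> (\<rho> + (2 * m + 3)) * R" using x by (intro mult_le_mono1) (simp add: J_def)
      finally show "degree (case x of (i, j) \<Rightarrow> \<delta> (i, j) * f ^ (i * \<rho>) * monom 1 (j * R)) \<le> R * \<rho> + (2 * m + 3) * R"
        by (simp add: x algebra_simps)
    qed (simp add: K_def)
    fix P assume P: "P \<in> Irr" and xQ: "cg P (monom 1 (R ^ 2)) (monom 1 1)"
      and fa: "cg P (f ^ (\<rho> * (R + 1))) [:a:]"
    have "cg P (f ^ (d * \<rho>) * H ^ R) (\<Sum>x\<in>K. \<Phi> x (\<delta> x))"
    proof -
      have "cg P (H ^ R) (pcompose H (monom 1 R))" unfolding R by (rule cg_mono[OF frobenius])
      then have "cg P (f ^ (d * \<rho>) * H ^ R) (f ^ (d * \<rho>) * pcompose H (monom 1 R))" by (intro cg_mult cg_refl)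
      also have "f ^ (d * \<rho>) * pcompose H (monom 1 R) =
          (\<Sum>x\<in>K. f ^ (d * \<rho>) * pcompose (\<delta> x * f ^ (fst x * \<rho>) * monom 1 (snd x * R)) (monom 1 R))"
        by (simp add: H_def pcompose_sum sum_distrib_left case_prod_unfold)
      also have "cg P \<dots> (\<Sum>x\<in>K. \<Phi> x (\<delta> x))"
      proof (rule cg_sum)
        fix y assume "y \<in> K"
        then obtain i j where y: "y = (i, j)" "i < d" "j < J" by (auto simp: K_def)
        have "f ^ (d * \<rho>) * pcompose (\<delta> y * f ^ (i * \<rho>) * monom 1 (j * R)) (monom 1 R) =
          pcompose (\<delta> y) (monom 1 R) * (f ^ (d * \<rho>) * pcompose (f ^ (i * \<rho>)) (monom 1 R) * monom 1 (j * R * R))"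
          by (simp add: pcompose_mult mono_comp mult_ac)
        also have "cg P \<dots> (pcompose (\<delta> y) (monom 1 R) * (of_int (a ^ i) * f ^ ((d - i) * \<rho>) * monom 1 j))"
        proof (rule cg_mult[OF cg_refl], rule cg_mult)
          have "cg P (f ^ (d * \<rho>) * pcompose (f ^ (i * \<rho>)) (monom 1 R)) (f ^ (d * \<rho>) * (f ^ (i * \<rho>)) ^ R)"
            unfolding R by (intro cg_mult cg_refl cg_sym[OF cg_mono[OF frobenius]])
          also have "f ^ (d * \<rho>) * (f ^ (i * \<rho>)) ^ R = (f ^ (\<rho> * (R + 1))) ^ i * f ^ ((d - i) * \<rho>)"
          proof -
            obtain k where k: "d = i + k" using y by (metis less_imp_add_positive)
            have "d * \<rho> + i * \<rho> * R = \<rho> * (R + 1) * i + (d - i) * \<rho>"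
              unfolding k by (simp add: algebra_simps)
            then show ?thesis by (simp add: power_mult [symmetric] power_add [symmetric])
          qed
          also have "cg P \<dots> ([:a:] ^ i * f ^ ((d - i) * \<rho>))" by (intro cg_mult cg_power fa cg_refl)
          also have "[:a:] ^ i = of_int (a ^ i)" by (simp add: of_int_poly poly_const_pow)
          finally show "cg P (f ^ (d * \<rho>) * pcompose (f ^ (i * \<rho>)) (monom 1 R)) (of_int (a ^ i) * f ^ ((d - i) * \<rho>))" .
          have "monom 1 (j * R * R) = monom (1::int) (R ^ 2) ^ j"
            by (simp add: monom_power power2_eq_square mult_ac)
          also have "cg P \<dots> (monom 1 1 ^ j)" by (intro cg_power xQ)
          also have "monom 1 1 ^ j = monom (1::int) j" by (simp add: monom_power)
          finally show "cg P (monom 1 (j * R * R)) (monom 1 j)" .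
        qed
        finally show "cg P (f ^ (d * \<rho>) * pcompose (\<delta> y * f ^ (fst y * \<rho>) * monom 1 (snd y * R)) (monom 1 R)) (\<Phi> y (\<delta> y))"
          by (simp add: \<Phi>_def y)
      qed
      finally show ?thesis .
    qed
    also have "cg P (\<Sum>x\<in>K. \<Phi> x (\<delta> x)) 0" by (rule cg_mono[OF \<delta>(3)])
    finally have "cg P (f ^ (d * \<rho>)) 0 \<or> cg P (H ^ R) 0" using IrrD(4)[OF P] by blast
    moreover have "\<not> cg P (f ^ (d * \<rho>)) 0"
    proof
      assume "cg P (f ^ (d * \<rho>)) 0"
      then have "cg P f 0" by (rule Irr_power_0[OF P])
      then have "cg P (f ^ (\<rho> * (R + 1))) (0 ^ (\<rho> * (R + 1)))" by (rule cg_power)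
      also have "0 ^ (\<rho> * (R + 1)) = (0::int poly)" using e\<rho> by (simp add: zero_power)
      finally have "cg P [:a:] 0" using cg_trans[OF cg_sym[OF fa]] by blast
      moreover have "coprime a (int p)" using a prime_p
        by (metis coprime_commute prime_imp_coprime prime_nat_int_transfer)
      then obtain c where "[a * c = 1] (mod int p)" using cong_solve_coprime_int by blast
      then have "cg 0 [:a * c:] [:1:]" unfolding cg_const_iff .
      then have "cg P ([:a:] * [:c:]) 1" using cg_mono by (simp add: one_pCons mult.commute)
      moreover have "cg P ([:a:] * [:c:]) 0" if "cg P [:a:] 0" using that by (rule cg_mult_0)
      ultimately have "cg P 1 0" using cg_trans[OF cg_sym] by blast
      then show False using Irr_one[OF P] by blast
    qed
    ultimately show "cg P H 0" using Irr_power_0[OF P] by blast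
  qed
qed

end

section \<open>Power sums of the inverse roots, and values of characters\<close>

text \<open>
Let \<open>G\<close> vanish at all the other values of \<open>z\<close>. Combining the power sums with the coefficients of \<open>G\<close> isolates the
powers of \<open>z i0\<close>, which therefore grow no faster than \<open>q\<^sup>\<mu>\<close>.
\<close>

lemma power_sums_bound:
  fixes z :: "'i \<Rightarrow> complex"
  assumes fin: "finite I" and q: "q > 0" and bd: "\<And>\<mu>. \<mu> \<ge> 1 \<Longrightarrow> cmod (\<Sum>i\<in>I. z i ^ \<mu>) \<le> C * q ^ \<mu>"
    and i0: "i0 \<in> I"
  shows "cmod (z i0) \<le> q"
proof (rule ccontr)
  assume "\<not> cmod (z i0) \<le> q"
  then have gt: "cmod (z i0) > q" by simp
  define V where "V = z ` I - {z i0}"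
  have finV: "finite V" using fin by (simp add: V_def)
  \<comment> \<open>A polynomial that vanishes at every value of \<open>z\<close> except \<open>z i0\<close>.\<close>
  define G where "G = (\<Prod>v\<in>V. [:- v, 1:])"
  define cnt where "cnt = card {i \<in> I. z i = z i0}"
  have "cnt \<noteq> 0" using i0 fin by (auto simp: cnt_def)
  have Gnz: "poly G (z i0) \<noteq> 0" using finV by (auto simp: G_def poly_prod V_def)
  have Gz: "poly G (z i) = 0" if "i \<in> I" "z i \<noteq> z i0" for i
    using that finV by (auto simp: G_def poly_prod V_def)
  define D where "D = C * (\<Sum>k\<le>degree G. cmod (coeff G k) * q ^ k)"
  have key: "real cnt * cmod (poly G (z i0)) * cmod (z i0) ^ \<mu> \<le> D * q ^ \<mu>" if "\<mu> \<ge> 1" for \<mu>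
  proof -
    have "(\<Sum>k\<le>degree G. coeff G k * (\<Sum>i\<in>I. z i ^ (\<mu> + k))) =
        (\<Sum>k\<le>degree G. \<Sum>i\<in>I. z i ^ \<mu> * (coeff G k * z i ^ k))"
      by (simp add: sum_distrib_left power_add mult_ac)
    also have "\<dots> = (\<Sum>i\<in>I. z i ^ \<mu> * poly G (z i))"
      by (subst sum.swap) (simp add: poly_altdef sum_distrib_left)
    also have "\<dots> = (\<Sum>i\<in>{i \<in> I. z i = z i0}. z i ^ \<mu> * poly G (z i))"
      using fin Gz by (intro sum.mono_neutral_right) auto
    also have "\<dots> = of_nat cnt * (z i0 ^ \<mu> * poly G (z i0))" by (simp add: cnt_def)
    finally have "real cnt * cmod (poly G (z i0)) * cmod (z i0) ^ \<mu> =
        cmod (\<Sum>k\<le>degree G. coeff G k * (\<Sum>i\<in>I. z i ^ (\<mu> + k)))"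
      by (simp add: norm_mult norm_power mult_ac)
    also have "\<dots> \<le> (\<Sum>k\<le>degree G. cmod (coeff G k) * (C * q ^ (\<mu> + k)))"
      using that by (intro order.trans[OF norm_sum] sum_mono) (auto simp: norm_mult intro!: mult_left_mono bd)
    also have "\<dots> = D * q ^ \<mu>" by (simp add: D_def sum_distrib_left sum_distrib_right power_add mult_ac)
    finally show ?thesis .
  qed
  define w where "w = cmod (z i0) / q"
  have "w > 1" using gt q by (simp add: w_def)
  define B where "B = real cnt * cmod (poly G (z i0))"
  have B: "B > 0" using \<open>cnt \<noteq> 0\<close> Gnz by (simp add: B_def)
  obtain n where n: "D / B < w ^ n" using real_arch_pow[OF \<open>w > 1\<close>] by blast
  also have "\<dots> \<le> w ^ Suc n" using \<open>w > 1\<close> by (intro power_increasing) auto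
  finally have "D < B * w ^ Suc n" using B by (simp add: field_simps)
  moreover have "B * w ^ Suc n \<le> D"
    using key[of "Suc n"] q unfolding B_def w_def power_divide by (simp add: field_simps)
  ultimately show False by simp
qed

text \<open>
The logarithmic derivative of \<open>\<Prod>i<k. (1 - \<omega> i X)\<close>, multiplied by \<open>X\<close>.
\<close>

lemma newton_for_product:
  fixes \<omega> :: "nat \<Rightarrow> complex"
  defines "T k \<equiv> Abs_fps (\<lambda>n. if n = 0 then 0 else - (\<Sum>i<k. \<omega> i ^ n))"
  shows "fps_X * fps_deriv (\<Prod>i<k. 1 - fps_const (\<omega> i) * fps_X) = (\<Prod>i<k. 1 - fps_const (\<omega> i) * fps_X) * T k"
proof (induction k)
  case 0
  have "T 0 = 0" by (simp add: T_def fps_eq_iff)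
  then show ?case by simp
next
  case (Suc k)
  define F where "F = (\<Prod>i<k. 1 - fps_const (\<omega> i) * fps_X)"
  define w where "w = fps_const (\<omega> k) * fps_X"
  define E where "E = Abs_fps (\<lambda>n. if n = 0 then 0 else \<omega> k ^ n)"
  have T: "T (Suc k) = T k - E" by (simp add: T_def E_def fps_eq_iff)
  have E: "(1 - w) * E = w"
  proof (rule fps_ext)
    fix n
    show "fps_nth ((1 - w) * E) n = fps_nth w n"
      by (cases n) (auto simp: w_def E_def left_diff_distrib mult.assoc fps_X_mult_nth)
  qed
  have d: "fps_deriv w = fps_const (\<omega> k)" by (simp add: w_def)
  have "fps_X * fps_deriv (F * (1 - w)) = (fps_X * fps_deriv F) * (1 - w) - F * w"
    by (simp add: d w_def algebra_simps)
  also have "\<dots> = F * T k * (1 - w) - F * ((1 - w) * E)" unfolding E F_def using Suc.IH by simp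
  also have "\<dots> = (F * (1 - w)) * T (Suc k)" unfolding T by (simp add: algebra_simps)
  finally show ?case by (simp add: F_def w_def mult.commute)
qed

text \<open>
Factor \<open>\<Sum>n. A n * z\<^sup>n = \<Prod>i. (1 - \<omega> i * z)\<close>. Newton's identities determine \<open>S n = - \<Sum>i. \<omega> i ^ n\<close>, so the power
sums of the \<open>\<omega> i ^ 2\<close> are \<open>O(q\<^sup>\<mu>)\<close> and \<open>\<bar>\<omega> i\<bar> \<le> \<surd>q\<close>. Even indices suffice, and they are the ones for
which Stepanov's method applies directly, since \<open>p\<^bsup>n/2\<^esup>\<close> is then a power of \<open>p\<close>.
\<close>

lemma newton_root_bound:
  fixes A S :: "nat \<Rightarrow> complex"
  assumes A0: "A 0 = 1" and Am: "\<And>n. n \<ge> m \<Longrightarrow> A n = 0"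
    and newton: "\<And>n. of_nat n * A n = (\<Sum>j=1..n. S j * A (n - j))"
    and q: "q > 0" and bd: "\<And>\<mu>. \<mu> \<ge> 1 \<Longrightarrow> cmod (S (2 * \<mu>)) \<le> C * q ^ \<mu>"
  shows "cmod (A 1) \<le> real (m - 1) * sqrt q"
proof -
  define a where "a = (\<Sum>n<m. monom (A n) n)"
  have ca: "coeff a n = A n" for n
    using Am by (simp add: a_def coeff_sum if_distrib sum.delta cong: if_cong)
  have "m > 0" using A0 Am[of 0] by (cases m) auto
  have deg: "degree a \<le> m - 1" using Am \<open>m > 0\<close> by (intro degree_le) (auto simp: ca)
  define D where "D = degree a"
  obtain root where root: "smult (lead_coeff a) (\<Prod>i<D. [:- root i, 1:]) = a"
    unfolding D_def using complex_poly_decompose' by blast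
  have a0: "poly a 0 = 1" using A0 ca[of 0] by (simp add: poly_0_coeff_0)
  have prod0: "lead_coeff a * (\<Prod>i<D. - root i) = 1"
    using a0 by (subst (asm) root[symmetric]) (simp add: poly_prod)
  have rnz: "root i \<noteq> 0" if "i < D" for i
  proof
    assume "root i = 0"
    then have "(\<Prod>i<D. - root i) = 0" using that by (intro prod_zero) auto
    then show False using prod0 by (metis mult_zero_right zero_neq_one)
  qed
  define \<omega> where "\<omega> i = 1 / root i" for i
  have a_eq: "a = (\<Prod>i<D. [:1, - \<omega> i:])"
  proof -
    have "(\<Prod>i<D. [:- root i, 1:]) = (\<Prod>i<D. smult (- root i) [:1, - \<omega> i:])"
      using rnz by (intro prod.cong) (auto simp: \<omega>_def)
    also have "\<dots> = smult (\<Prod>i<D. - root i) (\<Prod>i<D. [:1, - \<omega> i:])" by (rule prod_smult)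
    finally have "a = smult (lead_coeff a * (\<Prod>i<D. - root i)) (\<Prod>i<D. [:1, - \<omega> i:])"
      by (subst root[symmetric]) simp
    then show ?thesis unfolding prod0 by simp
  qed
  define F where "F = Abs_fps A"
  have F_eq: "F = (\<Prod>i<D. 1 - fps_const (\<omega> i) * fps_X)"
  proof -
    have "F = fps_of_poly a" by (simp add: F_def fps_eq_iff ca)
    also have "\<dots> = (\<Prod>i<D. fps_of_poly [:1, - \<omega> i:])" unfolding a_eq by (rule fps_of_poly_prod)
    also have "\<dots> = (\<Prod>i<D. 1 - fps_const (\<omega> i) * fps_X)"
    proof (intro prod.cong refl fps_ext)
      fix i n
      show "fps_nth (fps_of_poly [:1, - \<omega> i:]) n = fps_nth (1 - fps_const (\<omega> i) * fps_X) n"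
        by (simp add: coeff_pCons fps_X_def split: nat.splits)
    qed
    finally show ?thesis .
  qed
  define T where "T = Abs_fps (\<lambda>n. if n = 0 then 0 else - (\<Sum>i<D. \<omega> i ^ n))"
  define Sf where "Sf = Abs_fps (\<lambda>n. if n = 0 then 0 else S n)"
  have "fps_X * fps_deriv F = F * Sf"
  proof (rule fps_ext)
    fix n
    have "fps_nth (F * Sf) n = (\<Sum>i=0..n. fps_nth Sf i * fps_nth F (n - i))"
      by (subst mult.commute) (rule fps_mult_nth)
    also have "\<dots> = (\<Sum>i=1..n. S i * A (n - i))"
      by (rule sum.mono_neutral_cong_right) (auto simp: Sf_def F_def)
    also have "\<dots> = of_nat n * A n" by (rule newton[symmetric])
    also have "\<dots> = fps_nth (fps_X * fps_deriv F) n" by (cases n) (simp_all add: F_def)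
    finally show "fps_nth (fps_X * fps_deriv F) n = fps_nth (F * Sf) n" by simp
  qed
  moreover have "fps_X * fps_deriv F = F * T" unfolding F_eq T_def by (rule newton_for_product)
  ultimately have "F * Sf = F * T" by (simp only:)
  moreover have "F \<noteq> 0" using A0 by (auto simp: F_def fps_eq_iff intro!: exI[of _ 0])
  ultimately have "Sf = T" using mult_left_cancel[of F Sf T] by blast
  then have Sn: "S n = - (\<Sum>i<D. \<omega> i ^ n)" if "n \<ge> 1" for n
  proof -
    have "fps_nth Sf n = fps_nth T n" using \<open>Sf = T\<close> by simp
    then show ?thesis using that by (simp add: Sf_def T_def)
  qed
  have \<omega>: "cmod (\<omega> i) \<le> sqrt q" if "i < D" for i
  proof -
    have "cmod ((\<omega> i) ^ 2) \<le> q"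
    proof (rule power_sums_bound[where I = "{..<D}" and z = "\<lambda>i. \<omega> i ^ 2" and C = C])
      fix \<mu> :: nat assume "\<mu> \<ge> 1"
      then show "cmod (\<Sum>i<D. (\<omega> i ^ 2) ^ \<mu>) \<le> C * q ^ \<mu>"
        using bd[of \<mu>] Sn[of "2 * \<mu>"] by (simp add: power_mult)
    qed (use q that in auto)
    then show ?thesis by (simp add: norm_power real_le_rsqrt)
  qed
  have "A 1 = - (\<Sum>i<D. \<omega> i)" using newton[of 1] Sn[of 1] A0 by simp
  then have "cmod (A 1) \<le> (\<Sum>i<D. cmod (\<omega> i))" by (simp add: norm_sum)
  also have "\<dots> \<le> real D * sqrt q" using sum_mono[of "{..<D}" "\<lambda>i. cmod (\<omega> i)" "\<lambda>_. sqrt q"] \<omega> by simp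
  also have "\<dots> \<le> real (m - 1) * sqrt q" using deg q by (intro mult_right_mono) (auto simp: D_def)
  finally show ?thesis .
qed

locale char_p_character = char_p +
  fixes \<chi> :: "int \<Rightarrow> complex"
  assumes nonprincipal: "nonprincipal_character p \<chi>"
begin

lemma chi: "dirichlet_character p \<chi>"
  using nonprincipal by (simp add: nonprincipal_character_def)

lemma chi_cong: "[a = b] (mod int p) \<Longrightarrow> \<chi> a = \<chi> b"
  using chi by (simp add: dirichlet_character_def)

lemma chi_mult: "\<chi> (a * b) = \<chi> a * \<chi> b"
  using chi by (simp add: dirichlet_character_def)

lemma chi_1: "\<chi> 1 = 1" using chi by (rule dirichlet_character_one)

lemma chi_power: "\<chi> (a ^ n) = \<chi> a ^ n"
  by (induction n) (simp_all add: chi_1 chi_mult)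

lemma chi_prod: "\<chi> (prod f A) = (\<Prod>x\<in>A. \<chi> (f x))"
  by (induction A rule: infinite_finite_induct) (simp_all add: chi_1 chi_mult)

lemma chi_0_iff: "\<chi> a = 0 \<longleftrightarrow> int p dvd a"
  using dirichlet_character_prime_eq_0_iff[OF chi prime_p] .

lemma chi_power_p1: assumes "\<not> int p dvd a" shows "\<chi> a ^ (p - 1) = 1"
proof -
  have "\<chi> a ^ p = \<chi> a" using chi_cong[OF cong_power_p[of a]] by (simp add: chi_power)
  then have "\<chi> a * \<chi> a ^ (p - 1) = \<chi> a * 1" using p_gt_1 by (simp flip: power_Suc)
  then show ?thesis using assms chi_0_iff by (simp only: mult_cancel_left) simp
qed

lemma norm_chi: "cmod (\<chi> a) = (if int p dvd a then 0 else 1)"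
proof (cases "int p dvd a")
  case False
  have "cmod (\<chi> a) ^ (p - 1) = 1" using chi_power_p1[OF False] by (metis norm_one norm_power)
  then have "cmod (\<chi> a) = 1"
    using p_gt_1 power_eq_imp_eq_base[of "cmod (\<chi> a)" "p - 1" 1] by simp
  then show ?thesis using False by simp
qed (use chi_0_iff in auto)

lemma norm_chi_le: "cmod (\<chi> a) \<le> 1" by (simp add: norm_chi)

lemma chi_nontrivial: "\<exists>c. \<not> int p dvd c \<and> \<chi> c \<noteq> 1"
proof (rule ccontr)
  assume *: "\<not> ?thesis"
  have "\<chi> = principal_character p"
  proof
    fix n
    have "coprime n (int p) \<longleftrightarrow> \<not> int p dvd n"
      using chi_0_iff chi by (simp add: dirichlet_character_def)
    then show "\<chi> n = principal_character p n"
      using * chi_0_iff by (auto simp: principal_character_def)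
  qed
  then show False using nonprincipal by (simp add: nonprincipal_character_def)
qed

lemma sum_residues_reindex:
  fixes F :: "int \<Rightarrow> 'b :: comm_monoid_add"
  assumes F: "\<And>a b. [a = b] (mod int p) \<Longrightarrow> F a = F b"
    and inj: "\<And>a b. [\<phi> a = \<phi> b] (mod int p) \<Longrightarrow> [a = b] (mod int p)"
  shows "(\<Sum>c\<in>{0..<int p}. F (\<phi> c)) = (\<Sum>c\<in>{0..<int p}. F c)"
proof -
  have i: "inj_on (\<lambda>c. \<phi> c mod int p) {0..<int p}"
  proof (rule inj_onI)
    fix a b assume ab: "a \<in> {0..<int p}" "b \<in> {0..<int p}" and "\<phi> a mod int p = \<phi> b mod int p"
    then have "[\<phi> a = \<phi> b] (mod int p)" by (simp add: cong_def)
    then have "[a = b] (mod int p)" by (rule inj)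
    then show "a = b" using ab by (simp add: cong_def)
  qed
  have im: "(\<lambda>c. \<phi> c mod int p) ` {0..<int p} = {0..<int p}"
    using p_gt_1 by (intro endo_inj_surj[OF _ _ i]) auto
  have "(\<Sum>c\<in>{0..<int p}. F c) = (\<Sum>c\<in>(\<lambda>c. \<phi> c mod int p) ` {0..<int p}. F c)" by (simp only: im)
  also have "\<dots> = (\<Sum>c\<in>{0..<int p}. F (\<phi> c mod int p))" by (subst sum.reindex[OF i]) simp
  also have "\<dots> = (\<Sum>c\<in>{0..<int p}. F (\<phi> c))" by (intro sum.cong refl F) (simp add: cong_def)
  finally show ?thesis by simp
qed

lemma cong_mult_cancel: "\<not> int p dvd c \<Longrightarrow> [c * a = c * b] (mod int p) \<Longrightarrow> [a = b] (mod int p)"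
  using prime_p by (metis cong_mult_lcancel coprime_commute prime_imp_coprime prime_nat_int_transfer)

lemma chi_sum: "(\<Sum>c\<in>{0..<int p}. \<chi> c) = 0"
proof -
  obtain c where c: "\<not> int p dvd c" "\<chi> c \<noteq> 1" using chi_nontrivial by blast
  have "(\<Sum>a\<in>{0..<int p}. \<chi> (c * a)) = (\<Sum>a\<in>{0..<int p}. \<chi> a)"
    by (rule sum_residues_reindex[OF chi_cong cong_mult_cancel[OF c(1)]])
  then have "\<chi> c * (\<Sum>a\<in>{0..<int p}. \<chi> a) = (\<Sum>a\<in>{0..<int p}. \<chi> a)"
    by (simp add: chi_mult sum_distrib_left)
  then show ?thesis using c by (metis mult_cancel_right1)
qed

end

section \<open>Weil's bound for characters of products of linear factors\<close>

lemma (in char_p) geometric: "(p - 1) * (\<Sum>l<n. p ^ l) + 1 = p ^ n"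
proof (induction n)
  case (Suc n)
  have "(p - 1) * (\<Sum>l<Suc n. p ^ l) + 1 = (p - 1) * p ^ n + ((p - 1) * (\<Sum>l<n. p ^ l) + 1)"
    by (simp add: algebra_simps)
  also have "\<dots> = (p - 1) * p ^ n + p ^ n" unfolding Suc.IH ..
  also have "\<dots> = p ^ Suc n" using p_gt_1 by (cases p) simp_all
  finally show ?case .
qed simp

lemma (in char_p) geometric_double:
  "(\<Sum>l<2 * \<mu>. p ^ l) = (\<Sum>l<\<mu>. p ^ l) * (p ^ \<mu> + 1)"
proof -
  define s where "s = (\<Sum>l<\<mu>. p ^ l)"
  define d where "d = p - 1"
  define R where "R = p ^ \<mu>"
  have s: "d * s + 1 = R" unfolding s_def d_def R_def by (rule geometric)
  have "d * (\<Sum>l<2 * \<mu>. p ^ l) + 1 = R * R"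
    unfolding geometric d_def R_def by (simp add: power_add [symmetric] mult_2)
  also have "\<dots> = d * (s * (R + 1)) + 1" unfolding s[symmetric] by (simp add: algebra_simps)
  finally have "d * (\<Sum>l<2 * \<mu>. p ^ l) = d * (s * (R + 1))" by simp
  then show ?thesis using p_gt_1 by (simp add: s_def R_def d_def)
qed

text \<open>
The sum of \<open>\<chi>(\<Prod>r. (c + r)\<^bsup>e r\<^esup>)\<close>, translated so that the root whose exponent is coprime to \<open>p - 1\<close> is \<open>0\<close>.
\<close>

locale kummer_sum = char_p_character +
  fixes Rs :: "int set" and e :: "int \<Rightarrow> nat"
  assumes finite_Rs: "finite Rs" and zero_in: "0 \<in> Rs"
    and nonzero: "\<And>r. r \<in> Rs \<Longrightarrow> r \<noteq> 0 \<Longrightarrow> \<not> int p dvd r"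
    and simple_root: "coprime (e 0) (p - 1)"
begin

lemma pcompose_power_left: "pcompose (u ^ n) v = pcompose u v ^ n" for u v :: "int poly"
proof (induction n)
  case 0
  show ?case by (simp add: one_pCons pcompose_pCons)
qed (simp add: pcompose_mult)

definition kummer_poly :: "int poly" where "kummer_poly = (\<Prod>r\<in>Rs. [:r, -1:] ^ e r)"

definition root_prod :: "int poly \<Rightarrow> int" where "root_prod g = (\<Prod>r\<in>Rs. poly g r ^ e r)"

definition char_at_roots :: "int poly \<Rightarrow> complex" where "char_at_roots g = \<chi> (root_prod g)"

lemma char_at_roots_mult: "char_at_roots (g * h) = char_at_roots g * char_at_roots h"
  unfolding char_at_roots_def root_prod_def by (simp add: power_mult_distrib prod.distrib chi_mult)

lemma cg_poly_cong: assumes "cg 0 g h" shows "[poly g r = poly h r] (mod int p)"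
proof -
  obtain u v where "g = h + of_nat p * u + 0 * v" using assms by (rule cgE)
  then have "poly g r = poly h r + int p * poly u r" by simp
  then show ?thesis by (simp add: cong_iff_dvd_diff)
qed

lemma char_at_roots_cong: "cg 0 g h \<Longrightarrow> char_at_roots g = char_at_roots h"
  unfolding char_at_roots_def root_prod_def by (intro chi_cong cong_prod cong_pow cg_poly_cong)

text \<open>
The left side is the norm of \<open>kummer_poly\<close> at the point \<open>x\<close> of the field with \<open>p\<^sup>n\<close> elements: the Frobenius map turns
its powers into conjugates. The norm of each linear factor \<open>r - x\<close> is a power of \<open>P(r)\<close>.
\<close>

lemma kummer_poly_norm:
  assumes P: "P \<in> Irr" and dvd: "degree P dvd n"
  shows "cg P (kummer_poly ^ (\<Sum>l<n. p ^ l)) [:root_prod P ^ (n div degree P):]"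
proof -
  define t where "t = n div degree P"
  have n: "n = degree P * t" using dvd by (simp add: t_def)
  have "kummer_poly ^ (\<Sum>l<n. p ^ l) = (\<Prod>l<n. kummer_poly ^ (p ^ l))" by (rule power_sum)
  also have "cg P \<dots> (\<Prod>l<n. pcompose kummer_poly (monom 1 (p ^ l)))" by (intro cg_prod cg_mono[OF frobenius])
  also have "(\<Prod>l<n. pcompose kummer_poly (monom 1 (p ^ l))) = (\<Prod>l<n. \<Prod>r\<in>Rs. ([:r:] - monom 1 (p ^ l)) ^ e r)"
  proof (intro prod.cong refl)
    fix l
    have "pcompose [:r, -1:] (monom 1 (p ^ l)) = [:r:] - monom 1 (p ^ l)" for r :: int
      by (simp add: pcompose_pCons)
    then show "pcompose kummer_poly (monom 1 (p ^ l)) = (\<Prod>r\<in>Rs. ([:r:] - monom 1 (p ^ l)) ^ e r)"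
      by (simp add: kummer_poly_def pcompose_prod pcompose_power_left)
  qed
  also have "\<dots> = (\<Prod>r\<in>Rs. (\<Prod>l<n. [:r:] - monom 1 (p ^ l)) ^ e r)"
    by (subst prod.swap) (simp add: prod_power_distrib)
  also have "cg P \<dots> (\<Prod>r\<in>Rs. ([:poly P r:] ^ t) ^ e r)"
    unfolding n by (intro cg_prod cg_power norm_Irr_mult[OF P])
  also have "(\<Prod>r\<in>Rs. ([:poly P r:] ^ t) ^ e r) = [:root_prod P ^ t:]"
  proof -
    have "(\<Prod>r\<in>Rs. ([:poly P r:] ^ t) ^ e r) = (\<Prod>r\<in>Rs. [:poly P r ^ e r:]) ^ t"
      by (simp add: prod_power_distrib poly_const_pow power_mult [symmetric] mult.commute)
    also have "(\<Prod>r\<in>Rs. [:poly P r ^ e r:]) = [:root_prod P:]"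
      unfolding root_prod_def using finite_Rs by (induction Rs rule: finite_induct) (simp_all add: one_pCons)
    finally show ?thesis by (simp add: poly_const_pow)
  qed
  finally show ?thesis by (simp add: t_def)
qed

definition cofactor :: "int poly" where
  "cofactor = [:(-1) ^ e 0:] * (\<Prod>r\<in>Rs - {0}. [:r, -1:] ^ e r)"

lemma kummer_poly_eq: "kummer_poly = monom 1 (e 0) * cofactor"
proof -
  have "[:0, -1:] = [:0, 1:] * [:-1::int:]" by simp
  then have "[:0, -1:] ^ e 0 = [:0, 1:] ^ e 0 * [:-1::int:] ^ e 0" by (simp only: power_mult_distrib)
  then have "[:0, -1:] ^ e 0 = monom 1 (e 0) * [:(-1::int) ^ e 0:]"
    by (simp only: monom_altdef poly_const_pow smult_1_left)
  then show ?thesis unfolding kummer_poly_def cofactor_def using finite_Rs zero_in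
    by (simp add: prod.remove[of Rs 0] mult.assoc)
qed

lemma cofactor_0: "\<not> int p dvd coeff cofactor 0"
proof -
  have "coeff cofactor 0 = poly cofactor 0" by (simp add: poly_0_coeff_0)
  also have "\<dots> = (-1) ^ e 0 * (\<Prod>r\<in>Rs - {0}. r ^ e r)" by (simp add: cofactor_def poly_prod)
  finally have "\<chi> (coeff cofactor 0) \<noteq> 0"
    using finite_Rs nonzero chi_0_iff p_gt_1
    by (simp add: chi_mult chi_prod chi_power)
  then show ?thesis by (simp add: chi_0_iff)
qed

lemma kummer_poly_nonzero: "\<not> cg 0 kummer_poly 0"
proof
  assume "cg 0 kummer_poly 0"
  then have "cg 0 (monom 1 (e 0)) 0 \<or> cg 0 cofactor 0" unfolding kummer_poly_eq cg_0_mult_iff .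
  then show False
  proof
    assume "cg 0 (monom 1 (e 0)) 0"
    then have "[coeff (monom 1 (e 0)) (e 0) = coeff 0 (e 0)] (mod int p)" unfolding cg_0_iff by blast
    then show False using p_gt_1 by (simp add: cong_0_iff)
  next
    assume "cg 0 cofactor 0"
    then show False using cofactor_0 by (auto simp: cg_0_iff cong_0_iff)
  qed
qed

text \<open>
The primes at whose points in the field with \<open>p\<^sup>n\<close> elements \<open>kummer_poly\<close> has a value of norm \<open>a\<close>; \<open>norm_count\<close> is
the number of these points.
\<close>

definition norm_class :: "nat \<Rightarrow> int \<Rightarrow> int poly set" where
  "norm_class n a = {P \<in> Irr_dvd n. root_prod P ^ (n div degree P) mod int p = a}"

definition norm_count :: "nat \<Rightarrow> int \<Rightarrow> nat" where
  "norm_count n a = (\<Sum>P\<in>norm_class n a. degree P)"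

lemma norm_class_power:
  assumes "P \<in> norm_class n a" shows "cg P (kummer_poly ^ (\<Sum>l<n. p ^ l)) [:a:]"
proof -
  have "cg P (kummer_poly ^ (\<Sum>l<n. p ^ l)) [:root_prod P ^ (n div degree P):]"
    using assms by (intro kummer_poly_norm) (auto simp: norm_class_def Irr_dvd_def)
  also have "cg P [:root_prod P ^ (n div degree P):] [:a:]"
    by (rule cg_mono) (use assms in \<open>auto simp: cg_const_iff norm_class_def cong_def\<close>)
  finally show ?thesis .
qed

lemma finite_norm_class: "n \<ge> 1 \<Longrightarrow> finite (norm_class n a)"
  using finite_Irr_dvd by (simp add: norm_class_def)

lemma sum_norm_count: assumes "n \<ge> 1" shows "(\<Sum>a\<in>{0..<int p}. norm_count n a) = p ^ n"
proof -
  have "(\<lambda>P. root_prod P ^ (n div degree P) mod int p) ` Irr_dvd n \<subseteq> {0..<int p}" using p_gt_1 by auto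
  from sum.group[OF finite_Irr_dvd[OF assms] _ this, of degree] show ?thesis
    using assms by (simp add: norm_count_def norm_class_def sum_degree_Irr_dvd)
qed

text \<open>
Norm zero means that \<open>kummer_poly\<close> itself vanishes at the point.
\<close>

lemma norm_count_0: assumes "n \<ge> 1" shows "norm_count n 0 \<le> degree kummer_poly"
  unfolding norm_count_def
proof (rule sum_degree_divisors_le)
  fix P assume P: "P \<in> norm_class n 0"
  then have "P \<in> Irr" by (simp add: norm_class_def Irr_dvd_def)
  moreover have "cg P (kummer_poly ^ (\<Sum>l<n. p ^ l)) 0" using norm_class_power[OF P] by simp
  ultimately show "cg P kummer_poly 0" by (rule Irr_power_0)
qed (use finite_norm_class assms kummer_poly_nonzero in \<open>auto simp: norm_class_def Irr_dvd_def\<close>)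

text \<open>
Stepanov's polynomial vanishes at all the points counted. For the finitely many \<open>\<mu>\<close> for which the construction
is not available the trivial bound is absorbed by the constant.
\<close>

lemma norm_count_upper:
  obtains C where "C \<ge> 0"
    "\<And>\<mu> a. \<mu> \<ge> 1 \<Longrightarrow> a \<in> {1..<int p} \<Longrightarrow> real (norm_count (2 * \<mu>) a) \<le> real p ^ (2 * \<mu>) / real (p - 1) + C * real p ^ \<mu>"
proof -
  define m where "m = degree kummer_poly"
  define d where "d = p - 1"
  define C1 where "C1 = (2 + d * e 0) * (m + 3)"
  have d0: "d > 0" using p_gt_1 by (simp add: d_def)
  show ?thesis
  proof (rule that[of "real C1 + real (2 * m + 3)"])
    fix \<mu> :: nat and a :: int assume \<mu>: "\<mu> \<ge> 1" and a: "a \<in> {1..<int p}"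
    define R where "R = p ^ \<mu>"
    define \<rho> where "\<rho> = (\<Sum>l<\<mu>. p ^ l)"
    have \<rho>: "d * \<rho> + 1 = R" unfolding R_def \<rho>_def d_def by (rule geometric)
    have RR: "real p ^ (2 * \<mu>) = real R * real R" by (simp add: R_def power_add [symmetric] mult_2)
    show "real (norm_count (2 * \<mu>) a) \<le> real p ^ (2 * \<mu>) / real (p - 1) + (real C1 + real (2 * m + 3)) * real p ^ \<mu>"
    proof (cases "C1 < R")
      case True
      have na: "\<not> int p dvd a" using a by (simp add: zdvd_not_zless)
      obtain H where H: "\<not> cg 0 H 0" "degree H \<le> R * \<rho> + (2 * m + 3) * R"
        "\<And>P. P \<in> Irr \<Longrightarrow> cg P (monom 1 (R ^ 2)) (monom 1 1) \<Longrightarrow> cg P (kummer_poly ^ (\<rho> * (R + 1))) [:a:] \<Longrightarrow> cg P H 0"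
        using stepanov_polynomial[OF d_def R_def \<rho> kummer_poly_eq cofactor_0 _ m_def _ na] simple_root True
        unfolding C1_def d_def by blast
      have "norm_count (2 * \<mu>) a \<le> degree H"
        unfolding norm_count_def
      proof (rule sum_degree_divisors_le)
        fix P assume P: "P \<in> norm_class (2 * \<mu>) a"
        then have PI: "P \<in> Irr" "degree P dvd 2 * \<mu>" by (simp_all add: norm_class_def Irr_dvd_def)
        show "cg P H 0"
        proof (rule H(3)[OF PI(1)])
          obtain t where t: "2 * \<mu> = degree P * t" using PI(2) by (rule dvdE)
          have "R ^ 2 = p ^ (degree P * t)"
            unfolding t [symmetric] R_def power_mult [symmetric] by (simp only: mult.commute)
          then have "monom (1::int) (R ^ 2) = monom 1 1 ^ (p ^ (degree P * t))"
            by (simp add: monom_power)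
          then show "cg P (monom 1 (R ^ 2)) (monom 1 1)" using fermat_Irr_mult[OF PI(1)] by simp
          show "cg P (kummer_poly ^ (\<rho> * (R + 1))) [:a:]"
            using norm_class_power[OF P] by (simp only: geometric_double \<rho>_def R_def)
        qed
      qed (use finite_norm_class[of "2 * \<mu>"] \<mu> H(1) in \<open>auto simp: norm_class_def Irr_dvd_def\<close>)
      also note H(2)
      finally have "real (norm_count (2 * \<mu>) a) \<le> real (R * \<rho> + (2 * m + 3) * R)" by (simp only: of_nat_le_iff)
      also have "\<dots> = real R * real \<rho> + real (2 * m + 3) * real R" by simp
      finally have A: "real (norm_count (2 * \<mu>) a) \<le> real R * real \<rho> + real (2 * m + 3) * real R" .
      have "real \<rho> \<le> real R / real d"
      proof -
        have "real d * real \<rho> \<le> real R" unfolding \<rho>[symmetric] by simp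
        then show ?thesis using d0 by (simp add: field_simps)
      qed
      then have "real R * real \<rho> \<le> real R * (real R / real d)" by (intro mult_left_mono) auto
      moreover have "0 \<le> real C1 * real R" by simp
      ultimately have "real R * real \<rho> + real (2 * m + 3) * real R \<le> real R * real R / real d + (real C1 + real (2 * m + 3)) * real R"
        unfolding distrib_right times_divide_eq_right by linarith
      with A have "real (norm_count (2 * \<mu>) a) \<le> real R * real R / real d + (real C1 + real (2 * m + 3)) * real R"
        by (rule order.trans)
      then show ?thesis unfolding RR by (simp add: d_def R_def)
    next
      case False
      have "norm_count (2 * \<mu>) a \<le> (\<Sum>P\<in>Irr_dvd (2 * \<mu>). degree P)"
        unfolding norm_count_def norm_class_def using \<mu> by (intro sum_mono2 finite_Irr_dvd) auto
      also have "\<dots> = R * R" using \<mu> by (subst sum_degree_Irr_dvd) (simp_all add: R_def power_add [symmetric] mult_2)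
      finally have "real (norm_count (2 * \<mu>) a) \<le> real R * real R" by (metis of_nat_le_iff of_nat_mult)
      also have "\<dots> \<le> real C1 * real R" using False by (intro mult_right_mono) auto
      also have "\<dots> \<le> real p ^ (2 * \<mu>) / real (p - 1) + (real C1 + real (2 * m + 3)) * real p ^ \<mu>"
        by (simp add: R_def distrib_right)
      finally show ?thesis .
    qed
  qed simp
qed

lemma point_sum_eq:
  assumes "n \<ge> 1"
  shows "point_sum char_at_roots n = (\<Sum>a\<in>{0..<int p}. of_nat (norm_count n a) * \<chi> a)"
proof -
  have "(\<Sum>a\<in>{0..<int p}. of_nat (norm_count n a) * \<chi> a) =
    (\<Sum>a\<in>{0..<int p}. \<Sum>P\<in>{P \<in> Irr_dvd n. root_prod P ^ (n div degree P) mod int p = a}. of_nat (degree P) * char_at_roots P ^ (n div degree P))"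
  proof (intro sum.cong refl)
    fix a
    have "char_at_roots P ^ (n div degree P) = \<chi> a" if "root_prod P ^ (n div degree P) mod int p = a" for P
      using that chi_cong[of "root_prod P ^ (n div degree P)" a] by (auto simp: char_at_roots_def chi_power cong_def)
    then show "of_nat (norm_count n a) * \<chi> a =
      (\<Sum>P\<in>{P \<in> Irr_dvd n. root_prod P ^ (n div degree P) mod int p = a}. of_nat (degree P) * char_at_roots P ^ (n div degree P))"
      by (simp add: norm_count_def norm_class_def sum_distrib_right)
  qed
  also have "\<dots> = (\<Sum>P\<in>Irr_dvd n. of_nat (degree P) * char_at_roots P ^ (n div degree P))"
    using p_gt_1 assms by (intro sum.group finite_Irr_dvd) auto
  finally show ?thesis by (simp add: point_sum_def)
qed

text \<open>
The counts for the \<open>p - 1\<close> nonzero norms add up to \<open>p\<^bsup>2\<mu>\<^esup> + O(1)\<close>, so the upper bounds for the others give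
a lower bound of the same quality for each. The common main term cancels since \<open>\<Sum>a. \<chi> a = 0\<close>.
\<close>

lemma point_sum_bound:
  obtains C where "\<And>\<mu>. \<mu> \<ge> 1 \<Longrightarrow> cmod (point_sum char_at_roots (2 * \<mu>)) \<le> C * real p ^ \<mu>"
proof -
  obtain C where C: "C \<ge> 0"
    "\<And>\<mu> a. \<mu> \<ge> 1 \<Longrightarrow> a \<in> {1..<int p} \<Longrightarrow> real (norm_count (2 * \<mu>) a) \<le> real p ^ (2 * \<mu>) / real (p - 1) + C * real p ^ \<mu>"
    using norm_count_upper by blast
  define d where "d = real (p - 1)"
  have d0: "d > 0" using p_gt_1 by (simp add: d_def)
  define I where "I = {1..<int p}"
  have cardI: "real (card I) = d" using p_gt_1 by (simp add: I_def d_def of_nat_diff)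
  have res: "{0..<int p} = insert 0 I" "0 \<notin> I" "finite I" using p_gt_1 by (auto simp: I_def)
  define m where "m = real (degree kummer_poly)"
  show ?thesis
  proof (rule that[of "d * (m + d * C)"])
    fix \<mu> :: nat assume \<mu>: "\<mu> \<ge> 1"
    define Q where "Q = real p ^ (2 * \<mu>)"
    define R where "R = real p ^ \<mu>"
    have R1: "R \<ge> 1" using p_gt_1 by (simp add: R_def)
    define c where "c a = real (norm_count (2 * \<mu>) a)" for a
    have up: "c a \<le> Q / d + C * R" if "a \<in> I" for a
      using C(2)[OF \<mu>] that by (simp add: c_def Q_def R_def d_def I_def)
    have tot: "c 0 + (\<Sum>a\<in>I. c a) = Q"
    proof -
      have "(\<Sum>a\<in>{0..<int p}. c a) = Q"
      proof -
        have "(\<Sum>a\<in>{0..<int p}. norm_count (2 * \<mu>) a) = p ^ (2 * \<mu>)" using \<mu> by (intro sum_norm_count) simp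
        then have "real (\<Sum>a\<in>{0..<int p}. norm_count (2 * \<mu>) a) = real (p ^ (2 * \<mu>))" by (simp only:)
        then show ?thesis by (simp add: c_def Q_def)
      qed
      then show ?thesis using res by simp
    qed
    have c0: "c 0 \<le> m" using norm_count_0[of "2 * \<mu>"] \<mu> by (simp add: c_def m_def)
    have lo: "c a \<ge> Q / d - m - d * C * R" if a: "a \<in> I" for a
    proof -
      have "(\<Sum>b\<in>I - {a}. c b) \<le> (\<Sum>b\<in>I - {a}. Q / d + C * R)" by (intro sum_mono up) auto
      also have "\<dots> = (d - 1) * (Q / d + C * R)"
      proof -
        have "card I \<ge> 1" using a res card_gt_0_iff[of I] by fastforce
        then have "real (card (I - {a})) = d - 1" using a cardI by (simp add: card_Diff_singleton of_nat_diff)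
        then show ?thesis by simp
      qed
      also have "\<dots> \<le> Q - Q / d + d * C * R"
        using d0 C R1 by (simp add: field_simps)
      finally have "(\<Sum>b\<in>I - {a}. c b) \<le> Q - Q / d + d * C * R" .
      moreover have "(\<Sum>b\<in>I. c b) = c a + (\<Sum>b\<in>I - {a}. c b)" using a res by (simp add: sum.remove)
      ultimately show ?thesis using tot c0 by linarith
    qed
    have m0: "m \<ge> 0" by (simp add: m_def)
    have d1: "d \<ge> 1" using p_gt_1 by (simp add: d_def)
    have dev: "\<bar>c a - Q / d\<bar> \<le> (m + d * C) * R" if "a \<in> I" for a
    proof -
      have "m * 1 \<le> m * R" using m0 R1 by (intro mult_left_mono)
      moreover have "1 * (C * R) \<le> d * (C * R)" using C(1) R1 d1 by (intro mult_right_mono) auto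
      ultimately have "m \<le> m * R" "C * R \<le> d * (C * R)" by simp_all
      then show ?thesis using up[OF that] lo[OF that] m0 C R1 by (simp add: abs_le_iff algebra_simps)
    qed
    have "(\<Sum>a\<in>I. \<chi> a) = 0" using chi_sum chi_0_iff[of 0] unfolding res using res by simp
    then have "(\<Sum>a\<in>I. of_real (Q / d) * \<chi> a) = 0"
      unfolding sum_distrib_left [symmetric] by simp
    moreover have "point_sum char_at_roots (2 * \<mu>) = (\<Sum>a\<in>I. of_real (c a) * \<chi> a)"
      using point_sum_eq[of "2 * \<mu>"] \<mu> chi_0_iff[of 0] unfolding res using res by (simp add: c_def)
    ultimately have "point_sum char_at_roots (2 * \<mu>) = (\<Sum>a\<in>I. of_real (c a - Q / d) * \<chi> a)"
      by (simp add: left_diff_distrib sum_subtractf)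
    also have "cmod \<dots> \<le> (\<Sum>a\<in>I. (m + d * C) * R)"
    proof (intro order.trans[OF norm_sum] sum_mono)
      fix a assume "a \<in> I"
      have "cmod (of_real (c a - Q / d) * \<chi> a) = \<bar>c a - Q / d\<bar> * cmod (\<chi> a)" by (simp only: norm_mult norm_of_real)
      also have "\<dots> \<le> (m + d * C) * R * 1" using dev[OF \<open>a \<in> I\<close>] norm_chi_le by (intro mult_mono) (auto intro: order.trans[OF abs_ge_zero])
      finally show "cmod (of_real (c a - Q / d) * \<chi> a) \<le> (m + d * C) * R" by simp
    qed
    also have "\<dots> = d * (m + d * C) * R" using cardI by simp
    finally show "cmod (point_sum char_at_roots (2 * \<mu>)) \<le> d * (m + d * C) * real p ^ \<mu>" by (simp add: R_def)
  qed
qed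

text \<open>
Once the degree is at least the number of roots, the value of \<open>g\<close> at \<open>0\<close> can be multiplied by \<open>c\<close> without changing
its values at the other roots, by adding a multiple of a Lagrange basis polynomial. This permutes the monic
polynomials and multiplies the sum by \<open>\<chi>(c)\<^bsup>e 0\<^esup> \<noteq> 1\<close>.
\<close>

lemma L_coeff_vanishes:
  assumes n: "n \<ge> card Rs"
  shows "L_coeff char_at_roots n = 0"
proof -
  obtain c where c: "\<not> int p dvd c" "\<chi> c \<noteq> 1" using chi_nontrivial by blast
  have ce: "\<chi> c ^ e 0 \<noteq> 1"
  proof
    assume 1: "\<chi> c ^ e 0 = 1"
    have 2: "\<chi> c ^ (p - 1) = 1" using chi_power_p1[OF c(1)] .
    show False
    proof (cases "e 0 = 0")
      case True
      then have "p - 1 = 1" using simple_root by simp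
      then show False using 2 c(2) by simp
    next
      case False
      then obtain x y where "e 0 * x = (p - 1) * y + 1" using coprime_bezout_strong[of "e 0" "p - 1"] simple_root
        by (metis bezout_nat coprime_iff_gcd_eq_1)
      then have "(\<chi> c ^ e 0) ^ x = (\<chi> c ^ (p - 1)) ^ y * \<chi> c" by (simp add: power_mult [symmetric] power_add)
      then show False using 1 2 c(2) by simp
    qed
  qed
  \<comment> \<open>\<open>\<beta>\<close> below is congruent to \<open>1\<close> at \<open>0\<close> and vanishes at the other roots.\<close>
  define w where "w = (\<Prod>r\<in>Rs - {0}. - r)"
  have "\<not> int p dvd w"
  proof -
    have "\<chi> w \<noteq> 0" using finite_Rs nonzero by (simp add: w_def chi_prod chi_0_iff)
    then show ?thesis by (simp add: chi_0_iff)
  qed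
  then have "coprime w (int p)" using prime_p by (metis coprime_commute prime_imp_coprime prime_nat_int_transfer)
  then obtain w' where w': "[w * w' = 1] (mod int p)" using cong_solve_coprime_int by blast
  define \<beta> where "\<beta> = smult w' (\<Prod>r\<in>Rs - {0}. [:- r, 1:])"
  have \<beta>0: "[poly \<beta> 0 = 1] (mod int p)" using w' by (simp add: \<beta>_def poly_prod w_def mult.commute)
  have \<beta>r: "poly \<beta> r = 0" if "r \<in> Rs" "r \<noteq> 0" for r
    using that finite_Rs by (auto simp: \<beta>_def poly_prod)
  have deg: "degree \<beta> < n"
  proof -
    have "degree \<beta> \<le> degree (\<Prod>r\<in>Rs - {0}. [:- r, 1:])" unfolding \<beta>_def by (rule degree_smult_le)
    also have "\<dots> = (\<Sum>r\<in>Rs - {0}. degree [:- r, 1:])" by (rule degree_prod_eq_sum_degree) simp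
    also have "\<dots> = card Rs - 1" using finite_Rs zero_in by simp
    finally show ?thesis using n finite_Rs zero_in card_gt_0_iff[of Rs] by fastforce
  qed
  define T where "T g = red (g + smult ((c - 1) * poly g 0) \<beta>)" for g
  have pT: "[poly (T g) r = poly g r + (c - 1) * poly g 0 * poly \<beta> r] (mod int p)" for g r
    using cg_poly_cong[OF cg_red(1)[of 0 "g + smult ((c - 1) * poly g 0) \<beta>"], of r] by (simp add: T_def)
  have T0: "[poly (T g) 0 = c * poly g 0] (mod int p)" for g
  proof -
    have "[poly g 0 + (c - 1) * poly g 0 * poly \<beta> 0 = poly g 0 + (c - 1) * poly g 0 * 1] (mod int p)"
      by (intro cong_add cong_mult \<beta>0 cong_refl)
    then show ?thesis using cong_trans[OF pT[of g 0]] by (simp add: algebra_simps)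
  qed
  have inj: "inj_on T (Mon n)"
  proof (rule inj_onI)
    fix g g' assume g: "g \<in> Mon n" "g' \<in> Mon n" "T g = T g'"
    have "[c * poly g 0 = c * poly g' 0] (mod int p)"
      using cong_trans[OF cong_sym[OF T0[of g]]] T0[of g'] g(3) by simp
    then have g0: "[poly g 0 = poly g' 0] (mod int p)" using c(1) by (rule cong_mult_cancel[rotated])
    have "cg 0 (g + smult ((c - 1) * poly g 0) \<beta>) (g' + smult ((c - 1) * poly g' 0) \<beta>)"
      using g(3) by (simp add: T_def red_eq_iff)
    moreover have "cg 0 (smult ((c - 1) * poly g 0) \<beta>) (smult ((c - 1) * poly g' 0) \<beta>)"
      unfolding cg_0_iff using g0 by (auto intro!: cong_mult)
    ultimately have "cg 0 (g + smult ((c - 1) * poly g 0) \<beta> - smult ((c - 1) * poly g 0) \<beta>)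
        (g' + smult ((c - 1) * poly g' 0) \<beta> - smult ((c - 1) * poly g' 0) \<beta>)" by (rule cg_diff)
    then show "g = g'" using g Mon_eqI by simp
  qed
  have "T ` Mon n \<subseteq> Mon n"
  proof clarify
    fix g assume g: "g \<in> Mon n"
    show "T g \<in> Mon n" unfolding T_def
      using deg g by (intro red_in_Mon) (auto simp: Mon_def coeff_eq_0)
  qed
  then have im: "T ` Mon n = Mon n" using endo_inj_surj[OF card_Mon(1) _ inj] by blast
  have XT: "char_at_roots (T g) = \<chi> c ^ e 0 * char_at_roots g" for g
  proof -
    have "char_at_roots (T g) = \<chi> (poly (T g) 0) ^ e 0 * (\<Prod>r\<in>Rs - {0}. \<chi> (poly (T g) r) ^ e r)"
      unfolding char_at_roots_def root_prod_def chi_prod chi_power using finite_Rs zero_in by (rule prod.remove)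
    also have "\<chi> (poly (T g) 0) = \<chi> c * \<chi> (poly g 0)" using chi_cong[OF T0[of g]] by (simp add: chi_mult)
    also have "(\<Prod>r\<in>Rs - {0}. \<chi> (poly (T g) r) ^ e r) = (\<Prod>r\<in>Rs - {0}. \<chi> (poly g r) ^ e r)"
      using chi_cong[OF pT[of g]] \<beta>r by (intro prod.cong refl) simp
    finally have "char_at_roots (T g) = \<chi> c ^ e 0 * (\<chi> (poly g 0) ^ e 0 * (\<Prod>r\<in>Rs - {0}. \<chi> (poly g r) ^ e r))"
      by (simp add: power_mult_distrib)
    also have "\<chi> (poly g 0) ^ e 0 * (\<Prod>r\<in>Rs - {0}. \<chi> (poly g r) ^ e r) = char_at_roots g"
      unfolding char_at_roots_def root_prod_def chi_prod chi_power using finite_Rs zero_in by (rule prod.remove[symmetric])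
    finally show ?thesis .
  qed
  have "L_coeff char_at_roots n = (\<Sum>g\<in>T ` Mon n. char_at_roots g)" by (simp only: im L_coeff_def)
  also have "\<dots> = \<chi> c ^ e 0 * L_coeff char_at_roots n"
    by (subst sum.reindex[OF inj]) (simp add: XT L_coeff_def sum_distrib_left)
  finally show ?thesis using ce by (metis mult_cancel_right1)
qed

lemma weil_at_0:
  "cmod (\<Sum>c\<in>{0..<int p}. \<chi> (\<Prod>r\<in>Rs. (c + r) ^ e r)) \<le> real (card Rs - 1) * sqrt (real p)"
proof -
  have "L_coeff char_at_roots 1 = (\<Sum>c\<in>{0..<int p}. \<chi> (\<Prod>r\<in>Rs. (c + r) ^ e r))"
    unfolding L_coeff_def
  proof (rule sum.reindex_bij_witness[where i = "\<lambda>c. [:c, 1:]" and j = "\<lambda>g. coeff g 0"])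
    fix g assume g: "g \<in> Mon 1"
    show "[:coeff g 0, 1:] = g"
    proof (rule poly_eqI)
      fix i show "coeff [:coeff g 0, 1:] i = coeff g i"
        using g by (cases i; cases "i - 1") (auto simp: Mon_def coeff_pCons split: nat.splits)
    qed
    then have "poly g r = coeff g 0 + r" for r by (metis add.right_neutral mult.right_neutral mult_zero_right poly_0 poly_pCons)
    then show "\<chi> (\<Prod>r\<in>Rs. (coeff g 0 + r) ^ e r) = char_at_roots g" by (simp add: char_at_roots_def root_prod_def)
    show "coeff g 0 \<in> {0..<int p}" using g by (simp add: Mon_def)
  qed (auto simp: Mon_def coeff_pCons split: nat.splits)
  moreover obtain C where "\<And>\<mu>. \<mu> \<ge> 1 \<Longrightarrow> cmod (point_sum char_at_roots (2 * \<mu>)) \<le> C * real p ^ \<mu>"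
    using point_sum_bound by blast
  then have "cmod (L_coeff char_at_roots 1) \<le> real (card Rs - 1) * sqrt (real p)"
    using L_coeff_vanishes p_gt_1
  proof (intro newton_root_bound[where S = "point_sum char_at_roots" and C = C])
    show "L_coeff char_at_roots 0 = 1" by (simp add: L_coeff_def Mon_0 char_at_roots_def root_prod_def chi_1)
    show "of_nat n * L_coeff char_at_roots n = (\<Sum>j=1..n. point_sum char_at_roots j * L_coeff char_at_roots (n - j))" for n
      by (rule newton_identity[OF char_at_roots_mult char_at_roots_cong])
  qed auto
  ultimately show ?thesis by simp
qed

end

text \<open>
Weil's bound. Translating by \<open>r0\<close> moves the distinguished root to \<open>0\<close>.
\<close>

theorem (in char_p_character) weil_bound:
  assumes "finite Rs" "r0 \<in> Rs" "\<And>r. r \<in> Rs \<Longrightarrow> r \<noteq> r0 \<Longrightarrow> \<not> [r = r0] (mod int p)"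
    and "coprime (e r0) (p - 1)"
  shows "cmod (\<Sum>c\<in>{0..<int p}. \<chi> (\<Prod>r\<in>Rs. (c + r) ^ e r)) \<le> real (card Rs - 1) * sqrt (real p)"
proof -
  define Rs' where "Rs' = (\<lambda>r. r - r0) ` Rs"
  define e' where "e' = (\<lambda>r. e (r + r0))"
  have inj: "inj_on (\<lambda>r. r - r0) Rs" by (auto simp: inj_on_def)
  interpret kummer_sum p \<chi> Rs' e'
    using assms by unfold_locales (auto simp: Rs'_def e'_def cong_iff_dvd_diff)
  define F where "F c = \<chi> (\<Prod>r\<in>Rs. (c + r) ^ e r)" for c
  have "F c = F c'" if "[c = c'] (mod int p)" for c c'
    unfolding F_def using that by (intro chi_cong cong_prod cong_pow cong_add cong_refl)
  then have "(\<Sum>c\<in>{0..<int p}. F (c - r0)) = (\<Sum>c\<in>{0..<int p}. F c)"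
  proof (rule sum_residues_reindex)
    show "[a = b] (mod int p)" if "[a - r0 = b - r0] (mod int p)" for a b
      using cong_add[OF that cong_refl[of r0]] by simp
  qed
  moreover have "F (c - r0) = \<chi> (\<Prod>r\<in>Rs'. (c + r) ^ e' r)" for c
    unfolding F_def Rs'_def by (subst prod.reindex[OF inj]) (simp add: e'_def algebra_simps)
  moreover have "card Rs' = card Rs" unfolding Rs'_def by (rule card_image[OF inj])
  ultimately show ?thesis using weil_at_0 by (simp add: F_def)
qed

section \<open>Burgess's inequality\<close>

text \<open>
The power mean inequality. Exponents that are powers of two suffice below, and for them it follows from
repeated use of the Cauchy-Schwarz inequality.
\<close>

lemma sum_power_2power_le:
  fixes f :: "'a \<Rightarrow> real"
  assumes "\<And>x. x \<in> A \<Longrightarrow> f x \<ge> 0"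
  shows "(\<Sum>x\<in>A. f x) ^ (2 ^ s) \<le> real (card A) ^ (2 ^ s - 1) * (\<Sum>x\<in>A. f x ^ (2 ^ s))"
proof (induction s)
  case (Suc s)
  define n where "n = real (card A)"
  define k where "k = (2::nat) ^ s"
  have k: "k \<ge> 1" by (simp add: k_def)
  have "(\<Sum>x\<in>A. f x) ^ (2 ^ Suc s) = ((\<Sum>x\<in>A. f x) ^ k)\<^sup>2"
    by (simp add: k_def power_mult [symmetric] mult.commute)
  also have "\<dots> \<le> (n ^ (k - 1) * (\<Sum>x\<in>A. f x ^ k))\<^sup>2"
    using Suc.IH assms unfolding k_def n_def by (intro power_mono) (auto intro!: sum_nonneg zero_le_power)
  also have "\<dots> = n ^ (2 * (k - 1)) * (\<Sum>x\<in>A. 1 * f x ^ k)\<^sup>2"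
    by (simp add: power_mult_distrib power_mult [symmetric] mult.commute)
  also have "\<dots> \<le> n ^ (2 * (k - 1)) * ((\<Sum>x\<in>A. 1\<^sup>2) * (\<Sum>x\<in>A. (f x ^ k)\<^sup>2))"
    by (intro mult_left_mono Cauchy_Schwarz_ineq_sum) (simp add: n_def)
  also have "\<dots> = n ^ (2 * (k - 1) + 1) * (\<Sum>x\<in>A. f x ^ (2 * k))"
    by (simp add: n_def power_mult [symmetric] mult.commute mult.left_commute)
  also have "2 * (k - 1) + 1 = 2 * k - 1" using k by simp
  finally show ?case by (simp add: n_def k_def)
qed simp

definition tuples :: "nat \<Rightarrow> nat \<Rightarrow> (nat \<Rightarrow> nat) set" where
  "tuples k T = {..<2 * k} \<rightarrow>\<^sub>E {1..T}"

text \<open>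
Some entry of the tuple occurs at no other place, so its linear factor in the expanded moment has exponent
\<open>1\<close> or \<open>p - 2\<close>, both coprime to \<open>p - 1\<close>.
\<close>

definition unpaired :: "nat \<Rightarrow> (nat \<Rightarrow> nat) \<Rightarrow> bool" where
  "unpaired k \<tau> \<longleftrightarrow> (\<exists>i0<2 * k. \<forall>i<2 * k. \<tau> i = \<tau> i0 \<longrightarrow> i = i0)"

text \<open>
A tuple without an unpaired entry has at most \<open>k\<close> different values, so it factors through \<open>{..<k}\<close>.
\<close>

lemma card_paired_tuples:
  "card {\<tau> \<in> tuples k T. \<not> unpaired k \<tau>} \<le> k ^ (2 * k) * T ^ k"
proof -
  define I where "I = {..<2 * k}"
  define \<Psi> where "\<Psi> = (\<lambda>(\<sigma>, g). restrict (\<lambda>i. g (\<sigma> i :: nat)) I :: nat \<Rightarrow> nat)"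
  define D where "D = (I \<rightarrow>\<^sub>E {..<k}) \<times> ({..<k} \<rightarrow>\<^sub>E {1..T})"
  have "{\<tau> \<in> tuples k T. \<not> unpaired k \<tau>} \<subseteq> \<Psi> ` D"
  proof
    fix \<tau> assume "\<tau> \<in> {\<tau> \<in> tuples k T. \<not> unpaired k \<tau>}"
    then have \<tau>: "\<tau> \<in> I \<rightarrow>\<^sub>E {1..T}" and pair: "\<And>i0. i0 \<in> I \<Longrightarrow> \<exists>i\<in>I. \<tau> i = \<tau> i0 \<and> i \<noteq> i0"
      by (auto simp: tuples_def unpaired_def I_def)
    define V where "V = \<tau> ` I"
    have finI: "finite I" by (simp add: I_def)
    have finV: "finite V" by (simp add: V_def I_def)
    have "2 \<le> card {i \<in> I. \<tau> i = v}" if v: "v \<in> V" for v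
    proof -
      obtain i0 where i0: "i0 \<in> I" "v = \<tau> i0" using v by (auto simp: V_def)
      obtain i1 where "i1 \<in> I" "\<tau> i1 = \<tau> i0" "i1 \<noteq> i0" using pair[OF i0(1)] by blast
      then have "{i0, i1} \<subseteq> {i \<in> I. \<tau> i = v}" "card {i0, i1} = 2" using i0 by auto
      then show ?thesis using card_mono[of "{i \<in> I. \<tau> i = v}" "{i0, i1}"] finI by simp
    qed
    then have "(\<Sum>v\<in>V. 2) \<le> (\<Sum>v\<in>V. card {i \<in> I. \<tau> i = v})" by (intro sum_mono)
    also have "\<dots> = card I"
      using sum.group[OF finI finV, of \<tau> "\<lambda>_. 1::nat"] by (simp add: V_def)
    finally have "card V \<le> k" by (simp add: I_def)
    then obtain \<phi> where \<phi>: "inj_on \<phi> V" "\<phi> ` V \<subseteq> {..<k}"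
      using card_le_inj[OF finV, of "{..<k}"] by auto
    define \<sigma> where "\<sigma> = restrict (\<lambda>i. \<phi> (\<tau> i)) I"
    define g where "g = restrict (\<lambda>j. if j \<in> \<phi> ` V then the_inv_into V \<phi> j else (SOME v. v \<in> {1..T})) {..<k}"
    have gv: "the_inv_into V \<phi> (\<phi> (\<tau> i)) = \<tau> i" if "i \<in> I" for i
      using that \<phi>(1) by (intro the_inv_into_f_f) (auto simp: V_def)
    have "\<sigma> \<in> I \<rightarrow>\<^sub>E {..<k}" using \<phi>(2) by (auto simp: \<sigma>_def V_def)
    moreover have "g \<in> {..<k} \<rightarrow>\<^sub>E {1..T}"
    proof (cases "k = 0")
      case False
      then have "0 \<in> I" by (simp add: I_def)
      then have "\<tau> 0 \<in> {1..T}" using \<tau> by blast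
      then have "(SOME v. v \<in> {1..T}) \<in> {1..T}" by (rule someI)
      moreover have "the_inv_into V \<phi> (\<phi> v) \<in> {1..T}" if "v \<in> V" for v
        using that gv \<tau> by (auto simp: V_def)
      ultimately show ?thesis by (auto simp: g_def)
    qed (simp add: g_def fun_eq_iff)
    moreover have "\<tau> = \<Psi> (\<sigma>, g)"
    proof
      fix i show "\<tau> i = \<Psi> (\<sigma>, g) i"
      proof (cases "i \<in> I")
        case True
        then have "\<phi> (\<tau> i) < k" "\<phi> (\<tau> i) \<in> \<phi> ` V" using \<phi>(2) by (auto simp: V_def)
        then show ?thesis using True gv[OF True] by (simp add: \<Psi>_def \<sigma>_def g_def)
      next
        case False
        then show ?thesis using \<tau> by (auto simp: \<Psi>_def PiE_def extensional_def)
      qed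
    qed
    ultimately show "\<tau> \<in> \<Psi> ` D" unfolding D_def by blast
  qed
  moreover have "finite D" by (simp add: D_def I_def finite_PiE)
  ultimately have "card {\<tau> \<in> tuples k T. \<not> unpaired k \<tau>} \<le> card D"
    using surj_card_le by blast
  also have "card D = k ^ (2 * k) * T ^ k"
    by (simp add: D_def I_def card_cartesian_product card_funcsetE)
  finally show ?thesis .
qed

context char_p_character
begin

lemma p_ge_3: "p \<ge> 3"
proof (rule ccontr)
  assume "\<not> p \<ge> 3"
  then have "p - 1 = 1" using p_gt_1 by simp
  moreover obtain c where c: "\<not> int p dvd c" "\<chi> c \<noteq> 1" using chi_nontrivial by blast
  ultimately show False using chi_power_p1[OF c(1)] c(2) by simp
qed

lemma cnj_chi: "cnj (\<chi> a) = \<chi> (a ^ (p - 2))"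
proof (cases "int p dvd a")
  case True
  then have "\<chi> a = 0" by (simp add: chi_0_iff)
  then show ?thesis using p_ge_3 by (simp add: chi_power zero_power)
next
  case False
  have "p - 1 = Suc (p - 2)" using p_ge_3 by simp
  then have "\<chi> a * \<chi> a ^ (p - 2) = \<chi> a ^ (p - 1)" by (simp only: power_Suc)
  also have "\<dots> = 1" by (rule chi_power_p1[OF False])
  also have "\<dots> = \<chi> a * cnj (\<chi> a)" using norm_chi[of a] False by (simp add: complex_norm_square [symmetric])
  finally show ?thesis using False chi_0_iff by (simp add: chi_power)
qed

lemma coprime_p_minus_2: "coprime (p - 2) (p - 1)"
proof -
  have "p - 1 = Suc (p - 2)" using p_ge_3 by simp
  then show ?thesis by (metis coprime_Suc_right_nat)
qed

text \<open>
Expand the power, with \<open>cnj (\<chi> a) = \<chi>(a\<^bsup>p-2\<^esup>)\<close>. Weil's bound applies to each unpaired tuple, and the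
remaining tuples are few.
\<close>

lemma moment_bound:
  assumes T: "T \<le> p"
  shows "(\<Sum>l\<in>{0..<int p}. cmod (\<Sum>t=1..T. \<chi> (l + int t)) ^ (2 * k))
    \<le> real (k ^ (2 * k)) * real T ^ k * real p + 2 * real k * real T ^ (2 * k) * sqrt (real p)"
proof -
  define ex where "ex i = (if i < k then 1 else p - 2)" for i :: nat
  define G where "G \<tau> l = \<chi> (\<Prod>i<2 * k. (l + int (\<tau> i)) ^ ex i)" for \<tau> :: "nat \<Rightarrow> nat" and l
  define Z where "Z l = (\<Sum>t=1..T. \<chi> (l + int t))" for l
  have expand: "of_real (cmod (Z l) ^ (2 * k)) = (\<Sum>\<tau>\<in>tuples k T. G \<tau> l)" for l
  proof -
    have "of_real (cmod (Z l) ^ (2 * k)) = of_real ((cmod (Z l))\<^sup>2) ^ k"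
      by (simp only: power_mult of_real_power)
    also have "\<dots> = (Z l * cnj (Z l)) ^ k" unfolding complex_norm_square ..
    also have "\<dots> = (\<Prod>i<2 * k. if i < k then Z l else cnj (Z l))"
    proof -
      define w where "w i = (if i < k then Z l else cnj (Z l))" for i
      have "{..<2 * k} = {..<k} \<union> {k..<2 * k}" by auto
      then have "prod w {..<2 * k} = prod w ({..<k} \<union> {k..<2 * k})" by (rule arg_cong)
      also have "\<dots> = prod w {..<k} * prod w {k..<2 * k}" by (rule prod.union_disjoint) auto
      also have "prod w {..<k} = (\<Prod>i<k. Z l)" by (intro prod.cong) (auto simp: w_def)
      also have "prod w {k..<2 * k} = (\<Prod>i\<in>{k..<2 * k}. cnj (Z l))" by (intro prod.cong) (auto simp: w_def)
      finally show ?thesis by (simp add: power_mult_distrib w_def)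
    qed
    also have "\<dots> = (\<Prod>i<2 * k. \<Sum>t=1..T. \<chi> ((l + int t) ^ ex i))"
      by (intro prod.cong refl) (simp add: Z_def ex_def cnj_chi)
    also have "\<dots> = (\<Sum>\<tau>\<in>tuples k T. \<Prod>i<2 * k. \<chi> ((l + int (\<tau> i)) ^ ex i))"
      unfolding tuples_def by (rule prod_sum_PiE) auto
    finally show ?thesis by (simp add: G_def chi_prod)
  qed
  have fin: "finite (tuples k T)" unfolding tuples_def by (intro finite_PiE) auto
  have card_tuples: "card (tuples k T) = T ^ (2 * k)" by (simp add: tuples_def card_funcsetE)
  have trivial: "cmod (\<Sum>l\<in>{0..<int p}. G \<tau> l) \<le> real p" for \<tau>
    using norm_sum[of "G \<tau>" "{0..<int p}"] sum_bounded_above[of "{0..<int p}" "\<lambda>l. cmod (G \<tau> l)" 1] norm_chi_le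
    by (simp add: G_def)
  have good: "cmod (\<Sum>l\<in>{0..<int p}. G \<tau> l) \<le> 2 * real k * sqrt (real p)"
    if \<tau>: "\<tau> \<in> tuples k T" and un: "unpaired k \<tau>" for \<tau>
  proof -
    obtain i0 where i0: "i0 < 2 * k" "\<And>i. i < 2 * k \<Longrightarrow> \<tau> i = \<tau> i0 \<Longrightarrow> i = i0"
      using un unfolding unpaired_def by blast
    define I where "I = {..<2 * k}"
    define \<theta> where "\<theta> i = int (\<tau> i)" for i
    define Rs where "Rs = \<theta> ` I"
    define e where "e r = (\<Sum>i\<in>{i \<in> I. \<theta> i = r}. ex i)" for r
    have rng: "1 \<le> \<theta> i" "\<theta> i \<le> int p" if "i \<in> I" for i
      using PiE_mem[OF \<tau>[unfolded tuples_def], of i] that T by (auto simp: I_def \<theta>_def)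
    have G: "G \<tau> l = \<chi> (\<Prod>r\<in>Rs. (l + r) ^ e r)" for l
    proof -
      have "(\<Prod>r\<in>Rs. (l + r) ^ e r) = (\<Prod>r\<in>Rs. \<Prod>i\<in>{i \<in> I. \<theta> i = r}. (l + \<theta> i) ^ ex i)"
        by (intro prod.cong refl) (simp add: e_def power_sum)
      also have "\<dots> = (\<Prod>i\<in>I. (l + \<theta> i) ^ ex i)"
        unfolding Rs_def by (rule prod.group) (auto simp: I_def)
      finally show ?thesis by (simp add: G_def I_def \<theta>_def)
    qed
    have "{i \<in> I. \<theta> i = \<theta> i0} = {i0}" using i0 by (auto simp: I_def \<theta>_def)
    then have "e (\<theta> i0) = ex i0" by (simp add: e_def)
    then have cop: "coprime (e (\<theta> i0)) (p - 1)" using coprime_p_minus_2 by (simp add: ex_def)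
    have "cmod (\<Sum>l\<in>{0..<int p}. \<chi> (\<Prod>r\<in>Rs. (l + r) ^ e r)) \<le> real (card Rs - 1) * sqrt (real p)"
    proof (rule weil_bound[where ?r0.0 = "\<theta> i0"])
      show "\<theta> i0 \<in> Rs" using i0 by (simp add: Rs_def I_def)
      have i0I: "i0 \<in> I" using i0 by (simp add: I_def)
      fix r assume "r \<in> Rs" "r \<noteq> \<theta> i0"
      then obtain i where i: "i \<in> I" "r = \<theta> i" by (auto simp: Rs_def)
      show "\<not> [r = \<theta> i0] (mod int p)"
      proof
        assume "[r = \<theta> i0] (mod int p)"
        then have "int p dvd r - \<theta> i0" by (simp add: cong_iff_dvd_diff)
        moreover have "\<bar>r - \<theta> i0\<bar> < int p" using rng[OF i(1)] rng[OF i0I] i by linarith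
        ultimately show False using \<open>r \<noteq> \<theta> i0\<close> dvd_imp_le_int[of "r - \<theta> i0" "int p"] by simp
      qed
    qed (use cop in \<open>simp_all add: Rs_def I_def\<close>)
    also have "\<dots> \<le> 2 * real k * sqrt (real p)"
    proof (rule mult_right_mono)
      have "card Rs \<le> 2 * k" unfolding Rs_def using card_image_le[of I \<theta>] by (simp add: I_def)
      then show "real (card Rs - 1) \<le> 2 * real k" by simp
    qed simp
    finally show ?thesis by (simp add: G)
  qed
  have "complex_of_real (\<Sum>l\<in>{0..<int p}. cmod (Z l) ^ (2 * k)) = (\<Sum>\<tau>\<in>tuples k T. \<Sum>l\<in>{0..<int p}. G \<tau> l)"
    by (simp only: of_real_sum expand) (rule sum.swap)
  then have "cmod (complex_of_real (\<Sum>l\<in>{0..<int p}. cmod (Z l) ^ (2 * k))) \<le> (\<Sum>\<tau>\<in>tuples k T. cmod (\<Sum>l\<in>{0..<int p}. G \<tau> l))"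
    by (simp only: norm_sum)
  moreover have "(\<Sum>l\<in>{0..<int p}. cmod (Z l) ^ (2 * k)) \<ge> 0" by (intro sum_nonneg) simp
  ultimately have "(\<Sum>l\<in>{0..<int p}. cmod (Z l) ^ (2 * k)) \<le> (\<Sum>\<tau>\<in>tuples k T. cmod (\<Sum>l\<in>{0..<int p}. G \<tau> l))"
    by (simp only: norm_of_real abs_of_nonneg)
  also have "\<dots> \<le> (\<Sum>\<tau>\<in>tuples k T. (if unpaired k \<tau> then 0 else real p) + 2 * real k * sqrt (real p))"
    using good trivial by (intro sum_mono) (auto intro: order.trans[OF trivial])
  also have "\<dots> = real (card {\<tau> \<in> tuples k T. \<not> unpaired k \<tau>}) * real p + real (T ^ (2 * k)) * (2 * real k * sqrt (real p))"
    by (simp add: sum.distrib sum.If_cases[OF fin] card_tuples Int_def Collect_neg_eq[symmetric])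
  also have "\<dots> \<le> real (k ^ (2 * k) * T ^ k) * real p + real (T ^ (2 * k)) * (2 * real k * sqrt (real p))"
    by (intro add_right_mono mult_right_mono) (use card_paired_tuples in \<open>auto simp only: of_nat_le_iff\<close>)
  finally show ?thesis by (simp add: Z_def mult_ac)
qed

text \<open>
Let \<open>\<nu>(\<lambda>)\<close> be the number of pairs with \<open>x i / y j = \<lambda>\<close>. Then \<open>E\<close> bounds the sum of \<open>\<nu>(\<lambda>)\<^sup>2\<close>, and Hoelder's
inequality separates it from the moment of the sums \<open>\<Sum>t\<le>T. \<chi>(\<lambda> + t)\<close>.
\<close>

lemma burgess_inequality:
  fixes x :: "'i \<Rightarrow> int" and y :: "'j \<Rightarrow> int"
  assumes fin: "finite I" "finite J" and y: "\<And>j. j \<in> J \<Longrightarrow> \<not> int p dvd y j"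
    and T: "T \<le> p" and k: "k = 2 ^ s"
    and E: "real (card {((i, j), (i', j')). i \<in> I \<and> j \<in> J \<and> i' \<in> I \<and> j' \<in> J \<and> [x i * y j' = x i' * y j] (mod int p)}) \<le> E"
  shows "(\<Sum>i\<in>I. \<Sum>j\<in>J. cmod (\<Sum>t=1..T. \<chi> (x i + int t * y j))) ^ (2 * k)
    \<le> real (card I * card J) ^ (2 * k - 2) * E *
       (real (k ^ (2 * k)) * real T ^ k * real p + 2 * real k * real T ^ (2 * k) * sqrt (real p))"
proof -
  define F where "F l = cmod (\<Sum>t=1..T. \<chi> (l + int t))" for l
  define A where "A = I \<times> J"
  have finA: "finite A" using fin by (simp add: A_def)
  have "\<exists>l\<in>{0..<int p}. [l * y j = x i] (mod int p)" if "j \<in> J" for i j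
  proof -
    have "coprime (y j) (int p)" using y[OF that] prime_p
      by (metis coprime_commute prime_imp_coprime prime_nat_int_transfer)
    then obtain c where "[y j * c = 1] (mod int p)" using cong_solve_coprime_int by blast
    then have "[(x i * c) * y j = x i * 1] (mod int p)"
      using cong_scalar_left[of "y j * c" 1 "int p" "x i"] by (simp add: mult_ac)
    then have "[((x i * c) mod int p) * y j = x i] (mod int p)" by (simp add: cong_def mod_mult_left_eq)
    then show ?thesis using p_gt_1 by (intro bexI[of _ "(x i * c) mod int p"]) auto
  qed
  note ex = this
  define \<Lambda> where "\<Lambda> i j = (SOME l. l \<in> {0..<int p} \<and> [l * y j = x i] (mod int p))" for i j
  have \<Lambda>: "\<Lambda> i j \<in> {0..<int p} \<and> [\<Lambda> i j * y j = x i] (mod int p)" if "j \<in> J" for i j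
    unfolding \<Lambda>_def by (rule someI_ex) (use ex[OF that] in blast)
  define l where "l z = \<Lambda> (fst z) (snd z)" for z
  have lA: "l ` A \<subseteq> {0..<int p}" using \<Lambda> by (auto simp: l_def A_def)
  define \<nu> where "\<nu> c = real (card {z \<in> A. l z = c})" for c
  have group: "(\<Sum>z\<in>A. h (l z)) = (\<Sum>c\<in>{0..<int p}. \<nu> c * h c)" for h :: "int \<Rightarrow> real"
  proof -
    have "(\<Sum>z\<in>A. h (l z)) = (\<Sum>c\<in>{0..<int p}. \<Sum>z\<in>{z \<in> A. l z = c}. h (l z))"
      using finA lA by (intro sum.group[symmetric]) auto
    also have "\<dots> = (\<Sum>c\<in>{0..<int p}. \<nu> c * h c)" by (intro sum.cong refl) (simp add: \<nu>_def)
    finally show ?thesis .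
  qed
  have shift: "cmod (\<Sum>t=1..T. \<chi> (x i + int t * y j)) = F (l (i, j))" if "j \<in> J" for i j
  proof -
    have "\<chi> (x i + int t * y j) = \<chi> (y j) * \<chi> (\<Lambda> i j + int t)" for t
    proof -
      have "[y j * (\<Lambda> i j + int t) = x i + int t * y j] (mod int p)"
        using cong_add[OF conjunct2[OF \<Lambda>[OF that, of i]] cong_refl[of "int t * y j"]] by (simp add: algebra_simps)
      then show ?thesis using chi_cong by (metis chi_mult)
    qed
    then show ?thesis using norm_chi[of "y j"] y[OF that]
      by (simp add: F_def l_def sum_distrib_left [symmetric] norm_mult)
  qed
  have "(\<Sum>i\<in>I. \<Sum>j\<in>J. cmod (\<Sum>t=1..T. \<chi> (x i + int t * y j))) = (\<Sum>z\<in>A. F (l z))"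
  proof -
    have "(\<Sum>i\<in>I. \<Sum>j\<in>J. cmod (\<Sum>t=1..T. \<chi> (x i + int t * y j))) = (\<Sum>i\<in>I. \<Sum>j\<in>J. F (l (i, j)))"
      by (intro sum.cong refl shift)
    then show ?thesis by (simp add: A_def sum.cartesian_product)
  qed
  then have "(\<Sum>i\<in>I. \<Sum>j\<in>J. cmod (\<Sum>t=1..T. \<chi> (x i + int t * y j))) ^ (2 * k) = ((\<Sum>z\<in>A. F (l z)) ^ k)\<^sup>2"
    by (simp add: power_mult [symmetric] mult.commute)
  also have "\<dots> \<le> (real (card A) ^ (k - 1) * (\<Sum>z\<in>A. F (l z) ^ k))\<^sup>2"
    unfolding k by (intro power_mono sum_power_2power_le) (auto simp: F_def intro!: sum_nonneg zero_le_power)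
  also have "\<dots> = real (card A) ^ (2 * k - 2) * (\<Sum>c\<in>{0..<int p}. \<nu> c * F c ^ k)\<^sup>2"
  proof -
    have "2 * k - 2 = (k - 1) * 2" by simp
    then show ?thesis unfolding group[of "\<lambda>c. F c ^ k"] by (simp only: power_mult_distrib power_mult)
  qed
  also have "\<dots> \<le> real (card A) ^ (2 * k - 2) * ((\<Sum>c\<in>{0..<int p}. (\<nu> c)\<^sup>2) * (\<Sum>c\<in>{0..<int p}. (F c ^ k)\<^sup>2))"
    by (intro mult_left_mono Cauchy_Schwarz_ineq_sum) simp
  also have "\<dots> \<le> real (card A) ^ (2 * k - 2) * (E *
       (real (k ^ (2 * k)) * real T ^ k * real p + 2 * real k * real T ^ (2 * k) * sqrt (real p)))"
  proof (intro mult_left_mono mult_mono)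
    have "(\<Sum>c\<in>{0..<int p}. (\<nu> c)\<^sup>2) = (\<Sum>z\<in>A. \<nu> (l z))"
      unfolding group by (simp add: power2_eq_square)
    also have "\<dots> = real (\<Sum>z\<in>A. card {z' \<in> A. l z' = l z})" by (simp add: \<nu>_def)
    also have "(\<Sum>z\<in>A. card {z' \<in> A. l z' = l z}) = card (SIGMA z:A. {z' \<in> A. l z' = l z})"
      using finA by simp
    also have "\<dots> \<le> card {((i, j), (i', j')). i \<in> I \<and> j \<in> J \<and> i' \<in> I \<and> j' \<in> J \<and> [x i * y j' = x i' * y j] (mod int p)}"
    proof (rule card_mono)
      show "finite {((i, j), (i', j')). i \<in> I \<and> j \<in> J \<and> i' \<in> I \<and> j' \<in> J \<and> [x i * y j' = x i' * y j] (mod int p)}"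
        by (rule finite_subset[of _ "A \<times> A"]) (auto simp: A_def fin)
      show "(SIGMA z:A. {z' \<in> A. l z' = l z}) \<subseteq>
        {((i, j), (i', j')). i \<in> I \<and> j \<in> J \<and> i' \<in> I \<and> j' \<in> J \<and> [x i * y j' = x i' * y j] (mod int p)}"
      proof (clarsimp simp: A_def l_def)
        fix i j i' j' assume ij: "i \<in> I" "j \<in> J" "i' \<in> I" "j' \<in> J" "\<Lambda> i' j' = \<Lambda> i j"
        have "[x i * y j' = (\<Lambda> i j * y j) * y j'] (mod int p)"
          by (intro cong_mult cong_refl cong_sym[OF conjunct2[OF \<Lambda>[OF ij(2)]]])
        also have "(\<Lambda> i j * y j) * y j' = (\<Lambda> i' j' * y j') * y j" using ij by (simp add: mult_ac)
        also have "[\<dots> = x i' * y j] (mod int p)"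
          by (intro cong_mult cong_refl conjunct2[OF \<Lambda>[OF ij(4)]])
        finally show "[x i * y j' = x i' * y j] (mod int p)" .
      qed
    qed
    finally show "(\<Sum>c\<in>{0..<int p}. (\<nu> c)\<^sup>2) \<le> E" using E by simp
    show "(\<Sum>c\<in>{0..<int p}. (F c ^ k)\<^sup>2) \<le> real (k ^ (2 * k)) * real T ^ k * real p + 2 * real k * real T ^ (2 * k) * sqrt (real p)"
      using moment_bound[OF T, of k] by (simp add: F_def power_mult [symmetric] mult.commute)
    show "0 \<le> E" using E by (rule order.trans[rotated]) simp
  qed (auto intro!: sum_nonneg)
  finally show ?thesis by (simp add: A_def card_cartesian_product mult.assoc)
qed

end

section \<open>Divisors, linear congruences and energies\<close>

definition divisor_count :: "nat \<Rightarrow> nat" where "divisor_count n = card {d. d dvd n}"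

lemma divisor_count_prime_power_mult:
  assumes q: "prime q" and m: "m > 0"
  shows "divisor_count (q ^ a * m) \<le> (a + 1) * divisor_count m"
proof -
  have "{d. d dvd q ^ a * m} \<subseteq> (\<lambda>(i, e). q ^ i * e) ` ({..a} \<times> {d. d dvd m})"
  proof
    fix d assume "d \<in> {d. d dvd q ^ a * m}"
    then obtain b c where "d = b * c" "b dvd q ^ a" "c dvd m" using division_decomp by blast
    moreover from this obtain i where "i \<le> a" "b = q ^ i" using divides_primepow_nat[OF q] by blast
    ultimately show "d \<in> (\<lambda>(i, e). q ^ i * e) ` ({..a} \<times> {d. d dvd m})" by auto
  qed
  moreover have fin: "finite ({..a} \<times> {d. d dvd m})" using m by simp
  ultimately have "divisor_count (q ^ a * m) \<le> card ({..a} \<times> {d. d dvd m})"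
    unfolding divisor_count_def using surj_card_le by blast
  then show ?thesis by (simp add: card_cartesian_product divisor_count_def)
qed

text \<open>
With \<open>q\<^sup>a\<close> the exact power of a prime \<open>q\<close> in \<open>n\<close>, the factor \<open>a + 1\<close> is at most \<open>q\<^bsup>a\<eta>\<^esup>\<close> as soon as \<open>q\<^sup>\<eta> \<ge> 2\<close>,
and at most \<open>c q\<^bsup>a\<eta>\<^esup>\<close> for the finitely many smaller primes.
\<close>

lemma divisor_bound:
  fixes \<eta> :: real
  assumes \<eta>: "\<eta> > 0"
  obtains C where "C \<ge> 1" "\<And>n. n \<ge> 1 \<Longrightarrow> real (divisor_count n) \<le> C * real n powr \<eta>"
proof -
  define B where "B = nat \<lceil>2 powr (1 / \<eta>)\<rceil>"
  \<comment> \<open>Chosen so that \<open>1 + a \<le> c * (1 + a * \<eta> * ln 2)\<close>, which is at most \<open>c\<close> times \<open>2\<close> to the power \<open>a * \<eta>\<close>.\<close>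
  define c where "c = 1 + 1 / (\<eta> * ln 2)"
  have c1: "c \<ge> 1" using \<eta> by (simp add: c_def)
  define S where "S n = {q. prime q \<and> q < B \<and> q dvd n}" for n :: nat
  have finS: "finite (S n)" for n by (rule finite_subset[of _ "{..<B}"]) (auto simp: S_def)
  have big: "real (a + 1) \<le> real q powr (real a * \<eta>)" if "q \<ge> B" for q a :: nat
  proof -
    have "2 powr (1 / \<eta>) \<le> real q" using that by (simp add: B_def nat_ceiling_le_eq)
    then have "(2 powr (1 / \<eta>)) powr \<eta> \<le> real q powr \<eta>" using \<eta> by (intro powr_mono2) auto
    then have "2 \<le> real q powr \<eta>" using \<eta> by (simp add: powr_powr)
    then have "2 ^ a \<le> (real q powr \<eta>) ^ a" by (intro power_mono) auto
    moreover have "real (a + 1) \<le> 2 ^ a"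
    proof -
      have "a + 1 \<le> 2 ^ a" by (induction a) auto
      then show ?thesis by (metis of_nat_le_iff of_nat_numeral of_nat_power)
    qed
    moreover have "(real q powr \<eta>) ^ a = real q powr (real a * \<eta>)"
    proof -
      have "real q > 0" using \<open>2 powr (1 / \<eta>) \<le> real q\<close> by (metis less_le_trans powr_gt_zero zero_neq_numeral)
      then show ?thesis by (simp add: powr_realpow [symmetric] powr_powr mult.commute)
    qed
    ultimately show ?thesis by linarith
  qed
  have small: "real (a + 1) \<le> c * real q powr (real a * \<eta>)" if "q \<ge> 2" for q a :: nat
  proof -
    have "1 + real a * \<eta> * ln 2 \<le> exp (real a * \<eta> * ln 2)" by (rule exp_ge_add_one_self)
    also have "\<dots> = 2 powr (real a * \<eta>)" by (simp add: powr_def)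
    also have "\<dots> \<le> real q powr (real a * \<eta>)" using that \<eta> by (intro powr_mono2) auto
    finally have "c * (1 + real a * \<eta> * ln 2) \<le> c * real q powr (real a * \<eta>)" using c1 by (intro mult_left_mono) auto
    moreover have "real (a + 1) \<le> c * (1 + real a * \<eta> * ln 2)"
    proof -
      have "c * (1 + real a * \<eta> * ln 2) = 1 + real a + real a * \<eta> * ln 2 + 1 / (\<eta> * ln 2)"
        using \<eta> by (simp add: c_def field_simps)
      then show ?thesis using \<eta> by simp
    qed
    ultimately show ?thesis by linarith
  qed
  have main: "real (divisor_count n) \<le> c ^ card (S n) * real n powr \<eta>" if "n \<ge> 1" for n
    using that
  proof (induction n rule: less_induct)
    case (less n)
    show ?case
    proof (cases "n = 1")
      case True
      then show ?thesis using c1 by (simp add: divisor_count_def)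
    next
      case False
      then obtain q where q: "prime q" "q dvd n" using prime_factor_nat by blast
      define a where "a = multiplicity q n"
      obtain m where m: "n = q ^ a * m" "\<not> q dvd m"
        using multiplicity_decompose'[of n q] q less.prems unfolding a_def by (metis not_one_le_zero not_prime_unit)
      have m0: "m > 0" using m less.prems by (cases m) auto
      have a0: "a > 0" using q less.prems by (simp add: a_def prime_multiplicity_gt_zero_iff)
      have "1 * m < q ^ a * m" using a0 m0 prime_gt_1_nat[OF q(1)] by (intro mult_strict_right_mono one_less_power) auto
      then have "m < n" using m by simp
      then have IH: "real (divisor_count m) \<le> c ^ card (S m) * real m powr \<eta>" using less.IH m0 by simp
      have npow: "real n powr \<eta> = real q powr (real a * \<eta>) * real m powr \<eta>"
        unfolding m(1) using q m0 by (simp add: powr_mult powr_realpow [symmetric] powr_powr prime_gt_0_nat)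
      have "real (divisor_count n) \<le> real (a + 1) * real (divisor_count m)"
        unfolding m(1) using divisor_count_prime_power_mult[OF q(1) m0, of a] by (metis of_nat_le_iff of_nat_mult)
      also have "\<dots> \<le> real (a + 1) * (c ^ card (S m) * real m powr \<eta>)" using IH by (intro mult_left_mono) auto
      also have "\<dots> \<le> c ^ card (S n) * real n powr \<eta>"
      proof (cases "q < B")
        case True
        have "insert q (S m) \<subseteq> S n" "q \<notin> S m" using q True m by (auto simp: S_def)
        then have "Suc (card (S m)) \<le> card (S n)" using card_mono[OF finS[of n], of "insert q (S m)"] finS[of m] by simp
        then have cc: "c * c ^ card (S m) \<le> c ^ card (S n)" using power_increasing[OF _ c1] by (simp flip: power_Suc)
        have "real (a + 1) * (c ^ card (S m) * real m powr \<eta>) \<le> (c * real q powr (real a * \<eta>)) * (c ^ card (S m) * real m powr \<eta>)"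
          using small[of q a] prime_ge_2_nat[OF q(1)] c1 by (intro mult_right_mono) auto
        also have "\<dots> = (c * c ^ card (S m)) * real n powr \<eta>" by (simp add: npow mult_ac)
        also have "\<dots> \<le> c ^ card (S n) * real n powr \<eta>" using cc by (intro mult_right_mono) auto
        finally show ?thesis .
      next
        case False
        have "S m \<subseteq> S n" using m by (auto simp: S_def)
        then have cc: "c ^ card (S m) \<le> c ^ card (S n)" using c1 finS card_mono by (intro power_increasing) auto
        have "real (a + 1) * (c ^ card (S m) * real m powr \<eta>) \<le> real q powr (real a * \<eta>) * (c ^ card (S m) * real m powr \<eta>)"
          using big[of q a] False c1 by (intro mult_right_mono) auto
        also have "\<dots> = c ^ card (S m) * real n powr \<eta>" by (simp add: npow mult_ac)
        also have "\<dots> \<le> c ^ card (S n) * real n powr \<eta>" using cc by (intro mult_right_mono) auto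
        finally show ?thesis .
      qed
      finally show ?thesis .
    qed
  qed
  show ?thesis
  proof (rule that[of "c ^ B"])
    show "c ^ B \<ge> 1" using c1 by (rule one_le_power)
    fix n :: nat assume n: "n \<ge> 1"
    have "card (S n) \<le> B" using card_mono[of "{..<B}" "S n"] by (auto simp: S_def)
    then have "c ^ card (S n) \<le> c ^ B" using c1 by (intro power_increasing) auto
    then show "real (divisor_count n) \<le> c ^ B * real n powr \<eta>"
      using main[OF n] by (meson mult_right_mono order.trans powr_ge_zero)
  qed
qed

lemma card_residue_class_le:
  assumes "m > 0"
  shows "card {c \<in> {1..M}. c mod m = r} \<le> M div m + 1"
proof -
  have "inj_on (\<lambda>c. c div m) {c \<in> {1..M}. c mod m = r}"
    by (rule inj_onI) (metis (mono_tags, lifting) div_mult_mod_eq mem_Collect_eq)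
  moreover have "(\<lambda>c. c div m) ` {c \<in> {1..M}. c mod m = r} \<subseteq> {..M div m}" by (auto intro: div_le_mono)
  ultimately have "card {c \<in> {1..M}. c mod m = r} \<le> card {..M div m}" by (intro card_inj_on_le) auto
  then show ?thesis by simp
qed

text \<open>
For two solutions the values of \<open>c\<close> differ by a multiple of \<open>a div gcd a b\<close>, and \<open>c\<close> determines \<open>d\<close>.
\<close>

lemma card_linear_solutions:
  fixes a b :: nat and s :: int
  assumes a: "a > 0" and s: "s = 1 \<or> s = -1"
  shows "card {(c, d). c \<in> {1..M} \<and> d \<in> {1..M} \<and> int a * int d + s * int b * int c = x} \<le> M div (a div gcd a b) + 1"
    (is "card ?S \<le> _")
proof (cases "?S = {}")
  case False
  define g where "g = gcd a b"
  define m where "m = a div g"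
  have g0: "g > 0" using a by (simp add: g_def)
  have am: "a = m * g" by (simp add: m_def g_def)
  define b' where "b' = b div g"
  have bm: "b = b' * g" by (simp add: b'_def g_def)
  have m0: "m > 0" using a am by (cases m) auto
  have cop: "coprime m b'" unfolding m_def b'_def g_def using a by (intro div_gcd_coprime) auto
  obtain c0 d0 where 0: "(c0, d0) \<in> ?S" using False by fast
  have inj: "inj_on fst ?S" using a by (auto simp: inj_on_def)
  have "fst ` ?S \<subseteq> {c \<in> {1..M}. c mod m = c0 mod m}"
  proof clarsimp
    fix c d assume *: "Suc 0 \<le> c" "c \<le> M" "x = int a * int d + s * int b * int c"
    have "int a * int d + s * int b * int c = int a * int d0 + s * int b * int c0" using 0 * by simp
    then have "int g * (int m * (int d - int d0)) = int g * (- s * int b' * (int c - int c0))"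
      unfolding am bm by (simp add: algebra_simps)
    then have "int m * (int d - int d0) = - s * int b' * (int c - int c0)"
      using g0 mult_left_cancel[of "int g" "int m * (int d - int d0)" "- s * int b' * (int c - int c0)"] by simp
    then have "s * (int b' * (int c - int c0)) = int m * (int d0 - int d)"
      by (simp add: algebra_simps)
    then have "int m dvd s * (int b' * (int c - int c0))" by simp
    then have "int m dvd int b' * (int c - int c0)" using s by auto
    moreover have "coprime (int m) (int b')" using cop by simp
    ultimately have "int m dvd int c - int c0" using coprime_dvd_mult_right_iff by blast
    then have "[int c = int c0] (mod int m)" by (simp add: cong_iff_dvd_diff)
    then have "[c = c0] (mod m)" by (simp only: cong_int_iff)
    then show "c mod m = c0 mod m" by (simp only: cong_def)
  qed
  then have "card (fst ` ?S) \<le> card {c \<in> {1..M}. c mod m = c0 mod m}" by (intro card_mono) auto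
  also have "\<dots> \<le> M div m + 1" using m0 by (rule card_residue_class_le)
  finally show ?thesis unfolding card_image[OF inj] m_def g_def .
next
  case True
  show ?thesis unfolding True by simp
qed

text \<open>
The pair \<open>(a, b)\<close> is determined by \<open>a div gcd a b\<close>, \<open>b\<close> and the divisor \<open>gcd a b\<close> of \<open>b\<close>.
\<close>

lemma card_small_reduced_numerator:
  assumes D: "\<And>n. n \<ge> 1 \<Longrightarrow> n \<le> N \<Longrightarrow> divisor_count n \<le> D"
  shows "card {(a, b). a \<in> {1..N} \<and> b \<in> {1..N} \<and> a div gcd a b < M} \<le> M * N * D"
proof -
  define S where "S = {(a, b). a \<in> {1..N} \<and> b \<in> {1..N} \<and> a div gcd a b < M}"
  define \<Theta> where "\<Theta> = (\<lambda>(a :: nat, b). (a div gcd a b, (b, gcd a b)))"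
  define R where "R = {..<M} \<times> (SIGMA b:{1..N}. {d. d dvd b})"
  have "inj_on \<Theta> S"
  proof (rule inj_onI)
    fix z w assume "\<Theta> z = \<Theta> w"
    moreover obtain a b a' b' where zw: "z = (a, b)" "w = (a', b')" by fastforce
    ultimately have "a div gcd a b = a' div gcd a' b'" "b = b'" "gcd a b = gcd a' b'" by (auto simp: \<Theta>_def)
    then have "a div gcd a b * gcd a b = a' div gcd a' b' * gcd a' b'" by simp
    then show "z = w" using \<open>b = b'\<close> by (simp add: zw)
  qed
  moreover have "\<Theta> ` S \<subseteq> R" by (auto simp: S_def \<Theta>_def R_def)
  moreover have finR: "finite R" unfolding R_def by (intro finite_cartesian_product finite_SigmaI) auto
  ultimately have "card S \<le> card R" by (rule card_inj_on_le)
  also have "card R = M * (\<Sum>b\<in>{1..N}. divisor_count b)"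
    unfolding R_def divisor_count_def by (subst card_cartesian_product, subst card_SigmaI) auto
  also have "\<dots> \<le> M * (N * D)"
    using sum_bounded_above[of "{1..N}" divisor_count D] D by (intro mult_le_mono2) auto
  finally show ?thesis by (simp add: S_def mult.assoc)
qed

text \<open>
Given \<open>i\<close> and \<open>j'\<close> with \<open>x i \<noteq> 0\<close>, the number \<open>y j\<close> divides \<open>x i * y j'\<close>, so it has at most \<open>D\<close> values, and it
determines \<open>x i'\<close>. If \<open>x i = 0\<close> then \<open>x i' = 0\<close> as well; these solutions give the second summand.
\<close>

lemma card_proportional_le:
  fixes x :: "'i \<Rightarrow> int" and y :: "'j \<Rightarrow> int"
  assumes fin: "finite I" "finite J" and ypos: "\<And>j. j \<in> J \<Longrightarrow> y j > 0"
    and multx: "\<And>v. card {i \<in> I. x i = v} \<le> \<mu>" and multy: "\<And>v. card {j \<in> J. y j = v} \<le> \<mu>"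
    and D: "\<And>i j. i \<in> I \<Longrightarrow> j \<in> J \<Longrightarrow> x i \<noteq> 0 \<Longrightarrow> divisor_count (nat \<bar>x i * y j\<bar>) \<le> D"
  shows "card {((i, j), (i', j')). i \<in> I \<and> j \<in> J \<and> i' \<in> I \<and> j' \<in> J \<and> x i * y j' = x i' * y j}
    \<le> card I * card J * (D * \<mu> * \<mu>) + \<mu> * card J * (card J * \<mu>)"
proof -
  define S where "S = {((i, j), (i', j')). i \<in> I \<and> j \<in> J \<and> i' \<in> I \<and> j' \<in> J \<and> x i * y j' = x i' * y j}"
  define Fb where "Fb z = {w \<in> J \<times> I. x (fst z) * y (snd z) = x (snd w) * y (fst w)}" for z
  have finFb: "finite (Fb z)" for z using fin by (simp add: Fb_def)
  \<comment> \<open>Group the solutions by \<open>(i, j')\<close>, the two indices that determine the product.\<close>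
  define r where "r = (\<lambda>((i, j), (i', j')). ((i, j'), (j, i')) :: ('i \<times> 'j) \<times> ('j \<times> 'i))"
  have "inj_on r S" by (auto simp: inj_on_def r_def)
  moreover have "r ` S \<subseteq> (SIGMA z:I \<times> J. Fb z)" by (auto simp: r_def S_def Fb_def)
  ultimately have "card S \<le> card (SIGMA z:I \<times> J. Fb z)"
    using fin finFb by (intro card_inj_on_le) auto
  also have "\<dots> = (\<Sum>z\<in>I \<times> J. card (Fb z))" using fin finFb by simp
  also have "\<dots> \<le> (\<Sum>z\<in>I \<times> J. D * \<mu> * \<mu> + (if x (fst z) = 0 then card J * \<mu> else 0))"
  proof (rule sum_mono)
    fix z assume "z \<in> I \<times> J"
    then obtain i j' where z: "z = (i, j')" "i \<in> I" "j' \<in> J" by auto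
    have fibre: "card {i' \<in> I. x i * y j' = x i' * y j} \<le> \<mu>" if "j \<in> J" for j
    proof -
      have "{i' \<in> I. x i * y j' = x i' * y j} \<subseteq> {i' \<in> I. x i' = x i * y j' div y j}"
        using ypos[OF that] by auto
      then have "card {i' \<in> I. x i * y j' = x i' * y j} \<le> card {i' \<in> I. x i' = x i * y j' div y j}"
        using fin by (intro card_mono) auto
      then show ?thesis using multx le_trans by blast
    qed
    define J' where "J' = {j \<in> J. y j dvd x i * y j'}"
    have "Fb z \<subseteq> (SIGMA j:J'. {i' \<in> I. x i * y j' = x i' * y j})"
      by (auto simp: Fb_def z J'_def)
    then have "card (Fb z) \<le> card (SIGMA j:J'. {i' \<in> I. x i * y j' = x i' * y j})"
      using fin by (intro card_mono) (auto simp: J'_def)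
    also have "\<dots> = (\<Sum>j\<in>J'. card {i' \<in> I. x i * y j' = x i' * y j})" using fin by (simp add: J'_def)
    also have "\<dots> \<le> card J' * \<mu>" using sum_bounded_above[of J' _ \<mu>] fibre by (simp add: J'_def)
    finally have Fb: "card (Fb z) \<le> card J' * \<mu>" .
    show "card (Fb z) \<le> D * \<mu> * \<mu> + (if x (fst z) = 0 then card J * \<mu> else 0)"
    proof (cases "x i = 0")
      case True
      have "card J' \<le> card J" using fin by (intro card_mono) (auto simp: J'_def)
      then show ?thesis using Fb True by (auto simp: z intro: le_trans mult_le_mono1 trans_le_add2)
    next
      case False
      define n where "n = nat \<bar>x i * y j'\<bar>"
      have n0: "n > 0" using False ypos[OF z(3)] by (simp add: n_def)
      have "J' = (\<Union>e\<in>{d. d dvd n}. {j \<in> J. y j = int e})"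
      proof (intro equalityI subsetI)
        fix j assume j: "j \<in> J'"
        then have "nat (y j) dvd n" using ypos[of j] unfolding n_def J'_def
          by (simp add: nat_dvd_iff)
        then show "j \<in> (\<Union>e\<in>{d. d dvd n}. {j \<in> J. y j = int e})"
          using j ypos[of j] by (auto simp: J'_def intro!: exI[of _ "nat (y j)"])
      next
        fix j assume "j \<in> (\<Union>e\<in>{d. d dvd n}. {j \<in> J. y j = int e})"
        then obtain e where e: "e dvd n" "j \<in> J" "y j = int e" by auto
        have "int e dvd int n" using e(1) by simp
        then show "j \<in> J'" using e by (simp add: J'_def n_def)
      qed
      then have "card J' \<le> (\<Sum>e\<in>{d. d dvd n}. card {j \<in> J. y j = int e})"
        using n0 by (simp add: card_UN_le)
      also have "\<dots> \<le> divisor_count n * \<mu>"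
        using sum_bounded_above[of "{d. d dvd n}" _ \<mu>] multy by (simp add: divisor_count_def)
      also have "\<dots> \<le> D * \<mu>" using D[OF z(2,3) False] by (simp add: n_def)
      finally have "card J' * \<mu> \<le> D * \<mu> * \<mu>" by (rule mult_le_mono1)
      with Fb have "card (Fb z) \<le> D * \<mu> * \<mu>" by (rule le_trans)
      then show ?thesis by (rule trans_le_add1)
    qed
  qed
  also have "\<dots> = card I * card J * (D * \<mu> * \<mu>) + (\<Sum>z\<in>I \<times> J. if x (fst z) = 0 then card J * \<mu> else 0)"
    by (simp add: sum.distrib card_cartesian_product)
  also have "(\<Sum>z\<in>I \<times> J. if x (fst z) = 0 then card J * \<mu> else 0) = card ({i \<in> I. x i = 0} \<times> J) * (card J * \<mu>)"
  proof -
    have "{z \<in> I \<times> J. x (fst z) = 0} = {i \<in> I. x i = 0} \<times> J" by auto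
    moreover have "(\<Sum>z\<in>I \<times> J. if x (fst z) = 0 then card J * \<mu> else 0) = (\<Sum>z\<in>{z \<in> I \<times> J. x (fst z) = 0}. card J * \<mu>)"
      using fin by (intro sum.inter_filter[symmetric]) simp
    ultimately show ?thesis by simp
  qed
  also have "card ({i \<in> I. x i = 0} \<times> J) * (card J * \<mu>) \<le> \<mu> * card J * (card J * \<mu>)"
    using multx[of 0] by (simp add: card_cartesian_product)
  finally show ?thesis by (simp add: S_def)
qed

section \<open>Sums over a box of linear form values\<close>

lemma shift_sum_le_nat:
  fixes h :: "int \<Rightarrow> complex"
  assumes "\<And>z. cmod (h z) \<le> 1"
  shows "cmod ((\<Sum>c=1..N. h (int c + int s)) - (\<Sum>c=1..N. h (int c))) \<le> 2 * real s"
proof (induction s)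
  case (Suc s)
  define g where "g c = h (int c + int s)" for c
  have "(\<Sum>c=1..N. h (int c + int (Suc s))) - (\<Sum>c=1..N. g c) = (\<Sum>c=1..N. g (Suc c) - g c)"
    by (simp add: g_def sum_subtractf algebra_simps)
  also have "\<dots> = g (Suc N) - g 1" by (cases "N = 0") (simp_all add: sum_Suc_diff)
  finally have "cmod ((\<Sum>c=1..N. h (int c + int (Suc s))) - (\<Sum>c=1..N. g c)) \<le> 2"
    using norm_triangle_ineq4[of "g (Suc N)" "g 1"] assms[of "int (Suc N) + int s"] assms[of "int 1 + int s"]
    by (simp add: g_def)
  then have "cmod (((\<Sum>c=1..N. h (int c + int (Suc s))) - (\<Sum>c=1..N. g c)) + ((\<Sum>c=1..N. g c) - (\<Sum>c=1..N. h (int c))))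
    \<le> 2 + 2 * real s"
    using Suc.IH by (intro order.trans[OF norm_triangle_ineq]) (simp add: g_def)
  then show ?case by simp
qed simp

lemma shift_sum_le:
  fixes h :: "int \<Rightarrow> complex"
  assumes h: "\<And>z. cmod (h z) \<le> 1"
  shows "cmod ((\<Sum>c=1..N. h (int c)) - (\<Sum>c=1..N. h (int c + s))) \<le> 2 * real_of_int \<bar>s\<bar>"
proof (cases "s \<ge> 0")
  case True
  then show ?thesis using shift_sum_le_nat[where h = h and N = N and s = "nat s"] h by (simp add: norm_minus_commute)
next
  case False
  then show ?thesis
    using shift_sum_le_nat[where h = "\<lambda>z. h (z + s)" and N = N and s = "nat (- s)"] h by (simp add: norm_minus_commute)
qed

context char_p_character
begin

text \<open>
Shift first \<open>d\<close> and then \<open>c\<close>; each shift by \<open>s\<close> changes a sum over an interval by at most \<open>2 s\<close>.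
\<close>

lemma shifted_box_sum:
  fixes a b :: nat
  shows "cmod ((\<Sum>c=1..N. \<Sum>d=1..N. \<chi> (int a * int d - int b * int c))
    - (\<Sum>c=1..N. \<Sum>d=1..N. \<chi> (int a * (int d + int t * int v) - int b * (int c - int t * int u))))
    \<le> 2 * real N * real t * (real u + real v)"
proof -
  define S0 where "S0 = (\<Sum>c=1..N. \<Sum>d=1..N. \<chi> (int a * int d - int b * int c))"
  define S1 where "S1 = (\<Sum>c=1..N. \<Sum>d=1..N. \<chi> (int a * (int d + int t * int v) - int b * int c))"
  define S2 where "S2 = (\<Sum>c=1..N. \<Sum>d=1..N. \<chi> (int a * (int d + int t * int v) - int b * (int c - int t * int u)))"
  have "cmod (S0 - S1) \<le> (\<Sum>c=1..N. cmod ((\<Sum>d=1..N. \<chi> (int a * int d - int b * int c)) - (\<Sum>d=1..N. \<chi> (int a * (int d + int t * int v) - int b * int c))))"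
    unfolding S0_def S1_def sum_subtractf [symmetric] by (rule norm_sum)
  also have "\<dots> \<le> (\<Sum>c=1..N. 2 * real_of_int \<bar>int t * int v\<bar>)"
    by (intro sum_mono shift_sum_le[of "\<lambda>z. \<chi> (int a * z - _)"] norm_chi_le)
  finally have 1: "cmod (S0 - S1) \<le> 2 * real N * real t * real v" by (simp add: abs_mult)
  have sw: "S1 = (\<Sum>d=1..N. \<Sum>c=1..N. \<chi> (int a * (int d + int t * int v) - int b * int c))"
    "S2 = (\<Sum>d=1..N. \<Sum>c=1..N. \<chi> (int a * (int d + int t * int v) - int b * (int c + - (int t * int u))))"
    unfolding S1_def S2_def by (subst sum.swap, simp)+
  have "cmod (S1 - S2) \<le> (\<Sum>d=1..N. cmod ((\<Sum>c=1..N. \<chi> (int a * (int d + int t * int v) - int b * int c)) - (\<Sum>c=1..N. \<chi> (int a * (int d + int t * int v) - int b * (int c + - (int t * int u))))))"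
    unfolding sw sum_subtractf [symmetric] by (rule norm_sum)
  also have "\<dots> \<le> (\<Sum>d=1..N. 2 * real_of_int \<bar>- (int t * int u)\<bar>)"
    by (intro sum_mono shift_sum_le[of "\<lambda>z. \<chi> (_ - int b * z)"] norm_chi_le)
  finally have 2: "cmod (S1 - S2) \<le> 2 * real N * real t * real u" by (simp add: abs_mult)
  have "cmod (S0 - S2) \<le> cmod (S0 - S1) + cmod (S1 - S2)"
    using norm_triangle_ineq[of "S0 - S1" "S1 - S2"] by simp
  then show ?thesis using 1 2 by (simp add: S0_def S2_def algebra_simps)
qed

text \<open>
Averaging over the shifts \<open>t (-u, v)\<close> costs the second summand. The first is Burgess's inequality with
\<open>x = a d - b c\<close> and \<open>y = a v + b u\<close>; since \<open>\<bar>x y'\<bar> < p/2\<close>, the congruence that defines its energy is an equation.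
The sign of the shift is chosen to make \<open>y\<close> positive.
\<close>

lemma box_sum_bound:
  fixes a b N V T D \<mu> :: nat
  assumes a: "a \<in> {1..N}" and b: "b \<in> {1..N}" and V: "1 \<le> V" "V \<le> N" and T: "1 \<le> T" "T \<le> p"
    and small: "4 * N ^ 3 * V < p" and \<mu>: "N div (a div gcd a b) + 1 \<le> \<mu>"
    and D: "D \<ge> 1" "\<And>n. n \<ge> 1 \<Longrightarrow> n \<le> 2 * N ^ 3 * V \<Longrightarrow> divisor_count n \<le> D"
    and k: "k = 2 ^ s" and Tk: "sqrt (real p) \<le> real T ^ k"
  shows "cmod (\<Sum>c=1..N. \<Sum>d=1..N. \<chi> (int a * int d - int b * int c))
    \<le> real N ^ 2 * ((2 * real D * real \<mu> ^ 2 * (real (k ^ (2 * k)) + 2 * real k) * sqrt (real p)) / (real N ^ 2 * real V ^ 2)) powr (1 / real (2 * k))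
      + 4 * real N * real T * real V"
proof -
  define I where "I = {1..N} \<times> {1..N}"
  define J where "J = {1..V} \<times> {1..V}"
  define x where "x = (\<lambda>(c, d). int a * int d - int b * int c)"
  define y where "y = (\<lambda>(u, v). int a * int v + int b * int u)"
  have N1: "N \<ge> 1" using V by simp
  have fin: "finite I" "finite J" by (simp_all add: I_def J_def)
  have cI: "card I = N ^ 2" "card J = V ^ 2" by (simp_all add: I_def J_def card_cartesian_product power2_eq_square)
  have ypos: "y j > 0" if "j \<in> J" for j
    using that a by (auto simp: y_def J_def intro!: add_pos_nonneg)
  have yle: "y j \<le> 2 * int N * int V" if jJ: "j \<in> J" for j
  proof -
    obtain u v where j: "j = (u, v)" "u \<le> V" "v \<le> V" using jJ by (auto simp: J_def)
    have "a * v + b * u \<le> N * V + N * V" using a b j by (intro add_mono mult_le_mono) auto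
    then have "int (a * v + b * u) \<le> int (N * V + N * V)" by (simp only: of_nat_le_iff)
    then show ?thesis by (simp add: y_def j)
  qed
  have xle: "\<bar>x i\<bar> \<le> int N * int N" if iI: "i \<in> I" for i
  proof -
    obtain c d where i: "i = (c, d)" "c \<le> N" "d \<le> N" using iI by (auto simp: I_def)
    have "a * d \<le> N * N" "b * c \<le> N * N" using a b i by (auto intro: mult_le_mono)
    then have "int (a * d) \<le> int (N * N)" "int (b * c) \<le> int (N * N)" by (simp_all only: of_nat_le_iff)
    then have "int a * int d \<le> int N * int N" "int b * int c \<le> int N * int N"
      by (simp_all only: of_nat_mult)
    moreover have "0 \<le> int a * int d" "0 \<le> int b * int c" by simp_all
    ultimately show ?thesis unfolding x_def i by (simp only: prod.case)
  qed
  have prod_le: "\<bar>x i * y j\<bar> \<le> 2 * int N ^ 3 * int V" if "i \<in> I" "j \<in> J" for i j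
  proof -
    have "\<bar>x i * y j\<bar> = \<bar>x i\<bar> * y j" using ypos[OF that(2)] by (simp add: abs_mult)
    also have "\<dots> \<le> (int N * int N) * (2 * int N * int V)"
      using xle[OF that(1)] yle[OF that(2)] ypos[OF that(2)] by (intro mult_mono) auto
    finally show ?thesis by (simp add: power3_eq_cube mult_ac)
  qed
  have NVp: "4 * int N ^ 3 * int V < int p"
  proof -
    have "int (4 * N ^ 3 * V) < int p" using small by (simp only: of_nat_less_iff)
    then show ?thesis by simp
  qed
  have \<mu>x: "card {i \<in> I. x i = v} \<le> \<mu>" for v
  proof -
    have "{i \<in> I. x i = v} = {(c, d). c \<in> {1..N} \<and> d \<in> {1..N} \<and> int a * int d + (-1) * int b * int c = v}"
      by (auto simp: I_def x_def)
    moreover have "card \<dots> \<le> N div (a div gcd a b) + 1" using a by (intro card_linear_solutions) simp_all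
    ultimately have "card {i \<in> I. x i = v} \<le> N div (a div gcd a b) + 1" by (simp only:)
    then show ?thesis using \<mu> by (rule le_trans)
  qed
  have \<mu>y: "card {j \<in> J. y j = w} \<le> \<mu>" for w
  proof -
    have "{j \<in> J. y j = w} = {(c, d). c \<in> {1..V} \<and> d \<in> {1..V} \<and> int a * int d + 1 * int b * int c = w}"
      by (auto simp: J_def y_def)
    moreover have "card \<dots> \<le> V div (a div gcd a b) + 1" using a by (intro card_linear_solutions) simp_all
    ultimately have "card {j \<in> J. y j = w} \<le> V div (a div gcd a b) + 1" by (simp only:)
    moreover have "V div (a div gcd a b) \<le> N div (a div gcd a b)" using V by (intro div_le_mono)
    ultimately show ?thesis using \<mu> by linarith
  qed
  define Es where "Es = {((i, j), (i', j')). i \<in> I \<and> j \<in> J \<and> i' \<in> I \<and> j' \<in> J \<and> [x i * y j' = x i' * y j] (mod int p)}"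
  have "Es = {((i, j), (i', j')). i \<in> I \<and> j \<in> J \<and> i' \<in> I \<and> j' \<in> J \<and> x i * y j' = x i' * y j}"
  proof -
    have "x i * y j' = x i' * y j" if "i \<in> I" "j \<in> J" "i' \<in> I" "j' \<in> J" "[x i * y j' = x i' * y j] (mod int p)" for i j i' j'
    proof -
      have "int p dvd x i * y j' - x i' * y j" using that by (simp add: cong_iff_dvd_diff)
      moreover have "\<bar>x i * y j' - x i' * y j\<bar> < int p"
        using prod_le[OF that(1,4)] prod_le[OF that(3,2)] NVp by linarith
      ultimately show ?thesis using dvd_imp_le_int[of "x i * y j' - x i' * y j" "int p"] by fastforce
    qed
    then show ?thesis by (auto simp: Es_def)
  qed
  moreover have "card \<dots> \<le> card I * card J * (D * \<mu> * \<mu>) + \<mu> * card J * (card J * \<mu>)"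
  proof (rule card_proportional_le[OF fin ypos \<mu>x \<mu>y])
    fix i j assume ij: "i \<in> I" "j \<in> J" "x i \<noteq> 0"
    have "x i * y j \<noteq> 0" using ij ypos[OF ij(2)] by simp
    then have "nat \<bar>x i * y j\<bar> \<ge> 1" by linarith
    moreover have "nat \<bar>x i * y j\<bar> \<le> 2 * N ^ 3 * V" using prod_le[OF ij(1,2)] by (simp add: nat_le_iff)
    ultimately show "divisor_count (nat \<bar>x i * y j\<bar>) \<le> D" by (rule D(2))
  qed
  ultimately have "card Es \<le> N ^ 2 * V ^ 2 * (D * \<mu> * \<mu>) + \<mu> * V ^ 2 * (V ^ 2 * \<mu>)" by (simp only: cI)
  also have "\<mu> * V ^ 2 * (V ^ 2 * \<mu>) \<le> N ^ 2 * V ^ 2 * (D * \<mu> * \<mu>)"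
  proof -
    have "V ^ 2 * 1 \<le> N ^ 2 * D" using V D(1) by (intro mult_le_mono power_mono) auto
    then have "(V ^ 2 * \<mu> * \<mu>) * (V ^ 2 * 1) \<le> (V ^ 2 * \<mu> * \<mu>) * (N ^ 2 * D)" by (rule mult_le_mono2)
    then show ?thesis by (simp add: mult_ac)
  qed
  finally have Es: "card Es \<le> 2 * N ^ 2 * V ^ 2 * D * \<mu> ^ 2" by (simp add: power2_eq_square mult_ac)
  define n where "n = real N"
  define v where "v = real V"
  define \<tau> where "\<tau> = real T"
  have pos: "n \<ge> 1" "v \<ge> 1" "\<tau> \<ge> 1" using N1 V T by (simp_all add: n_def v_def \<tau>_def)
  define E where "E = 2 * n ^ 2 * v ^ 2 * real D * real \<mu> ^ 2"
  have "real (card Es) \<le> real (2 * N ^ 2 * V ^ 2 * D * \<mu> ^ 2)" using Es by (simp only: of_nat_le_iff)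
  then have EE: "real (card Es) \<le> E" by (simp add: E_def n_def v_def)
  define B where "B = (\<Sum>i\<in>I. \<Sum>j\<in>J. cmod (\<Sum>t=1..T. \<chi> (x i + int t * y j)))"
  have B0: "B \<ge> 0" unfolding B_def by (intro sum_nonneg) simp
  have k1: "k \<ge> 1" using k by simp
  define Ck where "Ck = real (k ^ (2 * k)) + 2 * real k"
  define Y where "Y = 2 * real D * real \<mu> ^ 2 * Ck * sqrt (real p) / (n ^ 2 * v ^ 2)"
  have Y0: "Y > 0"
  proof -
    have "\<mu> \<ge> 1" using \<mu> by simp
    moreover have "Ck > 0" using k1 by (simp add: Ck_def add_nonneg_pos)
    ultimately show ?thesis unfolding Y_def using D(1) pos p_gt_1
      by (intro divide_pos_pos mult_pos_pos) auto
  qed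
  have "B ^ (2 * k) \<le> real (card I * card J) ^ (2 * k - 2) * E *
       (real (k ^ (2 * k)) * real T ^ k * real p + 2 * real k * real T ^ (2 * k) * sqrt (real p))"
    unfolding B_def
  proof (rule burgess_inequality[OF fin _ T(2) k])
    show "\<not> int p dvd y j" if "j \<in> J" for j
    proof
      assume "int p dvd y j"
      then have "int p \<le> y j" using ypos[OF that] by (rule zdvd_imp_le)
      moreover have "y j \<le> 4 * int N ^ 3 * int V"
      proof -
        have "2 * int N * int V \<le> 4 * int N ^ 3 * int V"
        proof (rule mult_right_mono)
          have "int N \<le> int N ^ 3" using N1 by (intro self_le_power) auto
          then show "2 * int N \<le> 4 * int N ^ 3" by linarith
        qed simp
        then show ?thesis using yle[OF that] by linarith
      qed
      ultimately show False using NVp by linarith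
    qed
    show "real (card {((i, j), (i', j')). i \<in> I \<and> j \<in> J \<and> i' \<in> I \<and> j' \<in> J \<and> [x i * y j' = x i' * y j] (mod int p)}) \<le> E"
      using EE by (simp add: Es_def)
  qed
  also have "\<dots> \<le> real (card I * card J) ^ (2 * k - 2) * E * (Ck * \<tau> ^ (2 * k) * sqrt (real p))"
  proof (rule mult_left_mono)
    have "real p = sqrt (real p) * sqrt (real p)" by simp
    then have "\<tau> ^ k * real p = (\<tau> ^ k * sqrt (real p)) * sqrt (real p)" by (simp add: mult.assoc)
    also have "\<dots> \<le> (\<tau> ^ k * \<tau> ^ k) * sqrt (real p)"
      using Tk pos by (intro mult_right_mono mult_left_mono) (auto simp: \<tau>_def)
    finally have "\<tau> ^ k * real p \<le> \<tau> ^ (2 * k) * sqrt (real p)" by (simp add: power_add [symmetric] mult_2)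
    then have "real (k ^ (2 * k)) * (\<tau> ^ k * real p) \<le> real (k ^ (2 * k)) * (\<tau> ^ (2 * k) * sqrt (real p))"
      by (intro mult_left_mono) auto
    then show "real (k ^ (2 * k)) * real T ^ k * real p + 2 * real k * real T ^ (2 * k) * sqrt (real p) \<le> Ck * \<tau> ^ (2 * k) * sqrt (real p)"
      by (simp add: Ck_def \<tau>_def algebra_simps)
    show "0 \<le> real (card I * card J) ^ (2 * k - 2) * E" by (simp add: E_def)
  qed
  also have "\<dots> = (n ^ 2 * v ^ 2 * \<tau>) ^ (2 * k) * Y"
  proof -
    define A where "A = n ^ 2 * v ^ 2"
    have A: "A > 0" using pos by (simp add: A_def)
    have "real (card I * card J) = A" by (simp add: cI A_def n_def v_def)
    moreover have "E = A ^ 2 * (2 * real D * real \<mu> ^ 2) / A"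
      using A by (simp add: E_def A_def [symmetric] power2_eq_square)  (simp add: A_def power2_eq_square mult_ac)
    moreover have "A ^ (2 * k) = A ^ (2 * k - 2) * A ^ 2"
    proof -
      have "2 * k = (2 * k - 2) + 2" using k1 by simp
      then have "A ^ (2 * k) = A ^ ((2 * k - 2) + 2)" by (rule arg_cong)
      then show ?thesis by (simp only: power_add)
    qed
    moreover have "Y = 2 * real D * real \<mu> ^ 2 * Ck * sqrt (real p) / A" by (simp add: Y_def A_def)
    ultimately show ?thesis unfolding A_def [symmetric] power_mult_distrib by simp
  qed
  also have "Y = (Y powr (1 / real (2 * k))) ^ (2 * k)"
    using Y0 k1 by (simp add: powr_realpow [symmetric] powr_powr)
  finally have "B ^ (2 * k) \<le> (n ^ 2 * v ^ 2 * \<tau> * Y powr (1 / real (2 * k))) ^ (2 * k)"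
    by (simp only: power_mult_distrib)
  then have B: "B \<le> n ^ 2 * v ^ 2 * \<tau> * Y powr (1 / real (2 * k))"
    by (subst (asm) power_mono_iff) (use k1 pos B0 in auto)
  define W where "W = (\<Sum>c=1..N. \<Sum>d=1..N. \<chi> (int a * int d - int b * int c))"
  define Wt where "Wt j t = (\<Sum>i\<in>I. \<chi> (x i + int t * y j))" for j and t :: nat
  have W_eq: "W = (\<Sum>i\<in>I. \<chi> (x i))" by (simp add: W_def I_def x_def sum.cartesian_product case_prod_unfold)
  have Wt: "cmod (W - Wt j t) \<le> 4 * n * \<tau> * v" if jJ: "j \<in> J" and tT: "t \<in> {1..T}" for j t
  proof -
    obtain u w where j: "j = (u, w)" "u \<le> V" "w \<le> V" using jJ by (auto simp: J_def)
    have "Wt j t = (\<Sum>c=1..N. \<Sum>d=1..N. \<chi> (int a * (int d + int t * int w) - int b * (int c - int t * int u)))"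
      unfolding Wt_def I_def by (subst sum.cartesian_product) (simp add: x_def y_def j case_prod_unfold algebra_simps)
    then have "cmod (W - Wt j t) \<le> 2 * real N * real t * (real u + real w)"
      unfolding W_def using shifted_box_sum by simp
    also have "\<dots> \<le> 2 * n * \<tau> * (v + v)"
      using tT j by (intro mult_mono add_mono) (auto simp: n_def v_def \<tau>_def)
    finally show ?thesis by simp
  qed
  have "v ^ 2 * \<tau> * cmod W = cmod (\<Sum>j\<in>J. \<Sum>t=1..T. W)"
    by (simp add: cI norm_mult v_def \<tau>_def norm_power)
  also have "(\<Sum>j\<in>J. \<Sum>t=1..T. W) = (\<Sum>j\<in>J. \<Sum>t=1..T. W - Wt j t) + (\<Sum>j\<in>J. \<Sum>t=1..T. Wt j t)"
    by (simp add: sum.distrib [symmetric])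
  also have "cmod \<dots> \<le> cmod (\<Sum>j\<in>J. \<Sum>t=1..T. W - Wt j t) + cmod (\<Sum>j\<in>J. \<Sum>t=1..T. Wt j t)"
    by (rule norm_triangle_ineq)
  also have "cmod (\<Sum>j\<in>J. \<Sum>t=1..T. W - Wt j t) \<le> (\<Sum>j\<in>J. \<Sum>t=1..T. 4 * n * \<tau> * v)"
    by (intro order.trans[OF norm_sum] sum_mono Wt)
  also have "(\<Sum>j\<in>J. \<Sum>t=1..T. 4 * n * \<tau> * v) = v ^ 2 * \<tau> * (4 * n * \<tau> * v)" by (simp add: cI v_def \<tau>_def)
  also have "(\<Sum>j\<in>J. \<Sum>t=1..T. Wt j t) = (\<Sum>i\<in>I. \<Sum>j\<in>J. \<Sum>t=1..T. \<chi> (x i + int t * y j))"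
  proof -
    have "(\<Sum>j\<in>J. \<Sum>t=1..T. Wt j t) = (\<Sum>j\<in>J. \<Sum>i\<in>I. \<Sum>t=1..T. \<chi> (x i + int t * y j))"
      unfolding Wt_def by (intro sum.cong refl) (rule sum.swap)
    then show ?thesis by (simp only: sum.swap[of _ J I])
  qed
  also have "cmod \<dots> \<le> B" unfolding B_def by (rule order.trans[OF norm_sum], rule sum_mono, rule norm_sum)
  finally have "v ^ 2 * \<tau> * cmod W \<le> v ^ 2 * \<tau> * (4 * n * \<tau> * v) + n ^ 2 * v ^ 2 * \<tau> * Y powr (1 / real (2 * k))"
    using B by linarith
  also have "\<dots> = v ^ 2 * \<tau> * (n ^ 2 * Y powr (1 / real (2 * k)) + 4 * n * \<tau> * v)" by (simp add: algebra_simps)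
  finally have "cmod W \<le> n ^ 2 * Y powr (1 / real (2 * k)) + 4 * n * \<tau> * v"
    by (rule mult_left_le_imp_le) (use pos in auto)
  then show ?thesis by (simp add: W_def Y_def Ck_def n_def v_def \<tau>_def)
qed

end

section \<open>Short and long ranges\<close>

lemma floor_between:
  fixes x :: real assumes "x \<ge> 1"
  shows "nat \<lfloor>x\<rfloor> \<ge> 1" "real (nat \<lfloor>x\<rfloor>) \<le> x" "x / 2 \<le> real (nat \<lfloor>x\<rfloor>)"
proof -
  have "\<lfloor>x\<rfloor> \<ge> 1" using assms by simp
  then have "real (nat \<lfloor>x\<rfloor>) = real_of_int \<lfloor>x\<rfloor>" by simp
  moreover have "real_of_int \<lfloor>x\<rfloor> \<le> x" "x < real_of_int \<lfloor>x\<rfloor> + 1" "real_of_int \<lfloor>x\<rfloor> \<ge> 1"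
    using \<open>\<lfloor>x\<rfloor> \<ge> 1\<close> by linarith+
  ultimately show "real (nat \<lfloor>x\<rfloor>) \<le> x" "x / 2 \<le> real (nat \<lfloor>x\<rfloor>)" by linarith+
  show "nat \<lfloor>x\<rfloor> \<ge> 1" using \<open>\<lfloor>x\<rfloor> \<ge> 1\<close> by linarith
qed

definition box_sum :: "(int \<Rightarrow> complex) \<Rightarrow> nat \<Rightarrow> nat \<Rightarrow> nat \<Rightarrow> complex" where
  "box_sum \<chi> N a b = (\<Sum>c=1..N. \<Sum>d=1..N. \<chi> (int a * int d - int b * int c))"

lemma (in char_p_character) norm_box_sum_le: "cmod (box_sum \<chi> N a b) \<le> real N ^ 2"
proof -
  have "cmod (box_sum \<chi> N a b) \<le> (\<Sum>c=1..N. \<Sum>d=1..N. 1)"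
    unfolding box_sum_def by (intro order.trans[OF norm_sum] sum_mono norm_chi_le)
  then show ?thesis by (simp add: power2_eq_square)
qed

lemma U_sum_le:
  assumes "\<And>a. a \<ge> 1 \<Longrightarrow> cmod (\<alpha> a) \<le> K" "\<And>b. b \<ge> 1 \<Longrightarrow> cmod (\<beta> b) \<le> K" and K: "K > 0"
  shows "cmod (U_sum \<chi> \<alpha> \<beta> N) \<le> K ^ 2 * (\<Sum>a=1..N. \<Sum>b=1..N. cmod (box_sum \<chi> N a b))"
proof -
  have "cmod (U_sum \<chi> \<alpha> \<beta> N) \<le> (\<Sum>a=1..N. K * (\<Sum>b=1..N. K * cmod (box_sum \<chi> N a b)))"
    unfolding U_sum_def box_sum_def [symmetric]
  proof (intro order.trans[OF norm_sum] sum_mono)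
    fix a assume a: "a \<in> {1..N}"
    have "cmod (\<Sum>b=1..N. \<beta> b * box_sum \<chi> N a b) \<le> (\<Sum>b=1..N. K * cmod (box_sum \<chi> N a b))"
      using assms by (intro order.trans[OF norm_sum] sum_mono) (auto simp: norm_mult intro!: mult_right_mono)
    then show "cmod (\<alpha> a * (\<Sum>b=1..N. \<beta> b * box_sum \<chi> N a b)) \<le> K * (\<Sum>b=1..N. K * cmod (box_sum \<chi> N a b))"
      unfolding norm_mult using assms a by (intro mult_mono) auto
  qed
  then show ?thesis by (simp add: sum_distrib_left [symmetric] power2_eq_square mult.assoc)
qed

text \<open>
Take \<open>V\<close>, \<open>T\<close> and \<open>M0\<close> of size \<open>N\<^bsup>1-2\<epsilon>\<^esup>\<close>, \<open>N\<^sup>\<epsilon>\<close> and \<open>N\<^bsup>1-\<epsilon>\<^esup>\<close>. The pairs with \<open>a div gcd a b < M0\<close> are few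
enough for the trivial bound. For the others \<open>\<mu> \<le> 3 N\<^sup>\<epsilon>\<close>, and \<open>\<surd>p \<le> N\<^bsup>4-16\<epsilon>\<^esup>\<close> outweighs the losses
in \<open>Y\<close>, whose root of order \<open>2 k\<close> is the saving.
\<close>

lemma short_range_bound:
  fixes \<epsilon> :: real
  assumes \<epsilon>: "0 < \<epsilon>" "\<epsilon> \<le> 1 / 8"
  obtains \<delta> C where "\<delta> > 0" "C \<ge> 0"
    "\<And>p \<chi> N. prime p \<Longrightarrow> nonprincipal_character p \<chi> \<Longrightarrow> real p powr (1/8 + \<epsilon>) \<le> real N \<Longrightarrow> 4 * N ^ 4 < p
      \<Longrightarrow> (\<Sum>a=1..N. \<Sum>b=1..N. cmod (box_sum \<chi> N a b)) \<le> C * real N powr (4 - \<delta>)"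
proof -
  obtain C1 where C1: "C1 \<ge> 1" "\<And>n. n \<ge> 1 \<Longrightarrow> real (divisor_count n) \<le> C1 * real n powr (\<epsilon> / 10)"
    using divisor_bound[of "\<epsilon> / 10"] \<epsilon> by auto
  \<comment> \<open>So large that \<open>T ^ k \<ge> \<surd>p\<close>: it is at least \<open>N ^ 5 / 2 ^ k\<close>, hence at least \<open>N ^ 4\<close> for large \<open>N\<close>.\<close>
  obtain s where s: "5 / \<epsilon> < 2 ^ s" using real_arch_pow[of 2 "5 / \<epsilon>"] by auto
  define k where "k = (2::nat) ^ s"
  have k\<epsilon>: "5 \<le> \<epsilon> * real k" using s \<epsilon> by (simp add: k_def field_simps)
  have k2: "k \<ge> 2"
  proof -
    have "\<epsilon> * real k \<le> 1/8 * real k" using \<epsilon> by (intro mult_right_mono) auto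
    then show ?thesis using k\<epsilon> by linarith
  qed
  define Ck where "Ck = real (k ^ (2 * k)) + 2 * real k"
  have Ck1: "Ck \<ge> 1"
  proof -
    have "0 \<le> real (k ^ (2 * k))" "1 \<le> 2 * real k" using k2 by simp_all
    then show ?thesis unfolding Ck_def by linarith
  qed
  define C3 where "C3 = 144 * C1 * Ck"
  have C31: "C3 \<ge> 1"
  proof -
    have "1 * 1 \<le> C1 * Ck" using C1(1) Ck1 by (intro mult_mono) auto
    then show ?thesis by (simp add: C3_def)
  qed
  define \<delta> where "\<delta> = \<epsilon> / real k"
  have \<delta>: "0 < \<delta>" "\<delta> \<le> \<epsilon> / 2" "\<delta> \<le> 1"
  proof -
    show "0 < \<delta>" using \<epsilon> k2 by (simp add: \<delta>_def)
    show "\<delta> \<le> \<epsilon> / 2" unfolding \<delta>_def using \<epsilon> k2 by (intro divide_left_mono) auto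
    then show "\<delta> \<le> 1" using \<epsilon> by simp
  qed
  define C where "C = (C3 + 4) + 2 * C1 + 2 ^ k"
  show ?thesis
  proof (rule that[of \<delta> C])
    show "\<delta> > 0" by fact
    show "C \<ge> 0" using C31 C1 by (simp add: C_def)
    fix p :: nat and \<chi> :: "int \<Rightarrow> complex" and N :: nat
    assume p: "prime p" and chi: "nonprincipal_character p \<chi>"
      and Np: "real p powr (1/8 + \<epsilon>) \<le> real N" and N4: "4 * N ^ 4 < p"
    interpret char_p_character p \<chi> by unfold_locales (use p chi in auto)
    define n where "n = real N"
    have "0 < real p powr (1/8 + \<epsilon>)" using p_gt_1 by simp
    then have "N > 0" using Np by linarith
    then have N1: "N \<ge> 1" and n1: "n \<ge> 1" by (simp_all add: n_def)
    have pw: "n powr x * n powr y = n powr (x + y)" for x y by (simp add: powr_add)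
    have pm: "n powr x \<le> n powr y" if "x \<le> y" for x y using that n1 by (rule powr_mono)
    have pge1: "1 \<le> n powr x" if "x \<ge> 0" for x using n1 that by (rule ge_one_powr_ge_zero)
    have pow: "(n powr x) ^ m = n powr (x * real m)" for x m
    proof -
      have "(n powr x) ^ m = (n powr x) powr real m" using n1 by (subst powr_realpow) auto
      then show ?thesis by (simp only: powr_powr)
    qed
    show "(\<Sum>a=1..N. \<Sum>b=1..N. cmod (box_sum \<chi> N a b)) \<le> C * real N powr (4 - \<delta>)"
    proof (cases "N \<ge> 2 ^ k")
      case False
      have "(\<Sum>a=1..N. \<Sum>b=1..N. cmod (box_sum \<chi> N a b)) \<le> (\<Sum>a=1..N. \<Sum>b=1..N. n ^ 2)"
        unfolding n_def by (intro sum_mono norm_box_sum_le)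
      also have "\<dots> = n ^ 4" by (simp add: n_def power2_eq_square power4_eq_xxxx)
      also have "\<dots> = n powr \<delta> * n powr (4 - \<delta>)" unfolding pw using n1 by simp
      also have "\<dots> \<le> C * n powr (4 - \<delta>)"
      proof (rule mult_right_mono)
        have "n powr \<delta> \<le> n powr 1" using \<delta> by (intro pm)
        also have "\<dots> = n" using n1 by simp
        also have "\<dots> \<le> real (2 ^ k)" using False unfolding n_def by (intro of_nat_mono) simp
        also have "\<dots> \<le> C" using C31 C1 by (simp add: C_def)
        finally show "n powr \<delta> \<le> C" .
      qed simp
      finally show ?thesis by (simp add: n_def)
    next
      case True
      define V where "V = nat \<lfloor>n powr (1 - 2 * \<epsilon>)\<rfloor>"
      define T where "T = nat \<lfloor>n powr \<epsilon>\<rfloor>"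
      define M0 where "M0 = nat \<lfloor>n powr (1 - \<epsilon>)\<rfloor>"
      define D where "D = nat \<lfloor>C1 * (2 * n ^ 4) powr (\<epsilon> / 10)\<rfloor>"
      define \<mu> where "\<mu> = N div M0 + 1"
      have V: "V \<ge> 1" "real V \<le> n powr (1 - 2 * \<epsilon>)" "n powr (1 - 2 * \<epsilon>) / 2 \<le> real V"
        unfolding V_def using floor_between[of "n powr (1 - 2 * \<epsilon>)"] pge1[of "1 - 2 * \<epsilon>"] \<epsilon> by auto
      have T: "T \<ge> 1" "real T \<le> n powr \<epsilon>" "n powr \<epsilon> / 2 \<le> real T"
        unfolding T_def using floor_between[of "n powr \<epsilon>"] pge1[of "\<epsilon>"] \<epsilon> by auto
      have M0: "M0 \<ge> 1" "real M0 \<le> n powr (1 - \<epsilon>)" "n powr (1 - \<epsilon>) / 2 \<le> real M0"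
        unfolding M0_def using floor_between[of "n powr (1 - \<epsilon>)"] pge1[of "1 - \<epsilon>"] \<epsilon> by auto
      have "real V \<le> n powr 1" using V(2) pm[of "1 - 2 * \<epsilon>" 1] \<epsilon> by linarith
      then have VN: "V \<le> N" using n1 by (simp add: n_def)
      have "real T \<le> n powr 1" using T(2) pm[of \<epsilon> 1] \<epsilon> by linarith
      then have TN: "T \<le> N" using n1 by (simp add: n_def)
      have "N \<le> N ^ 4" using N1 by (intro self_le_power) auto
      then have Tp: "T \<le> p" using TN N4 by linarith
      have NV4: "N ^ 3 * V \<le> N ^ 4" using mult_le_mono2[OF VN, of "N ^ 3"] by (simp add: power4_eq_xxxx power3_eq_cube mult_ac)
      then have small: "4 * N ^ 3 * V < p" using N4 by linarith
      have base1: "1 \<le> (2 * n ^ 4) powr (\<epsilon> / 10)"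
      proof (rule ge_one_powr_ge_zero)
        have "1 \<le> n ^ 4" using n1 by (rule one_le_power)
        then show "1 \<le> 2 * n ^ 4" by linarith
      qed (use \<epsilon> in simp)
      have D1: "D \<ge> 1" "real D \<le> C1 * (2 * n ^ 4) powr (\<epsilon> / 10)"
      proof -
        have "1 * 1 \<le> C1 * (2 * n ^ 4) powr (\<epsilon> / 10)" using C1(1) base1 by (intro mult_mono) auto
        then show "D \<ge> 1" "real D \<le> C1 * (2 * n ^ 4) powr (\<epsilon> / 10)"
          unfolding D_def using floor_between by simp_all
      qed
      have Ddiv: "divisor_count m \<le> D" if "m \<ge> 1" "m \<le> 2 * N ^ 4" for m
      proof -
        have "real m \<le> real (2 * N ^ 4)" using that by (simp only: of_nat_le_iff)
        then have "real m powr (\<epsilon> / 10) \<le> (2 * n ^ 4) powr (\<epsilon> / 10)"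
          using \<epsilon> by (intro powr_mono2) (auto simp: n_def)
        then have "C1 * real m powr (\<epsilon> / 10) \<le> C1 * (2 * n ^ 4) powr (\<epsilon> / 10)" using C1 by (intro mult_left_mono) auto
        then show ?thesis unfolding D_def using C1(2)[OF that(1)] by (intro le_nat_floor) linarith
      qed
      have D2: "real D \<le> 2 * C1 * n powr (\<epsilon> / 2)"
      proof -
        have "n ^ 4 = n powr 4" using n1 by simp
        then have "(2 * n ^ 4) powr (\<epsilon> / 10) = 2 powr (\<epsilon> / 10) * n powr (4 * (\<epsilon> / 10))"
          using n1 by (simp only: powr_mult powr_powr)
        also have "\<dots> \<le> 2 powr 1 * n powr (\<epsilon> / 2)" using \<epsilon> by (intro mult_mono powr_mono pm) auto
        finally have "C1 * (2 * n ^ 4) powr (\<epsilon> / 10) \<le> C1 * (2 * n powr (\<epsilon> / 2))" using C1 by (intro mult_left_mono) auto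
        then show ?thesis using D1 by simp
      qed
      have \<mu>3: "real \<mu> \<le> 3 * n powr \<epsilon>"
      proof -
        have "real (N div M0) \<le> n / real M0" unfolding n_def by (rule of_nat_div_le_of_nat)
        also have "\<dots> \<le> n / (n powr (1 - \<epsilon>) / 2)" using M0 n1 by (intro divide_left_mono mult_pos_pos) auto
        also have "\<dots> = 2 * (n powr 1 / n powr (1 - \<epsilon>))" using n1 by simp
        also have "\<dots> = 2 * n powr \<epsilon>" by (simp only: powr_diff [symmetric]) simp
        finally show ?thesis using pge1[of \<epsilon>] \<epsilon> by (simp add: \<mu>_def)
      qed
      have sq: "sqrt (real p) \<le> n powr (4 - 16 * \<epsilon>)"
      proof -
        have "sqrt (real p) = real p powr (1 / 2)" by (simp add: powr_half_sqrt)
        also have "\<dots> \<le> real p powr ((1/8 + \<epsilon>) * (4 - 16 * \<epsilon>))"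
        proof (rule powr_mono)
          have "(1/8 + \<epsilon>) * (4 - 16 * \<epsilon>) = 1 / 2 + 2 * \<epsilon> * (1 - 8 * \<epsilon>)" by (simp add: algebra_simps)
          moreover have "0 \<le> 2 * \<epsilon> * (1 - 8 * \<epsilon>)" using \<epsilon> by (intro mult_nonneg_nonneg) auto
          ultimately show "1 / 2 \<le> (1/8 + \<epsilon>) * (4 - 16 * \<epsilon>)" by linarith
        qed (use p_gt_1 in simp)
        also have "\<dots> = (real p powr (1/8 + \<epsilon>)) powr (4 - 16 * \<epsilon>)" by (simp add: powr_powr)
        also have "\<dots> \<le> n powr (4 - 16 * \<epsilon>)" unfolding n_def using Np \<epsilon> by (intro powr_mono2) auto
        finally show ?thesis .
      qed
      have Tk: "sqrt (real p) \<le> real T ^ k"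
      proof -
        have "sqrt (real p) \<le> n powr 4" using sq pm[of "4 - 16 * \<epsilon>" 4] \<epsilon> by linarith
        also have "\<dots> \<le> n powr (\<epsilon> * real k) / 2 ^ k"
        proof -
          have "2 ^ k \<le> n" using True unfolding n_def by (metis of_nat_le_iff of_nat_numeral of_nat_power)
          then have "n powr 4 * 2 ^ k \<le> n powr 4 * n powr 1" using n1 by (intro mult_left_mono) auto
          also have "\<dots> \<le> n powr (\<epsilon> * real k)" unfolding pw using k\<epsilon> by (intro pm) simp
          finally show ?thesis by (simp add: field_simps)
        qed
        also have "\<dots> = (n powr \<epsilon> / 2) ^ k" by (simp only: power_divide pow)
        also have "\<dots> \<le> real T ^ k" using T(3) by (intro power_mono) auto
        finally show ?thesis .
      qed
      define Y where "Y = 2 * real D * real \<mu> ^ 2 * Ck * sqrt (real p) / (n ^ 2 * real V ^ 2)"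
      have Y: "Y \<le> C3 * n powr (- 2 * \<epsilon>)"
      proof -
        have num: "2 * real D * real \<mu> ^ 2 * Ck * sqrt (real p) \<le> 2 * (2 * C1 * n powr (\<epsilon> / 2)) * (3 * n powr \<epsilon>) ^ 2 * Ck * n powr (4 - 16 * \<epsilon>)"
          using D2 \<mu>3 sq C1 Ck1 by (intro mult_mono power_mono) (auto intro!: mult_nonneg_nonneg)
        have den: "n ^ 2 * (n powr (1 - 2 * \<epsilon>) / 2) ^ 2 \<le> n ^ 2 * real V ^ 2"
          using V(3) by (intro mult_left_mono power_mono) auto
        have den0: "0 < n ^ 2 * (n powr (1 - 2 * \<epsilon>) / 2) ^ 2" using n1 by simp
        have "Y \<le> (2 * (2 * C1 * n powr (\<epsilon> / 2)) * (3 * n powr \<epsilon>) ^ 2 * Ck * n powr (4 - 16 * \<epsilon>)) / (n ^ 2 * (n powr (1 - 2 * \<epsilon>) / 2) ^ 2)"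
          unfolding Y_def using num den den0 C1 Ck1 by (intro frac_le) auto
        also have "\<dots> = C3 * (n powr (\<epsilon> / 2) * n powr (2 * \<epsilon>) * n powr (4 - 16 * \<epsilon>) / (n powr 2 * n powr (2 * (1 - 2 * \<epsilon>))))"
        proof -
          have sqV: "(n powr x) ^ 2 = n powr (2 * x)" for x by (simp add: power2_eq_square pw)
          have n2: "n ^ 2 = n powr 2" using n1 by simp
          show ?thesis unfolding power_mult_distrib power_divide sqV n2 C3_def by simp
        qed
        also have "\<dots> = C3 * n powr (\<epsilon> / 2 + 2 * \<epsilon> + (4 - 16 * \<epsilon>) - (2 + 2 * (1 - 2 * \<epsilon>)))"
          by (simp only: pw powr_diff [symmetric])
        also have "\<dots> \<le> C3 * n powr (- 2 * \<epsilon>)" using C31 \<epsilon> by (intro mult_left_mono pm) auto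
        finally show ?thesis .
      qed
      have Y0: "Y \<ge> 0" unfolding Y_def using Ck1 by simp
      have Yk: "Y powr (1 / real (2 * k)) \<le> C3 * n powr (- \<delta>)"
      proof -
        have "Y powr (1 / real (2 * k)) \<le> (C3 * n powr (- 2 * \<epsilon>)) powr (1 / real (2 * k))"
          using Y Y0 by (intro powr_mono2) auto
        also have "\<dots> = C3 powr (1 / real (2 * k)) * n powr (- \<delta>)"
          using C31 k2 by (simp add: powr_mult powr_powr \<delta>_def)
        also have "\<dots> \<le> C3 powr 1 * n powr (- \<delta>)" using C31 k2 by (intro mult_right_mono powr_mono) auto
        finally show ?thesis using C31 by simp
      qed
      have good: "cmod (box_sum \<chi> N a b) \<le> (C3 + 4) * n powr (2 - \<delta>)"
        if ab: "a \<in> {1..N}" "b \<in> {1..N}" "M0 \<le> a div gcd a b" for a b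
      proof -
        have "N div (a div gcd a b) + 1 \<le> \<mu>" unfolding \<mu>_def using ab(3) M0(1) by (simp add: div_le_mono2)
        then have "cmod (box_sum \<chi> N a b) \<le> n ^ 2 * Y powr (1 / real (2 * k)) + 4 * n * real T * real V"
          unfolding box_sum_def Y_def Ck_def n_def
          using ab V(1) VN T(1) Tp small D1(1) Ddiv NV4 k_def Tk
          by (intro box_sum_bound[where D = D]) (auto intro!: Ddiv)
        also have "\<dots> \<le> n ^ 2 * (C3 * n powr (- \<delta>)) + 4 * n * n powr \<epsilon> * n powr (1 - 2 * \<epsilon>)"
          using Yk T(2) V(2) n1 by (intro add_mono mult_mono) auto
        also have "\<dots> = C3 * (n powr 2 * n powr (- \<delta>)) + 4 * (n powr 1 * n powr \<epsilon> * n powr (1 - 2 * \<epsilon>))"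
          using n1 by (simp add: mult_ac)
        also have "\<dots> = C3 * n powr (2 - \<delta>) + 4 * n powr (2 - \<epsilon>)" by (simp only: pw) simp
        also have "\<dots> \<le> C3 * n powr (2 - \<delta>) + 4 * n powr (2 - \<delta>)" using \<delta> \<epsilon> by (intro add_left_mono mult_left_mono pm) auto
        finally show ?thesis by (simp add: algebra_simps)
      qed
      define Q where "Q = {1..N} \<times> {1..N}"
      define bad where "bad = {(a, b). a \<in> {1..N} \<and> b \<in> {1..N} \<and> a div gcd a b < M0}"
      have finQ: "finite Q" by (simp add: Q_def)
      have badQ: "{z \<in> Q. z \<in> bad} = bad" by (auto simp: Q_def bad_def)
      have "card bad \<le> M0 * N * D"
        unfolding bad_def
      proof (rule card_small_reduced_numerator)
        fix m assume "m \<ge> 1" "m \<le> N"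
        then show "divisor_count m \<le> D" using \<open>N \<le> N ^ 4\<close> by (intro Ddiv) auto
      qed
      then have "real (card bad) \<le> real (M0 * N * D)" by (simp only: of_nat_le_iff)
      also have "\<dots> = real M0 * n * real D" by (simp add: n_def)
      also have "\<dots> \<le> n powr (1 - \<epsilon>) * n powr 1 * (2 * C1 * n powr (\<epsilon> / 2))"
        using M0(2) D2 n1 by (intro mult_mono) auto
      also have "\<dots> = 2 * C1 * (n powr (1 - \<epsilon>) * n powr 1 * n powr (\<epsilon> / 2))" by simp
      also have "\<dots> = 2 * C1 * n powr (2 - \<epsilon> / 2)" by (simp only: pw) simp
      also have "\<dots> \<le> 2 * C1 * n powr (2 - \<delta>)" using C1 \<delta> by (intro mult_left_mono pm) auto
      finally have cbad: "real (card bad) \<le> 2 * C1 * n powr (2 - \<delta>)" .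
      have "(\<Sum>a=1..N. \<Sum>b=1..N. cmod (box_sum \<chi> N a b)) = (\<Sum>z\<in>Q. cmod (box_sum \<chi> N (fst z) (snd z)))"
        by (simp add: Q_def sum.cartesian_product case_prod_unfold)
      also have "\<dots> \<le> (\<Sum>z\<in>Q. (C3 + 4) * n powr (2 - \<delta>) + (if z \<in> bad then n ^ 2 else 0))"
      proof (rule sum_mono)
        fix z assume "z \<in> Q"
        then obtain a b where z: "z = (a, b)" "a \<in> {1..N}" "b \<in> {1..N}" by (auto simp: Q_def)
        show "cmod (box_sum \<chi> N (fst z) (snd z)) \<le> (C3 + 4) * n powr (2 - \<delta>) + (if z \<in> bad then n ^ 2 else 0)"
        proof (cases "z \<in> bad")
          case True
          have "0 \<le> (C3 + 4) * n powr (2 - \<delta>)" using C31 by simp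
          then show ?thesis using norm_box_sum_le[of N a b] True by (simp add: z n_def)
        next
          case False
          then have "M0 \<le> a div gcd a b" using z by (auto simp: bad_def)
          then show ?thesis using good[of a b] z False by simp
        qed
      qed
      also have "\<dots> = real (card Q) * ((C3 + 4) * n powr (2 - \<delta>)) + (\<Sum>z\<in>{z \<in> Q. z \<in> bad}. n ^ 2)"
        using finQ by (simp add: sum.distrib sum.inter_filter [symmetric])
      also have "\<dots> = n ^ 2 * ((C3 + 4) * n powr (2 - \<delta>)) + real (card bad) * n ^ 2"
        unfolding badQ by (simp add: Q_def card_cartesian_product n_def power2_eq_square)
      also have "\<dots> \<le> n ^ 2 * ((C3 + 4) * n powr (2 - \<delta>)) + (2 * C1 * n powr (2 - \<delta>)) * n ^ 2"
        using cbad by (intro add_left_mono mult_right_mono) auto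
      also have "\<dots> = (C3 + 4 + 2 * C1) * (n powr 2 * n powr (2 - \<delta>))" using n1 by (simp add: algebra_simps)
      also have "\<dots> = (C3 + 4 + 2 * C1) * n powr (4 - \<delta>)" unfolding pw by simp
      also have "\<dots> \<le> C * n powr (4 - \<delta>)" by (intro mult_right_mono) (auto simp: C_def)
      finally show ?thesis by (simp add: n_def)
    qed
  qed
qed

text \<open>
A residue class contains at most \<open>N\<^sup>3 div p + 1\<close> possible products, and each has at most \<open>D\<^sup>2\<close> factorisations.
\<close>

lemma card_product_congruence_le:
  fixes N D p :: nat
  assumes p: "p > 0" and D: "\<And>m. m \<ge> 1 \<Longrightarrow> m \<le> N ^ 3 \<Longrightarrow> divisor_count m \<le> D"
  shows "card {((b, c), a). b \<in> {1..N} \<and> c \<in> {1..N} \<and> a \<in> {1..N} \<and> (b * c * a) mod p = r} \<le> (N ^ 3 div p + 1) * D ^ 2"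
proof -
  define S where "S = {((b, c), a). b \<in> {1..N} \<and> c \<in> {1..N} \<and> a \<in> {1..N} \<and> (b * c * a) mod p = r}"
  define R where "R = (SIGMA m:{m \<in> {1..N ^ 3}. m mod p = r}. {d. d dvd m} \<times> {d. d dvd m})"
  define \<Theta> where "\<Theta> = (\<lambda>((b, c), a). (b * c * a, (b, c)) :: nat \<times> nat \<times> nat)"
  have "inj_on \<Theta> S" by (auto simp: inj_on_def \<Theta>_def S_def)
  moreover have "\<Theta> ` S \<subseteq> R"
  proof
    fix z assume "z \<in> \<Theta> ` S"
    then obtain b c a where z: "z = (b * c * a, (b, c))" "b \<in> {1..N}" "c \<in> {1..N}" "a \<in> {1..N}" "(b * c * a) mod p = r"
      by (auto simp: S_def \<Theta>_def)
    have "b * c * a \<le> N * N * N" using z by (intro mult_le_mono) auto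
    moreover have "1 \<le> b * c * a" using z by simp
    ultimately show "z \<in> R" using z by (simp add: R_def power3_eq_cube)
  qed
  moreover have finR: "finite R" unfolding R_def by (intro finite_SigmaI finite_cartesian_product) auto
  ultimately have "card S \<le> card R" by (rule card_inj_on_le)
  also have "card R = (\<Sum>m\<in>{m \<in> {1..N ^ 3}. m mod p = r}. divisor_count m * divisor_count m)"
    unfolding R_def divisor_count_def by (subst card_SigmaI) (auto simp: card_cartesian_product)
  also have "\<dots> \<le> (\<Sum>m\<in>{m \<in> {1..N ^ 3}. m mod p = r}. D * D)"
    using D by (intro sum_mono mult_le_mono) auto
  also have "\<dots> = card {m \<in> {1..N ^ 3}. m mod p = r} * D ^ 2" by (simp add: power2_eq_square)
  also have "\<dots> \<le> (N ^ 3 div p + 1) * D ^ 2" using card_residue_class_le[OF p] by (intro mult_le_mono1)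
  finally show ?thesis by (simp add: S_def)
qed

text \<open>
Here \<open>x = - b c\<close>, \<open>y = a\<close> and the interval of summation is that of \<open>d\<close> itself. The fourth moment (\<open>k = 2\<close>) gives
\<open>B\<^sup>4 = O(D\<^sup>2 N\<^bsup>15\<^esup>)\<close>, and the divisor bound allows \<open>D = O(N\<^bsup>1/4\<^esup>)\<close>.
\<close>

lemma long_range_bound:
  obtains C where "C \<ge> 0"
    "\<And>p \<chi> N. prime p \<Longrightarrow> nonprincipal_character p \<chi> \<Longrightarrow> N \<ge> 1 \<Longrightarrow> N ^ 2 < p \<Longrightarrow> p \<le> 4 * N ^ 4
      \<Longrightarrow> (\<Sum>a=1..N. \<Sum>b=1..N. cmod (box_sum \<chi> N a b)) \<le> C * real N powr (4 - 1 / 8)"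
proof -
  obtain C1 where C1: "C1 \<ge> 1" "\<And>n. n \<ge> 1 \<Longrightarrow> real (divisor_count n) \<le> C1 * real n powr (1 / 12)"
    using divisor_bound[of "1 / 12"] by auto
  define C where "C = 108 * C1 ^ 2"
  have C: "C \<ge> 1" using one_le_power[OF C1(1), of 2] by (simp add: C_def)
  show ?thesis
  proof (rule that[of C])
    show "C \<ge> 0" using C by simp
    fix p :: nat and \<chi> :: "int \<Rightarrow> complex" and N :: nat
    assume p: "prime p" and chi: "nonprincipal_character p \<chi>" and N1: "N \<ge> 1" and Np: "N ^ 2 < p" and pN: "p \<le> 4 * N ^ 4"
    interpret char_p_character p \<chi> by unfold_locales (use p chi in auto)
    define n where "n = real N"
    define q where "q = sqrt (real p)"
    have n1: "n \<ge> 1" using N1 by (simp add: n_def)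
    have qq: "real p = q ^ 2" by (simp add: q_def)
    have nq: "n \<le> q" unfolding q_def
    proof (rule real_le_rsqrt)
      have "real (N ^ 2) \<le> real p" using Np by (simp only: of_nat_le_iff)
      then show "n\<^sup>2 \<le> real p" by (simp add: n_def)
    qed
    have q2: "q \<le> 2 * n ^ 2" unfolding q_def
    proof (rule real_le_lsqrt)
      have "real p \<le> real (4 * N ^ 4)" using pN by (simp only: of_nat_le_iff)
      then show "real p \<le> (2 * n\<^sup>2)\<^sup>2" by (simp add: n_def power_mult_distrib power_mult [symmetric])
    qed simp
    have q0: "q > 0" using nq n1 by linarith
    have "N * 1 \<le> N ^ 2" using N1 unfolding power2_eq_square by (intro mult_le_mono2)
    then have Np': "N < p" using Np by simp
    define I where "I = {1..N} \<times> {1..N}"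
    define J where "J = {1..N}"
    define x where "x = (\<lambda>(b, c). - (int b * int c))"
    define y where "y = (\<lambda>a::nat. int a)"
    define D where "D = nat \<lfloor>C1 * n powr (1 / 4)\<rfloor>"
    have D: "real D \<le> C1 * n powr (1 / 4)"
    proof -
      have "1 * 1 \<le> C1 * n powr (1 / 4)" using C1(1) n1 by (intro mult_mono ge_one_powr_ge_zero) auto
      then show ?thesis unfolding D_def using floor_between by simp
    qed
    have Ddiv: "divisor_count m \<le> D" if "m \<ge> 1" "m \<le> N ^ 3" for m
    proof -
      have "real m \<le> real (N ^ 3)" using that by (simp only: of_nat_le_iff)
      then have "real m powr (1 / 12) \<le> (n ^ 3) powr (1 / 12)" by (intro powr_mono2) (auto simp: n_def)
      also have "\<dots> = (n powr 3) powr (1 / 12)" using n1 by simp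
      also have "\<dots> = n powr (1 / 4)" unfolding powr_powr by simp
      finally have "C1 * real m powr (1 / 12) \<le> C1 * n powr (1 / 4)" using C1 by (intro mult_left_mono) auto
      then show ?thesis unfolding D_def using C1(2)[OF that(1)] by (intro le_nat_floor) linarith
    qed
    define Es where "Es = {((i, j), (i', j')). i \<in> I \<and> j \<in> J \<and> i' \<in> I \<and> j' \<in> J \<and> [x i * y j' = x i' * y j] (mod int p)}"
    define Fb where "Fb z = {((b, c), a). b \<in> {1..N} \<and> c \<in> {1..N} \<and> a \<in> {1..N} \<and>
        (b * c * a) mod p = (fst (fst z) * snd (fst z) * snd z) mod p}" for z :: "(nat \<times> nat) \<times> nat"
    have finFb: "finite (Fb z)" for z
      by (rule finite_subset[of _ "({1..N} \<times> {1..N}) \<times> {1..N}"]) (auto simp: Fb_def)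
    have cFb: "card (Fb z) \<le> (N ^ 3 div p + 1) * D ^ 2" for z
      unfolding Fb_def using p_gt_1 Ddiv by (intro card_product_congruence_le) auto
    define r where "r = (\<lambda>((i, j), (i', j')). ((i, j'), (i', j)) :: ((nat \<times> nat) \<times> nat) \<times> ((nat \<times> nat) \<times> nat))"
    have "inj_on r Es" by (auto simp: inj_on_def r_def)
    moreover have "r ` Es \<subseteq> (SIGMA z:I \<times> J. Fb z)"
    proof
      fix w assume "w \<in> r ` Es"
      then obtain b c a b' c' a' where w: "w = (((b, c), a'), ((b', c'), a))"
        and mem: "b \<in> {1..N}" "c \<in> {1..N}" "a \<in> {1..N}" "b' \<in> {1..N}" "c' \<in> {1..N}" "a' \<in> {1..N}"
        and cong: "[- (int b * int c) * int a' = - (int b' * int c') * int a] (mod int p)"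
        by (auto simp: Es_def r_def I_def J_def x_def y_def)
      have "[int (b * c * a') = int (b' * c' * a)] (mod int p)"
        using cong cong_minus_minus_iff[of "int (b * c * a')" "int (b' * c' * a)" "int p"] by simp
      then have "[b * c * a' = b' * c' * a] (mod p)" unfolding cong_int_iff .
      then have "(b' * c' * a) mod p = (b * c * a') mod p" by (simp only: cong_def)
      then show "w \<in> (SIGMA z:I \<times> J. Fb z)" using mem by (simp add: w I_def J_def Fb_def)
    qed
    moreover have "finite (SIGMA z:I \<times> J. Fb z)" using finFb by (intro finite_SigmaI) (auto simp: I_def J_def)
    ultimately have "card Es \<le> card (SIGMA z:I \<times> J. Fb z)" by (rule card_inj_on_le)
    also have "\<dots> = (\<Sum>z\<in>I \<times> J. card (Fb z))" using finFb by (simp add: I_def J_def)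
    also have "\<dots> \<le> card (I \<times> J) * ((N ^ 3 div p + 1) * D ^ 2)"
      using sum_bounded_above[of "I \<times> J" "\<lambda>z. card (Fb z)"] cFb by simp
    also have "card (I \<times> J) = N ^ 3" by (simp add: I_def J_def card_cartesian_product power3_eq_cube)
    finally have "real (card Es) \<le> real (N ^ 3 * ((N ^ 3 div p + 1) * D ^ 2))" by (simp only: of_nat_le_iff)
    also have "\<dots> = n ^ 3 * ((real (N ^ 3 div p) + 1) * real D ^ 2)" by (simp add: n_def algebra_simps)
    also have "\<dots> \<le> n ^ 3 * ((n ^ 3 / q ^ 2 + 1) * real D ^ 2)"
    proof -
      have "real (N ^ 3 div p) \<le> real (N ^ 3) / real p" by (rule of_nat_div_le_of_nat)
      then have "real (N ^ 3 div p) \<le> n ^ 3 / q ^ 2" by (simp only: qq of_nat_power n_def)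
      then show ?thesis using n1 by (intro mult_left_mono mult_right_mono add_right_mono) auto
    qed
    finally have Es: "real (card Es) \<le> n ^ 3 * ((n ^ 3 / q ^ 2 + 1) * real D ^ 2)" .
    define B where "B = (\<Sum>i\<in>I. \<Sum>j\<in>J. cmod (\<Sum>t=1..N. \<chi> (x i + int t * y j)))"
    have B0: "B \<ge> 0" unfolding B_def by (intro sum_nonneg) simp
    have cIJ: "real (card I * card J) = n ^ 3" by (simp add: I_def J_def card_cartesian_product n_def power3_eq_cube)
    have "B ^ (2 * 2) \<le> real (card I * card J) ^ (2 * 2 - 2) * (n ^ 3 * ((n ^ 3 / q ^ 2 + 1) * real D ^ 2)) *
       (real (2 ^ (2 * 2)) * real N ^ 2 * real p + 2 * real 2 * real N ^ (2 * 2) * sqrt (real p))"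
      unfolding B_def
    proof (rule burgess_inequality[where k = 2 and s = 1])
      show "finite I" "finite J" by (simp_all add: I_def J_def)
      show "\<not> int p dvd y j" if "j \<in> J" for j
        using that Np' by (auto simp: J_def y_def dest: dvd_imp_le)
      show "N \<le> p" using Np' by simp
      show "real (card {((i, j), (i', j')). i \<in> I \<and> j \<in> J \<and> i' \<in> I \<and> j' \<in> J \<and> [x i * y j' = x i' * y j] (mod int p)})
        \<le> n ^ 3 * ((n ^ 3 / q ^ 2 + 1) * real D ^ 2)" using Es by (simp add: Es_def)
    qed simp
    then have "B ^ 4 \<le> (n ^ 3) ^ 2 * (n ^ 3 * ((n ^ 3 / q ^ 2 + 1) * real D ^ 2)) * (16 * n ^ 2 * q ^ 2 + 4 * n ^ 4 * q)"
      using q0 unfolding cIJ by (simp add: n_def [symmetric] q_def [symmetric] qq)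
    also have "\<dots> \<le> (n ^ 3) ^ 2 * (n ^ 3 * ((n ^ 3 / q ^ 2 + 1) * real D ^ 2)) * (36 * n ^ 4 * q)"
    proof (rule mult_left_mono)
      have "(16 * n ^ 2 * q) * q \<le> (16 * n ^ 2 * q) * (2 * n ^ 2)" using q2 q0 by (intro mult_left_mono) auto
      then show "16 * n ^ 2 * q ^ 2 + 4 * n ^ 4 * q \<le> 36 * n ^ 4 * q"
        by (simp add: power2_eq_square power4_eq_xxxx mult_ac)
      show "0 \<le> (n ^ 3) ^ 2 * (n ^ 3 * ((n ^ 3 / q ^ 2 + 1) * real D ^ 2))" using n1 by simp
    qed
    also have "\<dots> = 36 * n ^ 13 * real D ^ 2 * (n ^ 3 / q + q)"
    proof -
      have "(n ^ 3 / q ^ 2 + 1) * q = n ^ 3 / q + q" using q0 by (simp add: field_simps power2_eq_square)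
      moreover have "(n ^ 3) ^ 2 * (n ^ 3 * ((n ^ 3 / q ^ 2 + 1) * real D ^ 2)) * (36 * n ^ 4 * q)
        = 36 * ((n ^ 3) ^ 2 * n ^ 3 * n ^ 4) * real D ^ 2 * ((n ^ 3 / q ^ 2 + 1) * q)" by (simp only: mult_ac)
      moreover have "(n ^ 3) ^ 2 * n ^ 3 * n ^ 4 = n ^ 13" by (simp add: power_mult [symmetric] power_add [symmetric])
      ultimately show ?thesis by simp
    qed
    also have "\<dots> \<le> 36 * n ^ 13 * (C1 * n powr (1 / 4)) ^ 2 * (n ^ 2 + 2 * n ^ 2)"
    proof (intro mult_mono power_mono add_mono D q2)
      have "n ^ 3 / q \<le> n ^ 3 / n" using nq n1 q0 by (intro divide_left_mono) auto
      then show "n ^ 3 / q \<le> n ^ 2" using n1 by (simp add: power3_eq_cube power2_eq_square)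
    qed (use n1 q0 C1 in auto)
    also have "\<dots> = C * (n ^ 15 * n powr (1 / 2))"
    proof -
      have "(C1 * n powr (1 / 4)) ^ 2 = C1 ^ 2 * n powr (1 / 2)"
        by (simp add: power_mult_distrib power2_eq_square powr_add [symmetric])
      moreover have "n ^ 15 = n ^ 13 * n ^ 2" by (simp add: power_add [symmetric])
      ultimately show ?thesis by (simp add: C_def)
    qed
    also have "\<dots> = C * (n powr (4 - 1 / 8)) ^ 4"
    proof -
      have "n ^ 15 * n powr (1 / 2) = n powr 15 * n powr (1 / 2)" using n1 by simp
      also have "\<dots> = n powr ((4 - 1 / 8) * real 4)" unfolding powr_add [symmetric] by simp
      also have "\<dots> = (n powr (4 - 1 / 8)) powr real 4" by (simp only: powr_powr)
      also have "\<dots> = (n powr (4 - 1 / 8)) ^ 4" using n1 by (subst powr_realpow) auto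
      finally show ?thesis by simp
    qed
    also have "\<dots> \<le> C ^ 4 * (n powr (4 - 1 / 8)) ^ 4"
      using C self_le_power[OF C, of 4] by (intro mult_right_mono) auto
    finally have "B ^ 4 \<le> (C * n powr (4 - 1 / 8)) ^ 4" by (simp only: power_mult_distrib)
    then have B: "B \<le> C * n powr (4 - 1 / 8)"
      by (subst (asm) power_mono_iff) (use B0 C in auto)
    have "(\<Sum>a=1..N. \<Sum>b=1..N. cmod (box_sum \<chi> N a b)) \<le>
        (\<Sum>a=1..N. \<Sum>b=1..N. \<Sum>c=1..N. cmod (\<Sum>d=1..N. \<chi> (int a * int d - int b * int c)))"
      unfolding box_sum_def by (intro sum_mono norm_sum)
    also have "\<dots> = (\<Sum>a=1..N. \<Sum>i\<in>I. cmod (\<Sum>d=1..N. \<chi> (x i + int d * y a)))"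
      unfolding I_def by (subst sum.cartesian_product) (simp add: x_def y_def case_prod_unfold mult.commute)
    also have "\<dots> = B" unfolding B_def J_def by (rule sum.swap)
    finally show "(\<Sum>a=1..N. \<Sum>b=1..N. cmod (box_sum \<chi> N a b)) \<le> C * real N powr (4 - 1 / 8)"
      using B by (simp add: n_def)
  qed
qed

theorem theorem1p4:
  shows "\<forall>\<epsilon>::real. \<epsilon> > 0 \<longrightarrow> (\<exists>\<delta>\<^sub>0::real. \<delta>\<^sub>0 > 0 \<and>
    (\<forall>K::real. K > 0 \<longrightarrow> (\<exists>C::real. C > 0 \<and>
      (\<forall>(p::nat) (\<chi>::int \<Rightarrow> complex) (N::nat) (\<alpha>::nat \<Rightarrow> complex) (\<beta>::nat \<Rightarrow> complex).
        prime p \<longrightarrow>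
        nonprincipal_character p \<chi> \<longrightarrow>
        real p powr (1/8 + \<epsilon>) \<le> real N \<longrightarrow>
        real N < real p powr (1/2) \<longrightarrow>
        (\<forall>a\<ge>1. cmod (\<alpha> a) \<le> K) \<longrightarrow>
        (\<forall>b\<ge>1. cmod (\<beta> b) \<le> K) \<longrightarrow>
        cmod (U_sum \<chi> \<alpha> \<beta> N) \<le> C * real N powr (4 - \<delta>\<^sub>0)))))"
proof (intro allI impI, goal_cases)
  case (1 \<epsilon>)
  \<comment> \<open>The bound \<open>\<surd>p \<le> N powr (4 - 16 * \<epsilon>)\<close> behind the short range needs \<open>\<epsilon> \<le> 1 / 8\<close>.\<close>
  define \<epsilon>' where "\<epsilon>' = min \<epsilon> (1 / 8)"
  have \<epsilon>': "0 < \<epsilon>'" "\<epsilon>' \<le> 1 / 8" "\<epsilon>' \<le> \<epsilon>" using 1 by (auto simp: \<epsilon>'_def)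
  obtain \<delta> CA where \<delta>: "\<delta> > 0" and CA: "CA \<ge> 0"
    "\<And>p \<chi> N. prime p \<Longrightarrow> nonprincipal_character p \<chi> \<Longrightarrow> real p powr (1/8 + \<epsilon>') \<le> real N \<Longrightarrow> 4 * N ^ 4 < p
      \<Longrightarrow> (\<Sum>a=1..N. \<Sum>b=1..N. cmod (box_sum \<chi> N a b)) \<le> CA * real N powr (4 - \<delta>)"
    using short_range_bound[OF \<epsilon>'(1,2)] by blast
  obtain CB where CB: "CB \<ge> 0"
    "\<And>p \<chi> N. prime p \<Longrightarrow> nonprincipal_character p \<chi> \<Longrightarrow> N \<ge> 1 \<Longrightarrow> N ^ 2 < p \<Longrightarrow> p \<le> 4 * N ^ 4
      \<Longrightarrow> (\<Sum>a=1..N. \<Sum>b=1..N. cmod (box_sum \<chi> N a b)) \<le> CB * real N powr (4 - 1 / 8)"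
    using long_range_bound by blast
  define \<delta>\<^sub>0 where "\<delta>\<^sub>0 = min \<delta> (1 / 8)"
  have bound: "cmod (U_sum \<chi> \<alpha> \<beta> N) \<le> K ^ 2 * (CA + CB + 1) * real N powr (4 - \<delta>\<^sub>0)"
    if K: "K > 0" and p: "prime p" and chi: "nonprincipal_character p \<chi>"
      and lo: "real p powr (1/8 + \<epsilon>) \<le> real N" and hi: "real N < real p powr (1/2)"
      and \<alpha>: "\<forall>a\<ge>1. cmod (\<alpha> a) \<le> K" and \<beta>: "\<forall>b\<ge>1. cmod (\<beta> b) \<le> K"
    for K :: real and p N :: nat and \<chi> \<alpha> \<beta>
  proof -
    have p1: "real p \<ge> 1" using prime_gt_0_nat[OF p] by simp
    have "0 < real p powr (1/8 + \<epsilon>)" using p1 by simp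
    then have N1: "N \<ge> 1" using lo by linarith
    have lo': "real p powr (1/8 + \<epsilon>') \<le> real N"
      using lo powr_mono[of "1/8 + \<epsilon>'" "1/8 + \<epsilon>" "real p"] \<epsilon>'(3) p1 by linarith
    have "real N < sqrt (real p)" using hi p1 by (simp add: powr_half_sqrt)
    then have "real N ^ 2 < sqrt (real p) ^ 2" by (intro power_strict_mono) auto
    then have "real (N ^ 2) < real p" by simp
    then have hi': "N ^ 2 < p" by (simp only: of_nat_less_iff)
    have mono: "real N powr (4 - t) \<le> real N powr (4 - \<delta>\<^sub>0)" if "\<delta>\<^sub>0 \<le> t" for t
      using that N1 by (intro powr_mono) auto
    define S where "S = (\<Sum>a=1..N. \<Sum>b=1..N. cmod (box_sum \<chi> N a b))"
    have "S \<le> (CA + CB + 1) * real N powr (4 - \<delta>\<^sub>0)"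
    proof (cases "4 * N ^ 4 < p")
      case True
      have "S \<le> CA * real N powr (4 - \<delta>)" unfolding S_def by (rule CA(2)[OF p chi lo' True])
      also have "\<dots> \<le> (CA + CB + 1) * real N powr (4 - \<delta>\<^sub>0)"
        using CA(1) CB(1) by (intro mult_mono mono) (auto simp: \<delta>\<^sub>0_def)
      finally show ?thesis .
    next
      case False
      have "S \<le> CB * real N powr (4 - 1 / 8)"
        unfolding S_def using False by (intro CB(2)[OF p chi N1 hi']) simp
      also have "\<dots> \<le> (CA + CB + 1) * real N powr (4 - \<delta>\<^sub>0)"
        using CA(1) CB(1) by (intro mult_mono mono) (auto simp: \<delta>\<^sub>0_def)
      finally show ?thesis .
    qed
    then have "K ^ 2 * S \<le> K ^ 2 * ((CA + CB + 1) * real N powr (4 - \<delta>\<^sub>0))"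
      by (intro mult_left_mono) auto
    moreover have "cmod (U_sum \<chi> \<alpha> \<beta> N) \<le> K ^ 2 * S"
      unfolding S_def using \<alpha> \<beta> K by (intro U_sum_le) auto
    ultimately show ?thesis by (simp add: mult.assoc)
  qed
  show ?case
  proof (rule exI[of _ \<delta>\<^sub>0], intro conjI allI impI, goal_cases)
    case 1
    show ?case using \<delta> by (simp add: \<delta>\<^sub>0_def)
  next
    case (2 K)
    show ?case
    proof (rule exI[of _ "K ^ 2 * (CA + CB + 1)"], intro conjI allI impI, goal_cases)
      case 1
      show ?case using 2 CA(1) CB(1) by simp
    next
      case (2 p \<chi> N \<alpha> \<beta>)
      then show ?case by (intro bound \<open>K > 0\<close>)
    qed
  qed
qed

end
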